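(* Let $\Omega\subset\mathbb{R}^2$ be a bounded open set with Lipschitz boundary, let $h:[0,1]\to\mathbb{R}$ be a bounded Borel function and let $f(u,v)=h(|u\cdot v|)$ for $u,v\in S^1$. Let $F_\varepsilon:L^\infty(\Omega;\mathbb{M}^{2\times2}_{sym})\to\mathbb{R}\cup\{\infty\}$ be defined by $$F_\varepsilon(Q)=\sum_{|i-j|=1}\varepsilon^2f(u_i,u_j)\quad\text{if }Q\in C_\varepsilon(\Omega;S^1_\otimes),\ Q(\varepsilon i)=u_i\otimes u_i\ (u_i\in S^1,\ i\in\mathbb{Z}_\varepsilon(\Omega)),$$ and $F_\varepsilon(Q)=+\infty$ otherwise. Then, as $\varepsilon\to0$, $F_\varepsilon$ $\Gamma$-converges with respect to the weak$^*$ topology of $L^\infty(\Omega;\mathbb{M}^{2\times2}_{sym})$ to the functional $F$ defined by $$F(Q)=4\int_\Omega h^{++}\bigl(\sqrt2\,|Q(x)-\tfrac12I|\bigr)\,dx\ \text{ if }Q\in L^\infty(\Omega;K),\qquad F(Q)=+\infty\ \text{ otherwise,}$$ where $h^{++}:[0,1]\to\mathbb{R}$ is the nondecreasing convex lower semicontinuous envelope of $h$.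
   Context: $\mathbb{M}^{2\times2}_{sym}$ is the space of symmetric $2\times2$ real matrices with the Frobenius norm $|\cdot|$, $I$ the identity, $K=\{Q\in\mathbb{M}^{2\times2}_{sym}:Q\ge0,\ \mathrm{tr}\,Q=1\}$, $S^1_\otimes=\{v\otimes v:v\in S^1\}$. $\mathbb{Z}_\varepsilon(\Omega)=\{i\in\mathbb{Z}^2:\varepsilon i\in\Omega\}$, $W=[-\frac12,\frac12)^2$, and $C_\varepsilon(\Omega;S^1_\otimes)=\{Q:\Omega\to S^1_\otimes:\ Q(x)=Q(\varepsilon i)\text{ if }x\in\varepsilon\{i+W\},\ i\in\mathbb{Z}_\varepsilon(\Omega)\}$. The sum over $|i-j|=1$ runs over all ordered pairs $(i,j)\in\mathbb{Z}_\varepsilon(\Omega)^2$ with $|i-j|=1$. The nondecreasing convex lower semicontinuous envelope $h^{++}$ of $h$ is the largest nondecreasing convex lower semicontinuous function on $[0,1]$ that is below $h$ at every point of $[0,1]$. *)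

theory Defs
  imports "HOL-Analysis.Analysis"
begin

section \<open>Gamma-convergence in a topological space\<close>

text \<open>The lower and upper Gamma-limits of a family of extended real functionals, indexed by a
  parameter tending along the filter \<open>G\<close>, with respect to a topology \<open>T\<close>.\<close>

definition Gamma_liminf :: "'a topology \<Rightarrow> 'p filter \<Rightarrow> ('p \<Rightarrow> 'a \<Rightarrow> ereal) \<Rightarrow> 'a \<Rightarrow> ereal" where
  "Gamma_liminf T G F x =
     (SUP U\<in>{U. openin T U \<and> x \<in> U}. Liminf G (\<lambda>e. INF y\<in>U. F e y))"

definition Gamma_limsup :: "'a topology \<Rightarrow> 'p filter \<Rightarrow> ('p \<Rightarrow> 'a \<Rightarrow> ereal) \<Rightarrow> 'a \<Rightarrow> ereal" where
  "Gamma_limsup T G F x =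
     (SUP U\<in>{U. openin T U \<and> x \<in> U}. Limsup G (\<lambda>e. INF y\<in>U. F e y))"

definition Gamma_converges ::
    "'a topology \<Rightarrow> 'p filter \<Rightarrow> ('p \<Rightarrow> 'a \<Rightarrow> ereal) \<Rightarrow> ('a \<Rightarrow> ereal) \<Rightarrow> bool" where
  "Gamma_converges T G F F0 \<longleftrightarrow>
     (\<forall>x\<in>topspace T. Gamma_liminf T G F x = F0 x \<and> Gamma_limsup T G F x = F0 x)"

section \<open>Lipschitz boundary\<close>

text \<open>Near each boundary point, in suitable orthonormal coordinates \<open>(y \<bullet> a, y \<bullet> b)\<close>, the set is
  the strict epigraph of a Lipschitz function. A Lipschitz function on an interval extends to the
  line with the same constant, so taking \<open>\<gamma>\<close> on \<open>UNIV\<close> is no restriction.\<close>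

definition lipschitz_boundary :: "(real^2) set \<Rightarrow> bool" where
  "lipschitz_boundary \<Omega> \<longleftrightarrow>
     (\<forall>x\<in>frontier \<Omega>. \<exists>r>0. \<exists>a b. \<exists>\<gamma> :: real \<Rightarrow> real. \<exists>L.
        norm a = 1 \<and> norm b = 1 \<and> a \<bullet> b = 0 \<and> L-lipschitz_on UNIV \<gamma> \<and>
        \<Omega> \<inter> ball x r = {y \<in> ball x r. \<gamma> (y \<bullet> a) < y \<bullet> b})"

section \<open>Q-tensors\<close>

text \<open>On \<^typ>\<open>real^2^2\<close> the library norm is the Frobenius norm and \<open>A \<bullet> B\<close> is the sum of
  \<open>A $ i $ j * B $ i $ j\<close>.\<close>

definition tensor :: "real^2 \<Rightarrow> real^2 \<Rightarrow> real^2^2" where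
  "tensor u v = (\<chi> i j. u $ i * v $ j)"

definition S1_tensor :: "(real^2^2) set" where
  "S1_tensor = {tensor v v | v. norm v = 1}"

definition sym_matrices :: "(real^2^2) set" where
  "sym_matrices = {Q. transpose Q = Q}"

definition K_set :: "(real^2^2) set" where
  "K_set = {Q \<in> sym_matrices. (\<forall>v. 0 \<le> v \<bullet> (Q *v v)) \<and> trace Q = 1}"

section \<open>The space of essentially bounded matrix fields and its weak* topology\<close>

text \<open>Fields are represented by functions rather than by classes modulo equality almost everywhere
  (values outside \<open>\<Omega>\<close> are irrelevant). The topology below and all functionals considered
  are invariant under changes on null sets, hence so is Gamma-convergence.\<close>

definition Linf :: "(real^2) set \<Rightarrow> (real^2^2) set \<Rightarrow> (real^2 \<Rightarrow> real^2^2) set" where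
  "Linf \<Omega> A = {Q \<in> borel_measurable (lebesgue_on \<Omega>).
     (AE x in lebesgue_on \<Omega>. Q x \<in> A) \<and> (\<exists>C. AE x in lebesgue_on \<Omega>. norm (Q x) \<le> C)}"

definition L1_sym :: "(real^2) set \<Rightarrow> (real^2 \<Rightarrow> real^2^2) set" where
  "L1_sym \<Omega> = {\<phi>. integrable (lebesgue_on \<Omega>) \<phi> \<and> (AE x in lebesgue_on \<Omega>. \<phi> x \<in> sym_matrices)}"

text \<open>The coarsest topology making all pairings with elements of the predual continuous.\<close>

definition weak_star :: "(real^2) set \<Rightarrow> (real^2 \<Rightarrow> real^2^2) topology" where
  "weak_star \<Omega> = topology_generated_by
     {{Q \<in> Linf \<Omega> sym_matrices. (\<integral>x. Q x \<bullet> \<phi> x \<partial>lebesgue_on \<Omega>) \<in> V} | \<phi> V.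
        \<phi> \<in> L1_sym \<Omega> \<and> open V}"

lemma topspace_weak_star: "topspace (weak_star \<Omega>) = Linf \<Omega> sym_matrices"
proof -
  have "(\<lambda>x. 0) \<in> L1_sym \<Omega>"
    by (simp add: L1_sym_def sym_matrices_def transpose_def vec_eq_iff)
  moreover have "Linf \<Omega> sym_matrices =
      {Q \<in> Linf \<Omega> sym_matrices. (\<integral>x. Q x \<bullet> 0 \<partial>lebesgue_on \<Omega>) \<in> UNIV}"
    by simp
  ultimately have "Linf \<Omega> sym_matrices \<in>
      {{Q \<in> Linf \<Omega> sym_matrices. (\<integral>x. Q x \<bullet> \<phi> x \<partial>lebesgue_on \<Omega>) \<in> V} | \<phi> V.
        \<phi> \<in> L1_sym \<Omega> \<and> open V}"
    using open_UNIV by blast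
  then show ?thesis
    unfolding weak_star_def topology_generated_by_topspace by (intro equalityI Union_upper Union_least) auto
qed

section \<open>The discrete energies\<close>

text \<open>The lattice \<open>\<int>\<^sup>2\<close> is the set of vectors of \<^typ>\<open>real^2\<close> with integer coordinates.\<close>

definition lattice_pts :: "real \<Rightarrow> (real^2) set \<Rightarrow> (real^2) set" where
  "lattice_pts \<epsilon> \<Omega> = {i. (\<forall>k. i $ k \<in> \<int>) \<and> \<epsilon> *\<^sub>R i \<in> \<Omega>}"

definition unit_cell :: "(real^2) set" where
  "unit_cell = {w. \<forall>k. - 1 / 2 \<le> w $ k \<and> w $ k < 1 / 2}"

definition C_eps :: "real \<Rightarrow> (real^2) set \<Rightarrow> (real^2 \<Rightarrow> real^2^2) set" where
  "C_eps \<epsilon> \<Omega> = {Q. (\<forall>x\<in>\<Omega>. Q x \<in> S1_tensor) \<and>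
     (\<forall>i\<in>lattice_pts \<epsilon> \<Omega>. \<forall>x\<in>\<Omega>. x \<in> (\<lambda>w. \<epsilon> *\<^sub>R (i + w)) ` unit_cell \<longrightarrow> Q x = Q (\<epsilon> *\<^sub>R i))}"

definition neighbours :: "real \<Rightarrow> (real^2) set \<Rightarrow> ((real^2) \<times> (real^2)) set" where
  "neighbours \<epsilon> \<Omega> = {(i, j). i \<in> lattice_pts \<epsilon> \<Omega> \<and> j \<in> lattice_pts \<epsilon> \<Omega> \<and> norm (i - j) = 1}"

text \<open>\<open>director_field \<epsilon> \<Omega> Q u\<close>: the class of \<open>Q\<close> modulo equality almost everywhere contains some
  \<open>P\<close> in \<open>C_eps \<epsilon> \<Omega>\<close>, and \<open>P (\<epsilon> i) = u i \<otimes> u i\<close> with unit vectors \<open>u i\<close>.\<close>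

definition director_field ::
    "real \<Rightarrow> (real^2) set \<Rightarrow> (real^2 \<Rightarrow> real^2^2) \<Rightarrow> (real^2 \<Rightarrow> real^2) \<Rightarrow> bool" where
  "director_field \<epsilon> \<Omega> Q u \<longleftrightarrow> (\<exists>P\<in>C_eps \<epsilon> \<Omega>. (AE x in lebesgue_on \<Omega>. P x = Q x) \<and>
     (\<forall>i\<in>lattice_pts \<epsilon> \<Omega>. norm (u i) = 1 \<and> P (\<epsilon> *\<^sub>R i) = tensor (u i) (u i)))"

text \<open>The set below has at most one element when \<open>f u v\<close> depends only on \<open>u \<otimes> u\<close> and \<open>v \<otimes> v\<close>
  (lemma \<open>F_eps_eq\<close>), and the infimum of the empty set is \<open>\<infinity>\<close> (lemma \<open>F_eps_infinity\<close>).\<close>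

definition F_eps ::
    "(real^2 \<Rightarrow> real^2 \<Rightarrow> real) \<Rightarrow> (real^2) set \<Rightarrow> real \<Rightarrow> (real^2 \<Rightarrow> real^2^2) \<Rightarrow> ereal" where
  "F_eps f \<Omega> \<epsilon> Q =
     Inf {ereal (\<Sum>(i, j)\<in>neighbours \<epsilon> \<Omega>. \<epsilon>\<^sup>2 * f (u i) (u j)) | u. director_field \<epsilon> \<Omega> Q u}"

lemma C_eps_directors:
  assumes "P \<in> C_eps \<epsilon> \<Omega>"
  obtains u where "\<And>i. i \<in> lattice_pts \<epsilon> \<Omega> \<Longrightarrow> norm (u i) = 1 \<and> P (\<epsilon> *\<^sub>R i) = tensor (u i) (u i)"
proof -
  have "\<forall>i\<in>lattice_pts \<epsilon> \<Omega>. \<exists>v. norm v = 1 \<and> P (\<epsilon> *\<^sub>R i) = tensor v v"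
  proof
    fix i assume "i \<in> lattice_pts \<epsilon> \<Omega>"
    then have "P (\<epsilon> *\<^sub>R i) \<in> S1_tensor" using assms by (simp add: C_eps_def lattice_pts_def)
    then show "\<exists>v. norm v = 1 \<and> P (\<epsilon> *\<^sub>R i) = tensor v v" by (auto simp: S1_tensor_def)
  qed
  from bchoice[OF this] show thesis using that by blast
qed

lemma F_eps_infinity:
  assumes "\<not> (\<exists>P\<in>C_eps \<epsilon> \<Omega>. AE x in lebesgue_on \<Omega>. P x = Q x)"
  shows "F_eps f \<Omega> \<epsilon> Q = \<infinity>"
proof -
  have "\<not> director_field \<epsilon> \<Omega> Q u" for u
    using assms by (auto simp: director_field_def)
  then show ?thesis by (simp add: F_eps_def top_ereal_def)
qed

lemma inner_tensor: "tensor u u \<bullet> tensor v v = (u \<bullet> v)\<^sup>2"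
  by (simp add: tensor_def inner_vec_def sum_2 power2_eq_square algebra_simps)

lemma C_eps_AE_eq:
  assumes "open \<Omega>" "\<epsilon> > 0" "P \<in> C_eps \<epsilon> \<Omega>" "P' \<in> C_eps \<epsilon> \<Omega>"
    and ae: "AE x in lebesgue_on \<Omega>. P x = P' x" and i: "i \<in> lattice_pts \<epsilon> \<Omega>"
  shows "P (\<epsilon> *\<^sub>R i) = P' (\<epsilon> *\<^sub>R i)"
proof (rule ccontr)
  assume ne: "P (\<epsilon> *\<^sub>R i) \<noteq> P' (\<epsilon> *\<^sub>R i)"
  from i \<open>open \<Omega>\<close> obtain r where r: "r > 0" "ball (\<epsilon> *\<^sub>R i) r \<subseteq> \<Omega>"
    by (auto simp: lattice_pts_def open_contains_ball)
  define s where "s = min r (\<epsilon> / 2)"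
  have s: "s > 0" "ball (\<epsilon> *\<^sub>R i) s \<subseteq> \<Omega>" using r \<open>\<epsilon> > 0\<close> by (auto simp: s_def)
  have bad: "P x \<noteq> P' x" if x: "x \<in> ball (\<epsilon> *\<^sub>R i) s" for x
  proof -
    define w where "w = (1 / \<epsilon>) *\<^sub>R (x - \<epsilon> *\<^sub>R i)"
    have xw: "x = \<epsilon> *\<^sub>R (i + w)" using \<open>\<epsilon> > 0\<close> by (simp add: w_def algebra_simps)
    have "norm (x - \<epsilon> *\<^sub>R i) < \<epsilon> / 2" using x by (simp add: s_def dist_norm norm_minus_commute)
    moreover have "norm w = norm (x - \<epsilon> *\<^sub>R i) / \<epsilon>" using \<open>\<epsilon> > 0\<close> by (simp add: w_def)
    ultimately have "norm w < 1 / 2" using \<open>\<epsilon> > 0\<close> by (simp add: divide_less_eq)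
    then have "\<bar>w $ k\<bar> < 1 / 2" for k using component_le_norm_cart[of w k] by linarith
    then have "- 1 / 2 \<le> w $ k \<and> w $ k < 1 / 2" for k
      using abs_less_iff[of "w $ k" "1 / 2"] by (simp add: less_imp_le minus_less_iff)
    then have "w \<in> unit_cell" by (simp add: unit_cell_def)
    then have "x \<in> (\<lambda>w. \<epsilon> *\<^sub>R (i + w)) ` unit_cell" using xw by blast
    moreover have "x \<in> \<Omega>" using x s(2) by blast
    ultimately have "P x = P (\<epsilon> *\<^sub>R i)" "P' x = P' (\<epsilon> *\<^sub>R i)"
      using assms(3,4) i unfolding C_eps_def by blast+
    with ne show ?thesis by simp
  qed
  have "\<Omega> \<in> sets lebesgue" using \<open>open \<Omega>\<close> by (simp add: sets_completionI_sets)
  then have "AE x in lebesgue. x \<in> \<Omega> \<longrightarrow> P x = P' x" using ae by (simp add: AE_restrict_space_iff)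
  then have "AE x in lebesgue. x \<notin> ball (\<epsilon> *\<^sub>R i) s" by eventually_elim (use bad s(2) in auto)
  then have "ball (\<epsilon> *\<^sub>R i) s \<in> null_sets lebesgue"
    by (simp add: AE_iff_null_sets)
  then have "negligible (ball (\<epsilon> *\<^sub>R i) s)" by (simp add: negligible_iff_null_sets)
  then show False using s(1) open_not_negligible[OF open_ball, of "\<epsilon> *\<^sub>R i" s] by simp
qed

lemma F_eps_eq:
  assumes "open \<Omega>" "\<epsilon> > 0" and f: "\<And>u v. norm u = 1 \<Longrightarrow> norm v = 1 \<Longrightarrow> f u v = h \<bar>u \<bullet> v\<bar>"
    and u: "director_field \<epsilon> \<Omega> Q u"
  shows "F_eps f \<Omega> \<epsilon> Q = ereal (\<Sum>(i, j)\<in>neighbours \<epsilon> \<Omega>. \<epsilon>\<^sup>2 * f (u i) (u j))"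
proof -
  have "(\<Sum>(i, j)\<in>neighbours \<epsilon> \<Omega>. \<epsilon>\<^sup>2 * f (w i) (w j)) =
        (\<Sum>(i, j)\<in>neighbours \<epsilon> \<Omega>. \<epsilon>\<^sup>2 * f (u i) (u j))" if w: "director_field \<epsilon> \<Omega> Q w" for w
  proof -
    obtain P where P: "P \<in> C_eps \<epsilon> \<Omega>" "AE x in lebesgue_on \<Omega>. P x = Q x"
      "\<And>i. i \<in> lattice_pts \<epsilon> \<Omega> \<Longrightarrow> norm (u i) = 1 \<and> P (\<epsilon> *\<^sub>R i) = tensor (u i) (u i)"
      using u by (auto simp: director_field_def)
    obtain P' where P': "P' \<in> C_eps \<epsilon> \<Omega>" "AE x in lebesgue_on \<Omega>. P' x = Q x"
      "\<And>i. i \<in> lattice_pts \<epsilon> \<Omega> \<Longrightarrow> norm (w i) = 1 \<and> P' (\<epsilon> *\<^sub>R i) = tensor (w i) (w i)"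
      using w by (auto simp: director_field_def)
    have "AE x in lebesgue_on \<Omega>. P x = P' x" using P(2) P'(2) by eventually_elim simp
    then have t: "tensor (u i) (u i) = tensor (w i) (w i)" if "i \<in> lattice_pts \<epsilon> \<Omega>" for i
      using C_eps_AE_eq[OF assms(1,2) P(1) P'(1) _ that] P(3)[OF that] P'(3)[OF that] by simp
    have "f (w i) (w j) = f (u i) (u j)" if ij: "i \<in> lattice_pts \<epsilon> \<Omega>" "j \<in> lattice_pts \<epsilon> \<Omega>" for i j
    proof -
      have "(w i \<bullet> w j)\<^sup>2 = (u i \<bullet> u j)\<^sup>2" 
        using t[OF ij(1)] t[OF ij(2)] by (simp flip: inner_tensor)
      then have "\<bar>w i \<bullet> w j\<bar> = \<bar>u i \<bullet> u j\<bar>" by (simp add: power2_eq_iff abs_eq_iff)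
      then show ?thesis using f P(3) P'(3) ij by simp
    qed
    then show ?thesis by (intro sum.cong) (auto simp: neighbours_def)
  qed
  note sums = this
  show ?thesis unfolding F_eps_def
  proof (rule antisym)
    show "Inf {ereal (\<Sum>(i, j)\<in>neighbours \<epsilon> \<Omega>. \<epsilon>\<^sup>2 * f (w i) (w j)) | w. director_field \<epsilon> \<Omega> Q w}
        \<le> ereal (\<Sum>(i, j)\<in>neighbours \<epsilon> \<Omega>. \<epsilon>\<^sup>2 * f (u i) (u j))"
      using u by (intro Inf_lower) blast
    show "ereal (\<Sum>(i, j)\<in>neighbours \<epsilon> \<Omega>. \<epsilon>\<^sup>2 * f (u i) (u j))
        \<le> Inf {ereal (\<Sum>(i, j)\<in>neighbours \<epsilon> \<Omega>. \<epsilon>\<^sup>2 * f (w i) (w j)) | w. director_field \<epsilon> \<Omega> Q w}"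
    proof (rule Inf_greatest)
      fix z assume "z \<in> {ereal (\<Sum>(i, j)\<in>neighbours \<epsilon> \<Omega>. \<epsilon>\<^sup>2 * f (w i) (w j)) | w. director_field \<epsilon> \<Omega> Q w}"
      then obtain w where w: "director_field \<epsilon> \<Omega> Q w"
        and z: "z = ereal (\<Sum>(i, j)\<in>neighbours \<epsilon> \<Omega>. \<epsilon>\<^sup>2 * f (w i) (w j))" by blast
      show "ereal (\<Sum>(i, j)\<in>neighbours \<epsilon> \<Omega>. \<epsilon>\<^sup>2 * f (u i) (u j)) \<le> z"
        unfolding z sums[OF w] by (rule order_refl)
    qed
  qed
qed

section \<open>The nondecreasing convex lower semicontinuous envelope\<close>

definition lsc_on :: "real set \<Rightarrow> (real \<Rightarrow> real) \<Rightarrow> bool" where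
  "lsc_on S g \<longleftrightarrow> (\<forall>x\<in>S. \<forall>a<g x. \<forall>\<^sub>F y in at x within S. a < g y)"

definition ndcx_lsc_minorants :: "(real \<Rightarrow> real) \<Rightarrow> (real \<Rightarrow> real) set" where
  "ndcx_lsc_minorants h = {g. mono_on {0..1} g \<and> convex_on {0..1} g \<and> lsc_on {0..1} g \<and>
     (\<forall>t\<in>{0..1}. g t \<le> h t)}"

text \<open>Only the values on \<open>[0,1]\<close> are meaningful; there, for bounded \<open>h\<close>, this is the largest
  element of \<^term>\<open>ndcx_lsc_minorants h\<close> (lemma \<open>ndcx_lsc_envelope_greatest\<close>).\<close>

definition ndcx_lsc_envelope :: "(real \<Rightarrow> real) \<Rightarrow> real \<Rightarrow> real" where
  "ndcx_lsc_envelope h t = (SUP g\<in>ndcx_lsc_minorants h. g t)"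

lemma ndcx_lsc_envelope_greatest:
  assumes "bounded (h ` {0..1})"
  shows "ndcx_lsc_envelope h \<in> ndcx_lsc_minorants h"
    and "\<And>g t. g \<in> ndcx_lsc_minorants h \<Longrightarrow> t \<in> {0..1} \<Longrightarrow> g t \<le> ndcx_lsc_envelope h t"
proof -
  let ?M = "ndcx_lsc_minorants h" and ?e = "ndcx_lsc_envelope h"
  obtain B where B: "\<And>t. t \<in> {0..1} \<Longrightarrow> \<bar>h t\<bar> \<le> B"
    using assms unfolding bounded_iff by (metis imageI real_norm_def)
  have "convex_on {0..1} (\<lambda>t::real. - B)"
    by (simp add: convex_on_const)
  moreover have "- B \<le> h t" if "t \<in> {0..1}" for t
    using B[OF that] by linarith
  ultimately have "(\<lambda>t. - B) \<in> ?M"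
    by (simp add: ndcx_lsc_minorants_def lsc_on_def mono_on_def)
  then have ne: "?M \<noteq> {}" by blast
  have bdd: "bdd_above ((\<lambda>g. g t) ` ?M)" if "t \<in> {0..1}" for t
    using that by (intro bdd_aboveI[where M = "h t"]) (auto simp: ndcx_lsc_minorants_def)
  show upper: "g t \<le> ?e t" if "g \<in> ?M" "t \<in> {0..1}" for g t
    unfolding ndcx_lsc_envelope_def using bdd that by (intro cSUP_upper) auto
  have least: "?e t \<le> c" if "\<And>g. g \<in> ?M \<Longrightarrow> g t \<le> c" for t c
    unfolding ndcx_lsc_envelope_def using ne that by (intro cSUP_least) auto
  have "mono_on {0..1} ?e"
  proof (rule mono_onI)
    fix s t :: real assume st: "s \<in> {0..1}" "t \<in> {0..1}" "s \<le> t"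
    show "?e s \<le> ?e t"
    proof (rule least)
      fix g assume g: "g \<in> ?M"
      then have "g s \<le> g t" using st by (auto simp: ndcx_lsc_minorants_def mono_on_def)
      with upper[OF g st(2)] show "g s \<le> ?e t" by simp
    qed
  qed
  moreover have "convex_on {0..1} ?e"
  proof (rule convex_onI)
    fix t x y :: real assume t: "0 < t" "t < 1" and xy: "x \<in> {0..1}" "y \<in> {0..1}"
    show "?e ((1 - t) *\<^sub>R x + t *\<^sub>R y) \<le> (1 - t) * ?e x + t * ?e y"
    proof (rule least)
      fix g assume g: "g \<in> ?M"
      then have "g ((1 - t) *\<^sub>R x + t *\<^sub>R y) \<le> (1 - t) * g x + t * g y"
        using t xy by (intro convex_onD[of "{0..1}"]) (auto simp: ndcx_lsc_minorants_def)
      also have "\<dots> \<le> (1 - t) * ?e x + t * ?e y"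
        using upper[OF g] t xy by (intro add_mono mult_left_mono) auto
      finally show "g ((1 - t) *\<^sub>R x + t *\<^sub>R y) \<le> \<dots>" .
    qed
  qed simp
  moreover have "lsc_on {0..1} ?e"
    unfolding lsc_on_def
  proof (intro ballI allI impI)
    fix x a :: real assume x: "x \<in> {0..1}" and a: "a < ?e x"
    then obtain g where g: "g \<in> ?M" "a < g x" using least by (meson not_le)
    then have "\<forall>\<^sub>F y in at x within {0..1}. a < g y"
      using x by (auto simp: ndcx_lsc_minorants_def lsc_on_def)
    moreover have "\<forall>\<^sub>F y in at x within {0..1}. y \<in> {0..1}"
      by (simp add: eventually_at_filter)
    ultimately show "\<forall>\<^sub>F y in at x within {0..1}. a < ?e y"
      by eventually_elim (meson upper[OF g(1)] less_le_trans)
  qed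
  moreover have "\<forall>t\<in>{0..1}. ?e t \<le> h t"
    using least by (auto simp: ndcx_lsc_minorants_def)
  ultimately show "?e \<in> ?M" by (simp add: ndcx_lsc_minorants_def)
qed

section \<open>The limit energy\<close>

definition F_lim :: "(real \<Rightarrow> real) \<Rightarrow> (real^2) set \<Rightarrow> (real^2 \<Rightarrow> real^2^2) \<Rightarrow> ereal" where
  "F_lim h \<Omega> Q =
     (if Q \<in> Linf \<Omega> K_set
      then ereal (4 * (\<integral>x. ndcx_lsc_envelope h (sqrt 2 * norm (Q x - (1 / 2) *\<^sub>R mat 1)) \<partial>lebesgue_on \<Omega>))
      else \<infinity>)"

end

theory Submission
  imports Defs
begin

text \<open>Identify \<open>K\<close> with the closed unit disc by \<open>Q = I/2 + r (a \<otimes> a - I/2)\<close>, \<open>r = \<surd>2 |Q - I/2|\<close>. The directors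
  are the boundary circle, and \<open>|u \<cdot> v|\<close> is the radius \<open>r\<close> of the midpoint of \<open>u \<otimes> u\<close> and \<open>v \<otimes> v\<close>.

  Lower bound: a bond costs at least \<open>h\<^sup>+\<^sup>+(r)\<close> at the midpoint, a convex function of the midpoint. Replace
  it by its tangent plane at \<open>(1 - \<tau>) Q(x)\<close>; the slope is bounded there, so the tangent planes form one
  integrable test field, and averaging a field with a shift by \<open>\<epsilon>\<close> does not change its weak* limit.

  Upper bound: along a fixed director \<open>a\<close>, the lower boundary of the convex hull of the even graph
  \<open>(s, h |s|)\<close>, rescaled by \<open>1 - \<tau>\<close>, is an admissible minorant of \<open>h\<close>. Hence the mean of \<open>Q\<close> on a
  mesoscopic block is nearly a mixture of phases \<open>I/2 + s (a \<otimes> a - I/2)\<close> with mean energy nearly \<open>h\<^sup>+\<^sup>+(r)\<close>.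
  Each phase is a checkerboard of two directors all of whose bonds cost \<open>h |s|\<close>, and Jensen's
  inequality compares the block energies with the integral.\<close>

section \<open>Q-tensors\<close>

text \<open>Two obstacles shape the proof. At radius 1 the slope of \<open>h\<^sup>+\<^sup>+\<close>
  may be infinite and the lower boundary of the hull may jump; the factor \<open>1 - \<tau>\<close>
  avoids both. It is harmless in the limit: a nondecreasing lower semicontinuous function is left
  continuous, so the limit energy at shrunk radii converges to the limit energy. The second obstacle
  is uniformity. Gamma-limits are defined through neighbourhoods, so the lower bound needs one test
  field for all small \<epsilon>; the field of tangent planes gives a weak-star open half-space. In
  the upper bound the block sizes, \<tau> and \<eta> are fixed once a neighbourhood and an error are
  given, and then \<epsilon> tends to 0, so no diagonal sequence occurs. All blocks use the same
  number m of squares whatever their mean, hence mixtures are realized by averages whose error is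
  uniform in the target point. The factor 4 is the number of unit steps, each ordered bond being
  charged to its first endpoint. Boundary effects live in layers of width proportional to
  \<epsilon>, whose area vanishes because the frontier is negligible.\<close>

definition rad :: "real^2^2 \<Rightarrow> real" where
  "rad Q = sqrt 2 * norm (Q - (1 / 2) *\<^sub>R mat 1)"

abbreviation half_id :: "real^2^2" where
  "half_id \<equiv> (1 / 2) *\<^sub>R mat 1"

lemma inner_matrix_2:
  "(A::real^2^2) \<bullet> B = A$1$1 * B$1$1 + A$1$2 * B$1$2 + A$2$1 * B$2$1 + A$2$2 * B$2$2"
  by (simp add: inner_vec_def sum_2)

lemma matrix_2_eq_iff:
  "(A::real^2^2) = B \<longleftrightarrow> A$1$1 = B$1$1 \<and> A$1$2 = B$1$2 \<and> A$2$1 = B$2$1 \<and> A$2$2 = B$2$2"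
  by (auto simp: vec_eq_iff forall_2)

lemma mat_1_nth [simp]:
  "(mat 1 :: real^2^2)$1$1 = 1" "(mat 1 :: real^2^2)$1$2 = 0"
  "(mat 1 :: real^2^2)$2$1 = 0" "(mat 1 :: real^2^2)$2$2 = 1"
  by (simp_all add: mat_def)

lemma tensor_nth [simp]: "tensor u v $ i $ j = u $ i * v $ j"
  by (simp add: tensor_def)

lemma sym_matrices_iff: "Q \<in> sym_matrices \<longleftrightarrow> Q$1$2 = Q$2$1"
  by (auto simp: sym_matrices_def transpose_def matrix_2_eq_iff)

lemma quadratic_form_2:
  "v \<bullet> ((Q::real^2^2) *v v) = Q$1$1 * (v$1)\<^sup>2 + (Q$1$2 + Q$2$1) * (v$1 * v$2) + Q$2$2 * (v$2)\<^sup>2"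
  by (simp add: inner_vec_def matrix_vector_mult_def sum_2 power2_eq_square algebra_simps)

lemma trace_2: "trace (Q::real^2^2) = Q$1$1 + Q$2$2"
  by (simp add: trace_def sum_2)

lemma norm_sq_2: "norm v = 1 \<longleftrightarrow> (v$1)\<^sup>2 + (v$2)\<^sup>2 = 1" for v :: "real^2"
  by (simp add: norm_eq_1 inner_vec_def sum_2 power2_eq_square)

lemma K_set_iff:
  "Q \<in> K_set \<longleftrightarrow> Q$1$2 = Q$2$1 \<and> (\<forall>v. 0 \<le> v \<bullet> (Q *v v)) \<and> Q$1$1 + Q$2$2 = 1"
  by (simp add: K_set_def sym_matrices_iff trace_2)

lemma K_set_subset_sym: "K_set \<subseteq> sym_matrices"
  by (auto simp: K_set_def)

lemma convex_K_set: "convex K_set"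
  unfolding convex_alt
proof (intro ballI allI impI)
  fix A B :: "real^2^2" and t :: real
  assume A: "A \<in> K_set" and B: "B \<in> K_set" and t: "0 \<le> t \<and> t \<le> 1"
  have "0 \<le> v \<bullet> (((1 - t) *\<^sub>R A + t *\<^sub>R B) *v v)" for v
  proof -
    have "v \<bullet> (((1 - t) *\<^sub>R A + t *\<^sub>R B) *v v) = (1 - t) * (v \<bullet> (A *v v)) + t * (v \<bullet> (B *v v))"
      by (simp add: quadratic_form_2 algebra_simps)
    also have "\<dots> \<ge> 0" using A B t by (intro add_nonneg_nonneg mult_nonneg_nonneg) (auto simp: K_set_iff)
    finally show ?thesis .
  qed
  moreover have "(1 - t) * A$1$1 + t * B$1$1 + ((1 - t) * A$2$2 + t * B$2$2)
      = (1 - t) * (A$1$1 + A$2$2) + t * (B$1$1 + B$2$2)" by (simp add: algebra_simps)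
  ultimately show "(1 - t) *\<^sub>R A + t *\<^sub>R B \<in> K_set" using A B by (simp add: K_set_iff)
qed

lemma closed_K_set: "closed K_set"
proof -
  have eq: "K_set = {Q. Q$1$2 = Q$2$1} \<inter> (\<Inter>v. {Q. 0 \<le> v \<bullet> (Q *v v)}) \<inter> {Q. Q$1$1 + Q$2$2 = 1}"
    by (auto simp: K_set_iff)
  show ?thesis
    unfolding eq quadratic_form_2
    by (intro closed_Int closed_INT ballI closed_Collect_eq closed_Collect_le continuous_intros)
qed

lemma S1_tensor_subset_K_set: "S1_tensor \<subseteq> K_set"
proof
  fix Q assume "Q \<in> S1_tensor"
  then obtain u where u: "norm u = 1" "Q = tensor u u" by (auto simp: S1_tensor_def)
  have "v \<bullet> (tensor u u *v v) = (u$1 * v$1 + u$2 * v$2)\<^sup>2" for v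
    by (simp add: quadratic_form_2 power2_eq_square algebra_simps)
  then have "0 \<le> v \<bullet> (Q *v v)" for v using u(2) by simp
  then show "Q \<in> K_set" using u by (simp add: K_set_iff norm_sq_2 power2_eq_square)
qed

lemma half_id_in_K_set: "half_id \<in> K_set"
proof -
  have "0 \<le> v \<bullet> (half_id *v v)" for v by (simp add: quadratic_form_2)
  then show ?thesis by (simp add: K_set_iff)
qed

lemma tensor_in_K_set: "norm u = 1 \<Longrightarrow> tensor u u \<in> K_set"
  using S1_tensor_subset_K_set by (auto simp: S1_tensor_def)

lemma midpoint_in_K_set: "A \<in> K_set \<Longrightarrow> B \<in> K_set \<Longrightarrow> (1 / 2) *\<^sub>R (A + B) \<in> K_set"
  using convexD[OF convex_K_set, of A B "1/2" "1/2"] by (simp add: scaleR_add_right)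

lemma rad_nonneg: "0 \<le> rad Q"
  by (simp add: rad_def)

lemma rad_sq: "(rad Q)\<^sup>2 = 2 * ((Q - half_id) \<bullet> (Q - half_id))"
  by (simp add: rad_def power_mult_distrib power2_norm_eq_inner)

lemma rad_sq_K_set:
  assumes "Q \<in> K_set"
  shows "(rad Q)\<^sup>2 = (2 * Q$1$1 - 1)\<^sup>2 + (2 * Q$1$2)\<^sup>2"
proof -
  have "Q$2$2 = 1 - Q$1$1" "Q$2$1 = Q$1$2" using assms by (simp_all add: K_set_iff)
  note q = this
  show ?thesis unfolding rad_sq inner_matrix_2 by (simp add: q power2_eq_square algebra_simps)
qed

text \<open>For M of trace 1 the square of \<open>rad M\<close> is
  \<open>2 * (M \<bullet> M) - 1\<close>, and the midpoint M of the two tensors satisfies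
  \<open>M \<bullet> M = (1 + (u \<bullet> v)\<^sup>2) / 2\<close>. This identity turns a bond
  energy into a function of a midpoint in K.\<close>

lemma rad_midpoint_tensor:
  assumes "norm u = 1" "norm v = 1"
  shows "rad ((1 / 2) *\<^sub>R (tensor u u + tensor v v)) = \<bar>u \<bullet> v\<bar>"
proof -
  have "mat 1 \<bullet> tensor u u = 1" "mat 1 \<bullet> tensor v v = 1" "mat 1 \<bullet> (mat 1 :: real^2^2) = 2"
    using assms by (simp_all add: inner_matrix_2 norm_sq_2 power2_eq_square)
  moreover have "tensor u u \<bullet> tensor u u = 1" "tensor v v \<bullet> tensor v v = 1"
    using assms by (simp_all add: inner_tensor norm_eq_1)
  ultimately have "(rad ((1 / 2) *\<^sub>R (tensor u u + tensor v v)))\<^sup>2 = (u \<bullet> v)\<^sup>2"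
    unfolding rad_sq inner_tensor[symmetric]
    by (simp add: inner_add_left inner_add_right inner_diff_left inner_diff_right inner_commute
        algebra_simps)
  then show ?thesis by (metis abs_of_nonneg rad_nonneg real_sqrt_abs)
qed

text \<open>The map from a to \<open>tensor a a\<close> doubles angles: the two expressions in a are
  the cosine and the sine of twice its angle. The witness therefore takes half the angle of (x,
  y).\<close>

lemma polar_unit:
  fixes x y :: real
  assumes "x\<^sup>2 + y\<^sup>2 = 1"
  obtains a :: "real^2" where "norm a = 1" "2 * (a$1)\<^sup>2 - 1 = x" "2 * (a$1 * a$2) = y"
proof -
  obtain t where t: "x = cos t" "y = sin t" using sincos_total_2pi[of x y] assms by blast
  let ?a = "vector [cos (t / 2), sin (t / 2)] :: real^2"
  have "norm ?a = 1" by (simp add: norm_sq_2)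
  moreover have "2 * (?a$1)\<^sup>2 - 1 = x" using cos_double_cos[of "t/2"] t by simp
  moreover have "2 * (?a$1 * ?a$2) = y" using sin_double[of "t/2"] t by (simp add: mult.commute)
  ultimately show thesis by (rule that)
qed

text \<open>A symmetric matrix of trace 1 is determined by the pair \<open>2 * Q$1$1 - 1\<close>,
  \<open>2 * Q$1$2\<close>, whose Euclidean length is \<open>rad Q\<close>; normalizing the pair and
  halving its angle gives a. At the centre of the disc any unit vector serves.\<close>

lemma K_set_polar:
  assumes "Q \<in> K_set"
  obtains a where "norm a = 1" "Q = half_id + rad Q *\<^sub>R (tensor a a - half_id)"
proof (cases "rad Q = 0")
  case True
  then have "Q = half_id" by (simp add: rad_def)
  moreover have "norm (vector [1, 0] :: real^2) = 1" by (simp add: norm_sq_2)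
  ultimately show thesis using True that by (metis add_0_right scaleR_zero_left)
next
  case False
  define r where "r = rad Q"
  have "((2 * Q$1$1 - 1) / r)\<^sup>2 + ((2 * Q$1$2) / r)\<^sup>2 = (rad Q)\<^sup>2 / r\<^sup>2"
    unfolding rad_sq_K_set[OF assms] by (simp add: power_divide add_divide_distrib)
  also have "\<dots> = 1" using False by (simp add: r_def)
  finally obtain a :: "real^2" where a: "norm a = 1" "2 * (a$1)\<^sup>2 - 1 = (2 * Q$1$1 - 1) / r"
    "2 * (a$1 * a$2) = (2 * Q$1$2) / r"
    by (rule polar_unit)
  have a': "r * (2 * (a$1)\<^sup>2 - 1) = 2 * Q$1$1 - 1" "r * (a$1 * a$2) = Q$1$2"
    using a(2,3) False by (simp_all add: r_def field_simps)
  have "a$2 * a$2 = 1 - a$1 * a$1" using a(1) by (simp add: norm_sq_2 power2_eq_square)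
  then have "r * (a$2 * a$2) = r - r * (a$1 * a$1)" by (simp add: right_diff_distrib)
  moreover have "Q$2$2 = 1 - Q$1$1" "Q$2$1 = Q$1$2" using assms by (simp_all add: K_set_iff)
  ultimately have "Q = half_id + r *\<^sub>R (tensor a a - half_id)"
    using a' unfolding matrix_2_eq_iff power2_eq_square
    by (simp add: right_diff_distrib mult.left_commute mult.commute)
  then show thesis using that a(1) by (simp add: r_def)
qed

lemma rad_le_1:
  assumes "Q \<in> K_set"
  shows "rad Q \<le> 1"
proof -
  obtain a where a: "norm a = 1" "Q = half_id + rad Q *\<^sub>R (tensor a a - half_id)"
    using K_set_polar[OF assms] .
  \<comment> \<open>The eigenvector orthogonal to a has eigenvalue \<open>(1 - rad Q) / 2\<close>,
    which is nonnegative for Q in K.\<close>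
  define b :: "real^2" where "b = vector [- a$2, a$1]"
  have b: "b$1 = - a$2" "b$2 = a$1" by (simp_all add: b_def)
  have a1: "(a$1)\<^sup>2 + (a$2)\<^sup>2 = 1" using a(1) by (simp add: norm_sq_2)
  have "b \<bullet> (Q *v b) = 1 / 2 * ((a$1)\<^sup>2 + (a$2)\<^sup>2) - rad Q / 2 * ((a$1)\<^sup>2 + (a$2)\<^sup>2)"
    by (subst a(2)) (simp add: quadratic_form_2 b power2_eq_square algebra_simps)
  then have "b \<bullet> (Q *v b) = 1 / 2 - rad Q / 2" using a1 by simp
  moreover have "0 \<le> b \<bullet> (Q *v b)" using assms by (simp add: K_set_iff)
  ultimately show ?thesis by simp
qed

lemma norm_tensor_diff_half_id:
  assumes "norm a = 1"
  shows "sqrt 2 * norm (tensor a a - half_id) = 1"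
  using rad_midpoint_tensor[OF assms assms] assms
  by (simp add: rad_def norm_eq_1 flip: scaleR_2)

lemma norm_K_set_le:
  assumes "Q \<in> K_set"
  shows "norm Q \<le> 1"
proof -
  have "Q \<bullet> Q = (Q - half_id) \<bullet> (Q - half_id) + Q \<bullet> mat 1 - 1 / 2"
    by (simp add: inner_matrix_2 algebra_simps)
  also have "Q \<bullet> mat 1 = 1" using assms by (simp add: inner_matrix_2 K_set_iff)
  also have "(Q - half_id) \<bullet> (Q - half_id) = (rad Q)\<^sup>2 / 2" by (simp add: rad_sq)
  also have "(rad Q)\<^sup>2 \<le> 1" using rad_le_1[OF assms] rad_nonneg[of Q] by (simp add: power_le_one)
  finally have "Q \<bullet> Q \<le> 1" by simp
  then show ?thesis by (simp add: norm_eq_sqrt_inner)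
qed

text \<open>The vectors u and v are mirror images of each other in the line of a, so the mixed terms
  cancel in the mean of their tensors. With c and d the components along a and across it, the sum of
  the squares is 1 and their difference is s. Negative s is allowed, which is what the even graph
  needs.\<close>

lemma checkerboard_vectors:
  assumes "norm a = 1" "\<bar>s\<bar> \<le> 1"
  obtains u v where "norm u = 1" "norm v = 1" "\<bar>u \<bullet> v\<bar> = \<bar>s\<bar>"
    "(1 / 2) *\<^sub>R (tensor u u + tensor v v) = half_id + s *\<^sub>R (tensor a a - half_id)"
proof -
  define c d where "c = sqrt ((1 + s) / 2)" and "d = sqrt ((1 - s) / 2)"
  have cd: "c\<^sup>2 = (1 + s) / 2" "d\<^sup>2 = (1 - s) / 2" using assms(2) by (simp_all add: c_def d_def)
  define b :: "real^2" where "b = vector [- a$2, a$1]"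
  have b: "b$1 = - a$2" "b$2 = a$1" by (simp_all add: b_def)
  have a1: "(a$1)\<^sup>2 + (a$2)\<^sup>2 = 1" using assms(1) by (simp add: norm_sq_2)
  then have a2: "a$2 * a$2 = 1 - a$1 * a$1" by (simp add: power2_eq_square)
  have ip: "a \<bullet> a = 1" "b \<bullet> b = 1" "a \<bullet> b = 0"
    using a1 by (simp_all add: inner_vec_def sum_2 b power2_eq_square algebra_simps)
  define u v where "u = c *\<^sub>R a + d *\<^sub>R b" and "v = c *\<^sub>R a - d *\<^sub>R b"
  have "u \<bullet> u = c\<^sup>2 + d\<^sup>2" "v \<bullet> v = c\<^sup>2 + d\<^sup>2" "u \<bullet> v = c\<^sup>2 - d\<^sup>2"
    using ip by (simp_all add: u_def v_def inner_add_left inner_add_right inner_diff_left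
        inner_diff_right inner_commute power2_eq_square algebra_simps)
  then have uv: "norm u = 1" "norm v = 1" "u \<bullet> v = s"
    using cd by (simp_all add: norm_eq_1 flip: add_divide_distrib diff_divide_distrib)
  have "(1 / 2) *\<^sub>R (tensor u u + tensor v v) = c\<^sup>2 *\<^sub>R tensor a a + d\<^sup>2 *\<^sub>R tensor b b"
    by (simp add: matrix_2_eq_iff u_def v_def power2_eq_square algebra_simps)
  also have "tensor b b = mat 1 - tensor a a"
    using a2 by (simp add: matrix_2_eq_iff b)
  also have "c\<^sup>2 *\<^sub>R tensor a a + d\<^sup>2 *\<^sub>R (mat 1 - tensor a a) = half_id + s *\<^sub>R (tensor a a - half_id)"
    unfolding cd by (simp add: matrix_2_eq_iff field_simps)
  finally show thesis using that uv by simp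
qed

section \<open>The convex envelope and mixtures of phases\<close>

text \<open>For convex g the chord slopes starting at t increase with the other endpoint, so this
  infimum is the right derivative at t. Written with chords it needs no limit, and for nondecreasing
  g all chords have nonnegative slope, so the infimum is finite for t in [0,1).\<close>

definition right_slope :: "(real \<Rightarrow> real) \<Rightarrow> real \<Rightarrow> real" where
  "right_slope g t = (INF s\<in>{t<..1}. (g s - g t) / (s - t))"

context
  fixes g :: "real \<Rightarrow> real"
  assumes mono: "mono_on {0..1} g" and conv: "convex_on {0..1} g"
begin

lemma chord_slope_nonneg:
  assumes "0 \<le> t" "t < s" "s \<le> 1"
  shows "0 \<le> (g s - g t) / (s - t)"
  using assms mono_onD[OF mono, of t s] by (intro divide_nonneg_nonneg) auto

lemma right_slope_le_chord:
  assumes "0 \<le> t" "t < s" "s \<le> 1"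
  shows "right_slope g t \<le> (g s - g t) / (s - t)"
  unfolding right_slope_def
proof (rule cINF_lower)
  show "bdd_below ((\<lambda>s. (g s - g t) / (s - t)) ` {t<..1})"
    using chord_slope_nonneg assms by (intro bdd_belowI[of _ 0]) auto
qed (use assms in auto)

lemma right_slope_greatest:
  assumes "t < 1" "\<And>s. t < s \<Longrightarrow> s \<le> 1 \<Longrightarrow> c \<le> (g s - g t) / (s - t)"
  shows "c \<le> right_slope g t"
  unfolding right_slope_def using assms by (intro cINF_greatest) auto

lemma right_slope_nonneg: "0 \<le> t \<Longrightarrow> t < 1 \<Longrightarrow> 0 \<le> right_slope g t"
  by (intro right_slope_greatest chord_slope_nonneg)

text \<open>To the right of t this is the definition of the infimum. To the left, convexity puts
  each chord slope ending at t below each chord slope starting at t.\<close>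

lemma right_slope_support:
  assumes t: "0 \<le> t" "t < 1" and s: "0 \<le> s" "s \<le> 1"
  shows "g t + right_slope g t * (s - t) \<le> g s"
proof -
  consider "s < t" | "s = t" | "t < s" by linarith
  then show ?thesis
  proof cases
    case 1
    have "(g t - g s) / (t - s) \<le> right_slope g t"
    proof (rule right_slope_greatest[OF t(2)])
      fix y assume y: "t < y" "y \<le> 1"
      have "(g s - g t) / (s - t) \<le> (g t - g y) / (t - y)"
        using convex_on_slope_le[OF conv, of s y t] s t y 1 by force
      then show "(g t - g s) / (t - s) \<le> (g y - g t) / (y - t)"
        by (metis minus_diff_eq minus_divide_divide)
    qed
    then show ?thesis using 1 by (simp add: field_simps)
  next
    case 3
    show ?thesis using right_slope_le_chord[OF t(1) 3 s(2)] 3 by (simp add: field_simps)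
  qed simp
qed

text \<open>Chord slopes with a common right endpoint increase with the left one. Monotonicity is
  what makes the slope measurable along a measurable field.\<close>

lemma right_slope_mono: "mono_on {0..<1} (right_slope g)"
proof (rule mono_onI)
  fix t s :: real assume t: "t \<in> {0..<1}" and s: "s \<in> {0..<1}" and "t \<le> s"
  show "right_slope g t \<le> right_slope g s"
  proof (cases "t = s")
    case False
    with \<open>t \<le> s\<close> have ts: "t < s" by simp
    show ?thesis
    proof (rule right_slope_greatest)
      fix y assume y: "s < y" "y \<le> 1"
      have "right_slope g t \<le> (g y - g t) / (y - t)"
        using t ts y by (intro right_slope_le_chord) auto
      also have "\<dots> = (g t - g y) / (t - y)" by (metis minus_diff_eq minus_divide_divide)
      also have "\<dots> \<le> (g s - g y) / (s - y)"
        using convex_on_slope_le(2)[OF conv, of t y s] t s ts y by force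
      also have "\<dots> = (g y - g s) / (y - s)" by (metis minus_diff_eq minus_divide_divide)
      finally show "right_slope g t \<le> (g y - g s) / (y - s)" .
    qed (use s in auto)
  qed simp
qed

text \<open>Along arguments not exceeding t, lower semicontinuity bounds the values from below in
  the limit and monotonicity bounds them from above. This covers t = 1, where convexity alone gives
  no continuity.\<close>

lemma lsc_mono_tendsto:
  assumes lsc: "lsc_on {0..1} g" and t: "t \<in> {0..1}"
    and x: "x \<longlonglongrightarrow> t" "\<And>n. 0 \<le> x n" "\<And>n. x n \<le> t"
  shows "(\<lambda>n. g (x n)) \<longlonglongrightarrow> g t"
proof (rule order_tendstoI)
  fix a assume a: "a < g t"
  have "\<forall>\<^sub>F y in at t within {0..1}. a < g y" using lsc t a by (simp add: lsc_on_def)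
  then have "\<forall>\<^sub>F y in nhds t. y \<in> {0..1} \<longrightarrow> a < g y"
    unfolding eventually_at_filter using a by (auto elim!: eventually_mono)
  then have "\<forall>\<^sub>F n in sequentially. x n \<in> {0..1} \<longrightarrow> a < g (x n)"
    using x(1) by (rule eventually_compose_filterlim)
  moreover have "x n \<in> {0..1}" for n using x(2)[of n] order_trans[OF x(3)[of n], of 1] t by simp
  ultimately show "\<forall>\<^sub>F n in sequentially. a < g (x n)" by simp
next
  fix a assume a: "g t < a"
  have "g (x n) \<le> g t" for n
    using x(2,3)[of n] t by (intro mono_onD[OF mono]) auto
  then show "\<forall>\<^sub>F n in sequentially. g (x n) < a" using a by (intro always_eventually) (auto intro: le_less_trans)
qed

end

text \<open>Greedy choice: some point of \<open>S\<close> always makes a nonpositive inner product with the current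
  error, so the squared error grows by at most \<open>C\<^sup>2\<close> per step. In contrast to an expansion as a
  convex combination, the rate is uniform in \<open>z\<close>.\<close>

lemma convex_hull_averages:
  fixes S :: "'a::real_inner set"
  assumes z: "z \<in> convex hull S" and C: "\<And>x. x \<in> S \<Longrightarrow> norm (x - z) \<le> C"
  obtains \<sigma> :: "nat \<Rightarrow> 'a" where "\<And>k. \<sigma> k \<in> S" "\<And>m. norm (\<Sum>k<m. \<sigma> k - z) \<le> C * sqrt m"
proof -
  have "\<exists>x\<in>S. v \<bullet> (x - z) \<le> 0" for v
  proof (rule ccontr)
    assume "\<not> ?thesis"
    then have "S \<subseteq> {x. v \<bullet> x > v \<bullet> z}" by (auto simp: inner_diff_right)
    then have "convex hull S \<subseteq> {x. v \<bullet> x > v \<bullet> z}" by (intro hull_minimal convex_halfspace_gt)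
    with z show False by auto
  qed
  then obtain f where f: "\<And>v. f v \<in> S" "\<And>v. v \<bullet> (f v - z) \<le> 0" by metis
  define V where "V = rec_nat 0 (\<lambda>_ v. v + (f v - z))"
  have V: "V 0 = 0" "V (Suc m) = V m + (f (V m) - z)" for m by (simp_all add: V_def)
  have sum: "(\<Sum>k<m. f (V k) - z) = V m" for m by (induction m) (simp_all add: V)
  have "0 \<le> C" using C[OF f(1)] norm_ge_zero order_trans by blast
  have sq: "(norm (V m))\<^sup>2 \<le> C\<^sup>2 * real m" for m
  proof (induction m)
    case (Suc m)
    have "(norm (V (Suc m)))\<^sup>2 = (norm (V m))\<^sup>2 + 2 * (V m \<bullet> (f (V m) - z)) + (norm (f (V m) - z))\<^sup>2"
      unfolding V power2_norm_eq_inner by (simp add: inner_add_left inner_add_right inner_commute)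
    also have "\<dots> \<le> C\<^sup>2 * real m + 2 * 0 + C\<^sup>2"
      using Suc f C by (intro add_mono mult_left_mono power_mono) auto
    finally show ?case by (simp add: algebra_simps)
  qed (simp add: V)
  have "norm (V m) \<le> C * sqrt m" for m
    using real_sqrt_le_mono[OF sq[of m]] \<open>0 \<le> C\<close> by (simp add: real_sqrt_mult)
  with f(1) sum show thesis by (intro that[of "\<lambda>k. f (V k)"]) auto
qed

text \<open>The convex hull of this set describes the mixtures of phases \<open>Q = I/2 + s (a \<otimes> a - I/2)\<close>
  with \<open>\<bar>s\<bar> \<le> 1\<close> along a fixed director \<open>a\<close>.\<close>

definition even_graph :: "(real \<Rightarrow> real) \<Rightarrow> (real \<times> real) set" where
  "even_graph h = (\<lambda>s. (s, h \<bar>s\<bar>)) ` {-1..1}"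

lemma convex_hull_even_graph:
  assumes B: "\<And>t. t \<in> {0..1} \<Longrightarrow> \<bar>h t\<bar> \<le> B"
  shows "convex hull (even_graph h) \<subseteq> {-1..1} \<times> {-B..B}"
proof (rule hull_minimal)
  show "even_graph h \<subseteq> {-1..1} \<times> {-B..B}"
  proof (clarsimp simp: even_graph_def)
    fix s :: real assume "-1 \<le> s" "s \<le> 1"
    then have "\<bar>h \<bar>s\<bar>\<bar> \<le> B" by (intro B) auto
    then show "- B \<le> h \<bar>s\<bar> \<and> h \<bar>s\<bar> \<le> B" by linarith
  qed
qed (intro convex_Times convex_real_interval)

lemma envelope_bounds:
  assumes B: "\<And>t. t \<in> {0..1} \<Longrightarrow> \<bar>h t\<bar> \<le> B" and t: "t \<in> {0..1}"
  shows "\<bar>ndcx_lsc_envelope h t\<bar> \<le> B"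
proof -
  have bd: "bounded (h ` {0..1})" using B by (auto simp: bounded_iff intro!: exI[of _ B])
  have "- B \<le> h t" if "t \<in> {0..1}" for t using B[OF that] by linarith
  then have "(\<lambda>_. - B) \<in> ndcx_lsc_minorants h"
    by (simp add: ndcx_lsc_minorants_def lsc_on_def mono_on_def convex_on_const)
  then have "- B \<le> ndcx_lsc_envelope h t" using ndcx_lsc_envelope_greatest(2)[OF bd] t by blast
  moreover have "ndcx_lsc_envelope h t \<le> h t"
    using ndcx_lsc_envelope_greatest(1)[OF bd] t by (auto simp: ndcx_lsc_minorants_def)
  ultimately show ?thesis using B[OF t] by linarith
qed

text \<open>The lower boundary e of the hull is convex, and evenness of the graph makes it
  nondecreasing on [0,1]. At 1 it may fail to be lower semicontinuous, so the minorant G is e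
  composed with the factor \<open>1 - \<tau>\<close>, which maps [0,1] into the open interval where
  e is continuous. The infimum that defines e may not be attained, hence the slack \<eta>.\<close>

lemma hull_point_below_envelope:
  assumes B: "\<And>t. t \<in> {0..1} \<Longrightarrow> \<bar>h t\<bar> \<le> B" and t: "t \<in> {0..1}" and \<tau>: "0 < \<tau>" "\<tau> < 1" and "0 < \<eta>"
  obtains y where "((1 - \<tau>) * t, y) \<in> convex hull (even_graph h)" "y < ndcx_lsc_envelope h t + \<eta>"
proof -
  define H where "H = convex hull (even_graph h)"
  define e where "e r = Inf {y. (r, y) \<in> H}" for r
  have cH: "convex H" by (simp add: H_def)
  have gH: "(r, h \<bar>r\<bar>) \<in> H" if "r \<in> {-1..1}" for r
    unfolding H_def using that by (intro hull_inc) (auto simp: even_graph_def)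
  have "H \<subseteq> {-1..1} \<times> {-B..B}" unfolding H_def by (rule convex_hull_even_graph[OF B])
  then have HB: "- B \<le> y" if "(r, y) \<in> H" for r y using that by auto
  have bdd: "bdd_below {y. (r, y) \<in> H}" for r using HB by (intro bdd_belowI[of _ "-B"]) auto
  have ne: "{y. (r, y) \<in> H} \<noteq> {}" if "r \<in> {-1..1}" for r using gH[OF that] by blast
  have e_le: "e r \<le> y" if "(r, y) \<in> H" for r y
    unfolding e_def using that bdd by (intro cInf_lower) auto
  have e_ge: "\<exists>y. (r, y) \<in> H \<and> y < e r + d" if "r \<in> {-1..1}" "0 < d" for r d
    using cInf_lessD[OF ne[OF that(1)], of "e r + d"] that(2) by (auto simp: e_def)
  have "(\<lambda>(x, y). (- x, y)) ` even_graph h \<subseteq> even_graph h"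
    by (force simp: even_graph_def)
  then have "convex hull ((\<lambda>(x, y). (- x, y)) ` even_graph h) \<subseteq> H"
    unfolding H_def by (rule hull_mono)
  moreover have "linear (\<lambda>(x::real, y::real). (- x, y))"
    by (auto intro!: linearI)
  ultimately have symH: "(- x, y) \<in> H" if "(x, y) \<in> H" for x y
    using that convex_hull_linear_image[of "\<lambda>(x::real, y::real). (- x, y)" "even_graph h"]
    by (auto simp: H_def)
  have "convex_on {-1..1} e"
  proof (rule convex_onI)
    fix u x y :: real assume u: "0 < u" "u < 1" and xy: "x \<in> {-1..1}" "y \<in> {-1..1}"
    show "e ((1 - u) *\<^sub>R x + u *\<^sub>R y) \<le> (1 - u) * e x + u * e y"
    proof (rule field_le_epsilon)
      fix d :: real assume d: "0 < d"
      obtain p q where p: "(x, p) \<in> H" "p < e x + d" and q: "(y, q) \<in> H" "q < e y + d"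
        using e_ge xy d by meson
      have "((1 - u) *\<^sub>R x + u *\<^sub>R y, (1 - u) * p + u * q) \<in> H"
        using convexD[OF cH p(1) q(1), of "1 - u" u] u by simp
      then have "e ((1 - u) *\<^sub>R x + u *\<^sub>R y) \<le> (1 - u) * p + u * q" by (rule e_le)
      also have "\<dots> \<le> (1 - u) * (e x + d) + u * (e y + d)"
        using p q u by (intro add_mono mult_left_mono) auto
      also have "\<dots> = (1 - u) * e x + u * e y + d" by (simp add: algebra_simps)
      finally show "e ((1 - u) *\<^sub>R x + u *\<^sub>R y) \<le> (1 - u) * e x + u * e y + d" .
    qed
  qed simp
  then have convG0: "convex_on {-1..1} e" .
  have monoe: "e x \<le> e y" if "0 \<le> x" "x \<le> y" "y \<le> 1" for x y
  proof (cases "y = 0")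
    case False
    then have y: "0 < y" using that by simp
    \<comment> \<open>As x lies between -y and y, it is a mixture of the two. Mixing (y, p) with its
      mirror image (-y, p) keeps the height p, so the hull contains (x, p).\<close>
    define u where "u = (1 + x / y) / 2"
    have u: "0 \<le> u" "u \<le> 1" "u * y + (1 - u) * (- y) = x"
      using y that by (simp_all add: u_def field_simps)
    show ?thesis unfolding e_def[of y]
    proof (rule cInf_greatest)
      fix p assume "p \<in> {p. (y, p) \<in> H}"
      then have p: "(y, p) \<in> H" by simp
      have "(u * y + (1 - u) * (- y), u * p + (1 - u) * p) \<in> H"
        using convexD[OF cH p symH[OF p], of u "1 - u"] u(1,2) by simp
      also have "u * p + (1 - u) * p = p" by (simp add: algebra_simps)
      finally show "e x \<le> p" unfolding u(3) by (rule e_le)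
    qed (use ne[of y] that in auto)
  qed (use that in auto)
  define G where "G r = e ((1 - \<tau>) * r)" for r
  have scale: "(1 - \<tau>) * r \<in> {0..<1}" if "r \<in> {0..1}" for r
    
  proof -
    have "(1 - \<tau>) * r \<le> 1 - \<tau>" using that \<tau> mult_left_mono[of r 1 "1 - \<tau>"] by simp
    moreover have "0 \<le> (1 - \<tau>) * r" using that \<tau> by simp
    ultimately show ?thesis using \<tau>(1) unfolding atLeastLessThan_iff by linarith
  qed
  have "G \<in> ndcx_lsc_minorants h"
    unfolding ndcx_lsc_minorants_def
  proof (intro CollectI conjI ballI)
    show "mono_on {0..1} G"
    proof (rule mono_onI)
      fix r s :: real assume "r \<in> {0..1}" "s \<in> {0..1}" "r \<le> s"
      then show "G r \<le> G s" unfolding G_def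
        using scale[of r] scale[of s] \<tau> by (intro monoe mult_left_mono) auto
    qed
    show "convex_on {0..1} G"
    proof (rule convex_onI)
      fix u x y :: real assume u: "0 < u" "u < 1" and xy: "x \<in> {0..1}" "y \<in> {0..1}"
      have "(1 - \<tau>) * ((1 - u) * x + u * y) = (1 - u) * ((1 - \<tau>) * x) + u * ((1 - \<tau>) * y)"
        by (simp add: algebra_simps)
      then show "G ((1 - u) *\<^sub>R x + u *\<^sub>R y) \<le> (1 - u) * G x + u * G y"
        unfolding G_def using convex_onD[OF convG0, of u "(1 - \<tau>) * x" "(1 - \<tau>) * y"]
          scale[OF xy(1)] scale[OF xy(2)] u by simp
    qed simp
    have "continuous_on {-1<..<1} e"
      by (rule convex_on_continuous) (auto intro: convex_on_subset[OF convG0])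
    then have "continuous_on {0..1} (\<lambda>r. e ((1 - \<tau>) * r))"
    proof (rule continuous_on_compose2)
      show "(\<lambda>r. (1 - \<tau>) * r) ` {0..1} \<subseteq> {-1<..<1}" using scale by force
    qed (intro continuous_intros)
    then show "lsc_on {0..1} G"
      unfolding lsc_on_def continuous_on_def G_def by (auto intro: order_tendstoD)
    show "G r \<le> h r" if r: "r \<in> {0..1}" for r
    proof -
      have "G r \<le> e r" unfolding G_def using r \<tau> scale[OF r] mult_right_mono[of "1 - \<tau>" 1 r]
        by (intro monoe) auto
      also have "\<dots> \<le> h r" using e_le[OF gH, of r] r by simp
      finally show ?thesis .
    qed
  qed
  moreover have "bounded (h ` {0..1})" using B by (auto simp: bounded_iff intro!: exI[of _ B])
  ultimately have "G t \<le> ndcx_lsc_envelope h t" using ndcx_lsc_envelope_greatest(2) t by blast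
  moreover obtain y where "((1 - \<tau>) * t, y) \<in> H" "y < G t + \<eta>"
    using e_ge[of "(1 - \<tau>) * t" \<eta>] scale[OF t] \<open>0 < \<eta>\<close> by (auto simp: G_def)
  ultimately show thesis using that unfolding H_def by fastforce
qed

text \<open>The greedy averages are applied in the plane, to the even graph and a hull point over
  \<open>(1 - \<tau>) * t\<close>, so one sequence of phases controls the order parameter and the
  energy together. The radius \<open>2 + 2 * B\<close> is the sum of the two side lengths of the box
  containing the hull. The energy estimate is one-sided because the hull point is known to lie below
  the envelope plus \<eta>.\<close>

lemma phase_sequence:
  assumes B: "\<And>t. t \<in> {0..1} \<Longrightarrow> \<bar>h t\<bar> \<le> B" and t: "t \<in> {0..1}" and \<tau>: "0 < \<tau>" "\<tau> < 1" and "0 < \<eta>"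
  obtains s :: "nat \<Rightarrow> real" where "\<And>k. \<bar>s k\<bar> \<le> 1"
    "\<And>m. \<bar>(\<Sum>k<m. s k) - m * ((1 - \<tau>) * t)\<bar> \<le> (2 + 2 * B) * sqrt m"
    "\<And>m. (\<Sum>k<m. h \<bar>s k\<bar>) \<le> m * (ndcx_lsc_envelope h t + \<eta>) + (2 + 2 * B) * sqrt m"
proof -
  define G where "G = even_graph h"
  obtain y where y: "((1 - \<tau>) * t, y) \<in> convex hull G" "y < ndcx_lsc_envelope h t + \<eta>"
    unfolding G_def using hull_point_below_envelope[where h = h, OF B t \<tau> \<open>0 < \<eta>\<close>] by metis
  have sub: "convex hull G \<subseteq> {-1..1} \<times> {-B..B}"
    unfolding G_def by (rule convex_hull_even_graph[OF B])
  have *: "\<bar>fst x\<bar> \<le> 1" "\<bar>snd x\<bar> \<le> B" if "x \<in> convex hull G" for x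
    using subsetD[OF sub that] unfolding mem_Times_iff atLeastAtMost_iff by linarith+
  have nb: "norm (x - ((1 - \<tau>) * t, y)) \<le> 2 + 2 * B" if "x \<in> G" for x
  proof -
    have "norm (x - ((1 - \<tau>) * t, y)) \<le> \<bar>fst x - (1 - \<tau>) * t\<bar> + \<bar>snd x - y\<bar>"
      using norm_Pair_le[of "fst x - (1 - \<tau>) * t" "snd x - y"] by (cases x) simp
    then show ?thesis
      using *[OF y(1)] *[OF hull_inc[OF that]] unfolding fst_conv snd_conv by linarith
  qed
  have "\<exists>\<sigma> :: nat \<Rightarrow> real \<times> real. (\<forall>k. \<sigma> k \<in> G) \<and>
      (\<forall>m. norm (\<Sum>k<m. \<sigma> k - ((1 - \<tau>) * t, y)) \<le> (2 + 2 * B) * sqrt (real m))"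
  proof (rule convex_hull_averages[OF y(1) nb])
    fix \<sigma> :: "nat \<Rightarrow> real \<times> real"
    assume "\<And>k. \<sigma> k \<in> G" "\<And>m. norm (\<Sum>k<m. \<sigma> k - ((1 - \<tau>) * t, y)) \<le> (2 + 2 * B) * sqrt (real m)"
    then show ?thesis by blast
  qed
  then obtain \<sigma> :: "nat \<Rightarrow> real \<times> real" where \<sigma>: "\<And>k. \<sigma> k \<in> G"
    "\<And>m. norm (\<Sum>k<m. \<sigma> k - ((1 - \<tau>) * t, y)) \<le> (2 + 2 * B) * sqrt (real m)"
    by blast
  have snd\<sigma>: "snd (\<sigma> k) = h \<bar>fst (\<sigma> k)\<bar>" "\<bar>fst (\<sigma> k)\<bar> \<le> 1" for k
    using \<sigma>(1)[of k] by (auto simp: G_def even_graph_def abs_le_iff)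
  have norm_fst_le': "norm (fst x) \<le> norm x" and norm_snd_le': "norm (snd x) \<le> norm x"
    for x :: "real \<times> real"
    using norm_fst_le[of "fst x" "snd x"] norm_snd_le[of "snd x" "fst x"] by simp_all
  show thesis
  proof (rule that[of "\<lambda>k. fst (\<sigma> k)"])
    fix m :: nat
    have "fst (\<Sum>k<m. \<sigma> k - ((1 - \<tau>) * t, y)) = (\<Sum>k<m. fst (\<sigma> k)) - m * ((1 - \<tau>) * t)"
      by (simp add: fst_sum sum_subtractf)
    moreover have "\<bar>fst (\<Sum>k<m. \<sigma> k - ((1 - \<tau>) * t, y))\<bar> \<le> (2 + 2 * B) * sqrt m"
      using order_trans[OF norm_fst_le' \<sigma>(2)[of m]] by simp
    ultimately show "\<bar>(\<Sum>k<m. fst (\<sigma> k)) - m * ((1 - \<tau>) * t)\<bar> \<le> (2 + 2 * B) * sqrt m" by simp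
    have "snd (\<Sum>k<m. \<sigma> k - ((1 - \<tau>) * t, y)) = (\<Sum>k<m. h \<bar>fst (\<sigma> k)\<bar>) - m * y"
      by (simp add: snd_sum sum_subtractf snd\<sigma>)
    moreover have "\<bar>snd (\<Sum>k<m. \<sigma> k - ((1 - \<tau>) * t, y))\<bar> \<le> (2 + 2 * B) * sqrt m"
      using order_trans[OF norm_snd_le' \<sigma>(2)[of m]] by simp
    moreover have "m * y \<le> m * (ndcx_lsc_envelope h t + \<eta>)" using y(2) by (intro mult_left_mono) auto
    ultimately show "(\<Sum>k<m. h \<bar>fst (\<sigma> k)\<bar>) \<le> m * (ndcx_lsc_envelope h t + \<eta>) + (2 + 2 * B) * sqrt m"
      by linarith
  qed (rule snd\<sigma>)
qed

section \<open>The boundary layer\<close>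

text \<open>The graph is contained in the image of the null line \<open>x$2 = 0\<close> under a
  Lipschitz map of the plane into itself, and such maps preserve negligible sets.\<close>

lemma negligible_lipschitz_graph:
  fixes a b :: "real^2" and \<gamma> :: "real \<Rightarrow> real"
  assumes ab: "norm a = 1" "norm b = 1" "a \<bullet> b = 0" and L: "L-lipschitz_on UNIV \<gamma>"
  shows "negligible {y. y \<bullet> b = \<gamma> (y \<bullet> a)}"
proof -
  define f :: "real^2 \<Rightarrow> real^2" where "f x = (x$1) *\<^sub>R a + \<gamma> (x$1) *\<^sub>R b" for x
  have "L \<ge> 0" using L by (rule lipschitz_on_nonneg)
  have "{y. y \<bullet> b = \<gamma> (y \<bullet> a)} \<subseteq> f ` {x. x$2 = 0}"
  proof
    fix y assume "y \<in> {y. y \<bullet> b = \<gamma> (y \<bullet> a)}"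
    then have y: "y \<bullet> b = \<gamma> (y \<bullet> a)" by simp
    have "(y - (y \<bullet> a) *\<^sub>R a - (y \<bullet> b) *\<^sub>R b) = 0"
    proof -
      \<comment> \<open>The remainder is orthogonal to a and b, which span the plane, so it is
        orthogonal to itself.\<close>
      define z where "z = y - (y \<bullet> a) *\<^sub>R a - (y \<bullet> b) *\<^sub>R b"
      have za: "z \<bullet> a = 0" "z \<bullet> b = 0"
        using ab by (simp_all add: z_def inner_diff_left inner_diff_right norm_eq_1 inner_commute)
      have "a \<noteq> b" using ab by (metis norm_eq_1 zero_neq_one)
      have "independent {a, b}"
        using ab \<open>a \<noteq> b\<close> by (intro pairwise_orthogonal_independent)
          (auto simp: pairwise_def orthogonal_def inner_commute)
      moreover have "card {a, b} = DIM(real^2)" using \<open>a \<noteq> b\<close> by simp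
      ultimately have "span {a, b} = UNIV"
        by (metis dim_UNIV dim_eq_card_independent dim_eq_full)
      then have "z \<in> span {a, b}" by simp
      then have "orthogonal z z"
        using za by (intro orthogonal_to_span[of z "{a, b}" z]) (auto simp: orthogonal_def)
      then show ?thesis by (simp add: orthogonal_def z_def)
    qed
    then have "y = f (axis 1 (y \<bullet> a))" using y by (simp add: f_def axis_def algebra_simps)
    moreover have "axis 1 (y \<bullet> a) \<in> {x::real^2. x$2 = 0}" by (simp add: axis_def)
    ultimately show "y \<in> f ` {x. x$2 = 0}" by blast
  qed
  moreover have "negligible (f ` {x. x$2 = 0})"
  proof (rule negligible_locally_Lipschitz_image)
    show "negligible {x::real^2. x$2 = 0}"
      by (rule negligible_standard_hyperplane_cart)
    fix x :: "real^2"
    have "norm (f y - f x) \<le> (1 + L) * norm (y - x)" for y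
    proof -
      have "f y - f x = (y$1 - x$1) *\<^sub>R a + (\<gamma> (y$1) - \<gamma> (x$1)) *\<^sub>R b"
        by (simp add: f_def algebra_simps)
      then have "norm (f y - f x) \<le> \<bar>y$1 - x$1\<bar> + \<bar>\<gamma> (y$1) - \<gamma> (x$1)\<bar>"
        using ab norm_triangle_ineq[of "(y$1 - x$1) *\<^sub>R a" "(\<gamma> (y$1) - \<gamma> (x$1)) *\<^sub>R b"] by simp
      moreover have "\<bar>\<gamma> (y$1) - \<gamma> (x$1)\<bar> \<le> L * \<bar>y$1 - x$1\<bar>"
        using lipschitz_onD[OF L, of "y$1" "x$1"] by (simp add: dist_real_def)
      moreover have "\<bar>y$1 - x$1\<bar> \<le> norm (y - x)"
        using component_le_norm_cart[of "y - x" 1] by simp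
      ultimately show ?thesis using \<open>L \<ge> 0\<close> mult_left_mono[of "\<bar>y$1 - x$1\<bar>" "norm (y - x)" L]
        by (simp add: algebra_simps)
    qed
    then show "\<exists>T B. open T \<and> x \<in> T \<and> (\<forall>y\<in>{x. x$2 = 0} \<inter> T. norm (f y - f x) \<le> B * norm (y - x))"
      by (intro exI[of _ UNIV] exI[of _ "1 + L"]) auto
  qed simp
  ultimately show ?thesis by (rule negligible_subset[rotated])
qed

text \<open>In a chart \<Omega> is the strict epigraph of a Lipschitz function. A frontier point is
  not above the graph, since it does not belong to the open set \<Omega>; nor is it below, since the
  points strictly below form an open set that misses \<Omega> within the chart. Thus the frontier
  lies locally in a graph, and compactness leaves finitely many charts.\<close>

lemma negligible_frontier_lipschitz:
  assumes "open \<Omega>" "bounded \<Omega>" "lipschitz_boundary \<Omega>"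
  shows "negligible (frontier \<Omega>)"
proof -
  have "\<exists>r>0. negligible (frontier \<Omega> \<inter> ball x r)" if x: "x \<in> frontier \<Omega>" for x
  proof -
    obtain r a b \<gamma> L where r: "r > 0" and ab: "norm a = 1" "norm b = 1" "a \<bullet> b = 0"
      and L: "L-lipschitz_on UNIV (\<gamma> :: real \<Rightarrow> real)"
      and eq: "\<Omega> \<inter> ball x r = {y \<in> ball x r. \<gamma> (y \<bullet> a) < y \<bullet> b}"
      using assms(3) x unfolding lipschitz_boundary_def by blast
    have cont: "continuous_on UNIV (\<lambda>y. \<gamma> (y \<bullet> a))"
      by (rule continuous_on_compose2[OF lipschitz_on_continuous_on[OF L]])
         (auto intro!: continuous_intros)
    have "frontier \<Omega> \<inter> ball x r \<subseteq> {y. y \<bullet> b = \<gamma> (y \<bullet> a)}"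
    proof
      fix y assume y: "y \<in> frontier \<Omega> \<inter> ball x r"
      have "y \<notin> \<Omega>" using y assms(1) by (auto simp: frontier_def interior_open)
      then have "\<not> \<gamma> (y \<bullet> a) < y \<bullet> b" using eq y by auto
      moreover have "\<not> y \<bullet> b < \<gamma> (y \<bullet> a)"
      proof
        assume less: "y \<bullet> b < \<gamma> (y \<bullet> a)"
        define V where "V = {z. z \<bullet> b < \<gamma> (z \<bullet> a)} \<inter> ball x r"
        have "open V" unfolding V_def
          by (intro open_Int open_ball open_Collect_less cont continuous_intros)
        moreover have "y \<in> V" using less y by (simp add: V_def)
        moreover have "y \<in> closure \<Omega>" using y by (simp add: frontier_def)
        ultimately have "V \<inter> \<Omega> \<noteq> {}" by (metis disjoint_iff open_Int_closure_eq_empty)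
        then obtain z where "z \<in> \<Omega> \<inter> ball x r" "z \<bullet> b < \<gamma> (z \<bullet> a)" unfolding V_def by blast
        then show False unfolding eq by simp
      qed
      ultimately show "y \<in> {y. y \<bullet> b = \<gamma> (y \<bullet> a)}" by simp
    qed
    then have "negligible (frontier \<Omega> \<inter> ball x r)"
      using negligible_lipschitz_graph[OF ab L] negligible_subset by blast
    with r show ?thesis by blast
  qed
  then obtain r where r: "\<And>x. x \<in> frontier \<Omega> \<Longrightarrow> r x > 0 \<and> negligible (frontier \<Omega> \<inter> ball x (r x))"
    by metis
  have "compact (frontier \<Omega>)" using assms(2) by (rule compact_frontier_bounded)
  then obtain D where D: "D \<subseteq> frontier \<Omega>" "finite D" "frontier \<Omega> \<subseteq> (\<Union>x\<in>D. ball x (r x))"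
  proof (rule compactE_image[where f = "\<lambda>x. ball x (r x)" and C = "frontier \<Omega>"])
    show "frontier \<Omega> \<subseteq> (\<Union>x\<in>frontier \<Omega>. ball x (r x))" using r by force
  qed auto
  have "negligible (\<Union>x\<in>D. frontier \<Omega> \<inter> ball x (r x))"
    using D r by (intro negligible_Union) auto
  then show ?thesis by (rule negligible_subset) (use D in auto)
qed

text \<open>With the closed inequality this is the sum of the frontier and a closed ball, hence
  compact for bounded \<Omega> and in particular measurable.\<close>

definition bdry_nbhd :: "(real^2) set \<Rightarrow> real \<Rightarrow> (real^2) set" where
  "bdry_nbhd \<Omega> r = {x. \<exists>y\<in>frontier \<Omega>. dist x y \<le> r}"

lemma bdry_nbhd_mono: "r \<le> s \<Longrightarrow> bdry_nbhd \<Omega> r \<subseteq> bdry_nbhd \<Omega> s"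
  by (force simp: bdry_nbhd_def)

text \<open>The segment from x to y meets the frontier, and by convexity it stays in the closed ball
  of radius r around p.\<close>

lemma bdry_nbhd_crossing:
  assumes "x \<in> \<Omega>" "y \<notin> \<Omega>" "dist p x \<le> r" "dist p y \<le> r"
  shows "p \<in> bdry_nbhd \<Omega> r"
proof -
  have "closed_segment x y \<inter> frontier \<Omega> \<noteq> {}"
    using assms by (intro connected_Int_frontier connected_segment) auto
  then obtain z where z: "z \<in> closed_segment x y" "z \<in> frontier \<Omega>" by blast
  have "closed_segment x y \<subseteq> cball p r" using assms by (intro closed_segment_subset) auto
  with z show ?thesis by (force simp: bdry_nbhd_def)
qed

lemma compact_bdry_nbhd:
  assumes "bounded \<Omega>"
  shows "compact (bdry_nbhd \<Omega> r)"
proof -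
  have "bdry_nbhd \<Omega> r = {y + z | y z. y \<in> frontier \<Omega> \<and> z \<in> cball 0 r}"
  proof (intro equalityI subsetI)
    fix x assume "x \<in> bdry_nbhd \<Omega> r"
    then obtain y where "y \<in> frontier \<Omega>" "dist x y \<le> r" by (auto simp: bdry_nbhd_def)
    moreover from this have "x = y + (x - y)" "x - y \<in> cball 0 r"
      by (simp_all add: dist_norm norm_minus_commute)
    ultimately show "x \<in> {y + z | y z. y \<in> frontier \<Omega> \<and> z \<in> cball 0 r}" by blast
  next
    fix x assume "x \<in> {y + z | y z. y \<in> frontier \<Omega> \<and> z \<in> cball 0 r}"
    then obtain y z where "x = y + z" "y \<in> frontier \<Omega>" "norm z \<le> r" by auto
    then show "x \<in> bdry_nbhd \<Omega> r" by (auto simp: bdry_nbhd_def dist_norm intro!: bexI[of _ y])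
  qed
  then show ?thesis by (simp only: compact_sums[OF compact_frontier_bounded[OF assms] compact_cball])
qed

lemma lmeasurable_bdry_nbhd: "bounded \<Omega> \<Longrightarrow> bdry_nbhd \<Omega> r \<in> lmeasurable"
  by (intro lmeasurable_compact compact_bdry_nbhd)

text \<open>Along the radii \<open>inverse (real (Suc n))\<close> the layers decrease to the
  frontier, which is closed and null; continuity from above applies since they have finite measure.
  Monotonicity in r passes from this sequence to the one-sided limit.\<close>

lemma measure_bdry_nbhd_tendsto:
  assumes "bounded \<Omega>" "negligible (frontier \<Omega>)"
  shows "((\<lambda>r. measure lebesgue (bdry_nbhd \<Omega> r)) \<longlongrightarrow> 0) (at_right 0)"
proof -
  define A where "A n = bdry_nbhd \<Omega> (inverse (real (Suc n)))" for n
  have mA: "A n \<in> lmeasurable" for n unfolding A_def by (rule lmeasurable_bdry_nbhd[OF assms(1)])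
  have fin: "emeasure lebesgue (A n) \<noteq> \<infinity>" for n
    using fmeasurableD2[OF mA[of n]] unfolding infinity_ennreal_def .
  have ran: "range A \<subseteq> sets lebesgue" using fmeasurableD[OF mA] by blast
  have dec: "decseq A" unfolding A_def decseq_def
    by (intro allI impI bdry_nbhd_mono) (simp add: le_imp_inverse_le)
  have Int: "(\<Inter>n. A n) = frontier \<Omega>"
  proof (intro equalityI subsetI)
    fix x assume x: "x \<in> (\<Inter>n. A n)"
    have "\<exists>y\<in>frontier \<Omega>. dist y x < e" if e: "e > 0" for e
    proof -
      obtain n where n: "inverse (real (Suc n)) < e" using reals_Archimedean[OF e] by blast
      have "x \<in> A n" using x by blast
      then obtain y where y: "y \<in> frontier \<Omega>" "dist x y \<le> inverse (real (Suc n))"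
        unfolding A_def bdry_nbhd_def by blast
      then show ?thesis using le_less_trans[OF y(2) n] by (metis dist_commute)
    qed
    then have "x \<in> closure (frontier \<Omega>)" unfolding closure_approachable by blast
    then show "x \<in> frontier \<Omega>" by (metis closure_closed frontier_closed)
  next
    fix x assume "x \<in> frontier \<Omega>"
    then have "x \<in> bdry_nbhd \<Omega> (inverse (real (Suc n)))" for n
      unfolding bdry_nbhd_def by (intro CollectI bexI[of _ x]) simp_all
    then show "x \<in> (\<Inter>n. A n)" by (simp add: A_def)
  qed
  have lim: "(\<lambda>n. measure lebesgue (A n)) \<longlonglongrightarrow> 0"
    using Lim_measure_decseq[OF ran dec fin] negligible_imp_measure0[OF assms(2)]
    unfolding Int by (simp only:)
  show ?thesis
  proof (rule order_tendstoI)
    fix c :: real assume "c < 0"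
    then show "\<forall>\<^sub>F r in at_right 0. c < measure lebesgue (bdry_nbhd \<Omega> r)"
      by (intro always_eventually) (auto intro: less_le_trans)
  next
    fix c :: real assume "0 < c"
    then obtain n where n: "measure lebesgue (A n) < c"
      using order_tendstoD(2)[OF lim] by (meson eventually_sequentially order_refl)
    have "measure lebesgue (bdry_nbhd \<Omega> r) < c" if "r < inverse (real (Suc n))" for r
    proof -
      have "measure lebesgue (bdry_nbhd \<Omega> r) \<le> measure lebesgue (A n)"
        unfolding A_def using that lmeasurable_bdry_nbhd[OF assms(1)]
        by (intro measure_mono_fmeasurable bdry_nbhd_mono) (auto simp: fmeasurableD)
      with n show ?thesis by simp
    qed
    moreover have "\<forall>\<^sub>F r in at_right 0. r < inverse (real (Suc n))"
      unfolding eventually_at_right_field by (intro exI[of _ "inverse (real (Suc n))"]) simp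
    ultimately show "\<forall>\<^sub>F r in at_right 0. measure lebesgue (bdry_nbhd \<Omega> r) < c"
      by (auto elim: eventually_mono)
  qed
qed

section \<open>Lattice cells\<close>

definition int_lattice :: "(real^2) set" where
  "int_lattice = {i. \<forall>k. i $ k \<in> \<int>}"

text \<open>Rounding with halves rounded up matches the half-open cell [-1/2, 1/2): each point of
  the plane gets exactly one lattice index, and the cells partition the plane.\<close>

definition idx :: "real \<Rightarrow> real^2 \<Rightarrow> real^2" where
  "idx \<epsilon> x = (\<chi> k. of_int \<lfloor>x $ k / \<epsilon> + 1 / 2\<rfloor>)"

definition cells :: "real \<Rightarrow> (real^2) set \<Rightarrow> (real^2) set" where
  "cells \<epsilon> J = {x. idx \<epsilon> x \<in> J}"

definition unit_steps :: "(real^2) set" where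
  "unit_steps = {axis 1 1, - axis 1 1, axis 2 1, - axis 2 1}"

lemma idx_in_lattice [simp]: "idx \<epsilon> x \<in> int_lattice"
  by (simp add: int_lattice_def idx_def)

lemma idx_eq_iff:
  assumes "i \<in> int_lattice"
  shows "idx \<epsilon> x = i \<longleftrightarrow> (\<forall>k. i $ k \<le> x $ k / \<epsilon> + 1 / 2 \<and> x $ k / \<epsilon> + 1 / 2 < i $ k + 1)"
proof -
  have "of_int \<lfloor>x $ k / \<epsilon> + 1 / 2\<rfloor> = i $ k \<longleftrightarrow> i $ k \<le> x $ k / \<epsilon> + 1 / 2 \<and> x $ k / \<epsilon> + 1 / 2 < i $ k + 1" for k
  proof -
    obtain n where n: "i $ k = of_int n" using assms by (auto simp: int_lattice_def elim: Ints_cases)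
    show ?thesis unfolding n by (simp add: floor_eq_iff)
  qed
  then show ?thesis by (simp add: idx_def vec_eq_iff)
qed

lemma idx_eq_iff':
  assumes "i \<in> int_lattice" "\<epsilon> > 0"
  shows "idx \<epsilon> x = i \<longleftrightarrow> (\<forall>k. \<epsilon> * (i $ k - 1 / 2) \<le> x $ k \<and> x $ k < \<epsilon> * (i $ k + 1 / 2))"
  unfolding idx_eq_iff[OF assms(1)] using assms(2) by (simp add: field_simps)

lemma mem_scaled_unit_cell_iff:
  assumes "i \<in> int_lattice" "\<epsilon> > 0"
  shows "x \<in> (\<lambda>w. \<epsilon> *\<^sub>R (i + w)) ` unit_cell \<longleftrightarrow> idx \<epsilon> x = i"
proof
  assume "x \<in> (\<lambda>w. \<epsilon> *\<^sub>R (i + w)) ` unit_cell"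
  then obtain w where w: "x = \<epsilon> *\<^sub>R (i + w)" "w \<in> unit_cell" by blast
  have "\<epsilon> * (i $ k - 1 / 2) \<le> \<epsilon> * (i $ k + w $ k)" "\<epsilon> * (i $ k + w $ k) < \<epsilon> * (i $ k + 1 / 2)" for k
    using w(2) assms(2) by (auto simp: unit_cell_def intro!: mult_left_mono mult_strict_left_mono)
  then show "idx \<epsilon> x = i" unfolding idx_eq_iff'[OF assms] w(1) by simp
next
  assume *: "idx \<epsilon> x = i"
  define w where "w = (1 / \<epsilon>) *\<^sub>R x - i"
  have "x = \<epsilon> *\<^sub>R (i + w)" using assms(2) by (simp add: w_def algebra_simps)
  moreover have "w \<in> unit_cell"
    using * unfolding idx_eq_iff[OF assms(1)] unit_cell_def w_def by (force simp: field_simps)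
  ultimately show "x \<in> (\<lambda>w. \<epsilon> *\<^sub>R (i + w)) ` unit_cell" by blast
qed

lemma idx_scaled [simp]:
  assumes "i \<in> int_lattice" "\<epsilon> > 0"
  shows "idx \<epsilon> (\<epsilon> *\<^sub>R i) = i"
  unfolding idx_eq_iff[OF assms(1)] using assms(2) by simp

lemma idx_shift:
  assumes "e \<in> int_lattice" "\<epsilon> > 0"
  shows "idx \<epsilon> (x + \<epsilon> *\<^sub>R e) = idx \<epsilon> x + e"
proof -
  have "idx \<epsilon> x + e \<in> int_lattice"
    using assms(1) idx_in_lattice[of \<epsilon> x] by (simp add: int_lattice_def)
  then show ?thesis
    using idx_eq_iff[OF idx_in_lattice[of \<epsilon> x], of \<epsilon> x] assms(2) by (simp add: idx_eq_iff field_simps)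
qed

text \<open>Each coordinate contributes at most \<epsilon> / 2 to the sum norm. This is cruder than
  the sharp constant \<epsilon> / sqrt 2, but it keeps the layer widths integer multiples of
  \<epsilon>.\<close>

lemma dist_idx_le:
  assumes "\<epsilon> > 0"
  shows "dist x (\<epsilon> *\<^sub>R idx \<epsilon> x) \<le> \<epsilon>"
proof -
  have b: "\<bar>x $ k - \<epsilon> * idx \<epsilon> x $ k\<bar> \<le> \<epsilon> / 2" for k
  proof -
    have "\<epsilon> * (idx \<epsilon> x $ k - 1 / 2) \<le> x $ k" "x $ k < \<epsilon> * (idx \<epsilon> x $ k + 1 / 2)"
      using idx_eq_iff'[OF idx_in_lattice[of \<epsilon> x] assms, of x] by blast+
    then show ?thesis unfolding right_diff_distrib distrib_left by linarith
  qed
  have "(\<Sum>k\<in>UNIV. \<bar>(x - \<epsilon> *\<^sub>R idx \<epsilon> x) $ k\<bar>) \<le> \<epsilon> / 2 + \<epsilon> / 2"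
    using add_mono[OF b[of 1] b[of 2]] by (simp add: sum_2)
  then show ?thesis using norm_le_l1_cart[of "x - \<epsilon> *\<^sub>R idx \<epsilon> x"] by (simp add: dist_norm)
qed

lemma unit_steps_subset: "unit_steps \<subseteq> int_lattice"
  by (auto simp: unit_steps_def int_lattice_def axis_def)

lemma norm_unit_steps: "e \<in> unit_steps \<Longrightarrow> norm e = 1"
  by (auto simp: unit_steps_def norm_axis_1)

lemma finite_unit_steps [simp]: "finite unit_steps"
  by (simp add: unit_steps_def)

lemma sum_unit_steps:
  "sum F unit_steps = F (axis 1 1) + F (- axis 1 1) + F (axis 2 1) + F (- axis 2 1)"
proof -
  have "axis 1 1 \<noteq> (axis 2 1 :: real^2)" "axis 1 1 \<noteq> - (axis 1 1 :: real^2)" "axis 1 1 \<noteq> - (axis 2 1 :: real^2)"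
    "axis 2 1 \<noteq> - (axis 1 1 :: real^2)" "axis 2 1 \<noteq> - (axis 2 1 :: real^2)" 
    by (simp_all add: vec_eq_iff forall_2 axis_def)
  then show ?thesis by (auto simp: unit_steps_def algebra_simps)
qed

lemma card_unit_steps: "card unit_steps = 4"
  using sum_unit_steps[of "\<lambda>_. 1::nat"] by simp

lemma lattice_add: "i \<in> int_lattice \<Longrightarrow> j \<in> int_lattice \<Longrightarrow> i + j \<in> int_lattice"
  and lattice_diff: "i \<in> int_lattice \<Longrightarrow> j \<in> int_lattice \<Longrightarrow> i - j \<in> int_lattice"
  by (simp_all add: int_lattice_def)

lemma lattice_cases:
  assumes "i \<in> int_lattice"
  obtains a b where "i $ 1 = of_int a" "i $ 2 = of_int b" "i = vector [of_int a, of_int b]"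
proof -
  have "i $ 1 \<in> \<int>" "i $ 2 \<in> \<int>" using assms by (simp_all add: int_lattice_def)
  then obtain a b where ab: "i $ 1 = of_int a" "i $ 2 = of_int b" by (meson Ints_cases)
  then have "i = vector [of_int a, of_int b]" by (simp add: vec_eq_iff forall_2)
  with ab that show thesis by blast
qed

lemma lattice_norm_1:
  assumes "e \<in> int_lattice" "norm e = 1"
  shows "e \<in> unit_steps"
proof -
  obtain a b where ab: "e $ 1 = of_int a" "e $ 2 = of_int b"
    by (rule lattice_cases[OF assms(1)])
  have "of_int (a\<^sup>2 + b\<^sup>2) = (1 :: real)" using assms(2) ab by (simp add: norm_sq_2)
  then have sq: "a\<^sup>2 + b\<^sup>2 = 1" by (simp only: of_int_eq_1_iff)
  have "a\<^sup>2 = 0 \<or> b\<^sup>2 = 0"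
  proof (rule ccontr)
    assume "\<not> ?thesis"
    then have "a\<^sup>2 \<ge> 1" "b\<^sup>2 \<ge> 1" by (simp_all add: int_one_le_iff_zero_less)
    with sq show False by simp
  qed
  then have "(a = 0 \<and> (b = 1 \<or> b = -1)) \<or> (b = 0 \<and> (a = 1 \<or> a = -1))"
    using sq by (auto simp: power2_eq_1_iff)
  then show ?thesis using ab by (auto simp: unit_steps_def vec_eq_iff forall_2 axis_def)
qed

lemma lattice_pts_iff: "i \<in> lattice_pts \<epsilon> \<Omega> \<longleftrightarrow> i \<in> int_lattice \<and> \<epsilon> *\<^sub>R i \<in> \<Omega>"
  by (auto simp: lattice_pts_def int_lattice_def)

lemma neighbours_eq:
  "neighbours \<epsilon> \<Omega> = {(i, i + e) | i e. i \<in> lattice_pts \<epsilon> \<Omega> \<and> e \<in> unit_steps \<and> i + e \<in> lattice_pts \<epsilon> \<Omega>}"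
proof (intro equalityI subsetI)
  fix p assume "p \<in> neighbours \<epsilon> \<Omega>"
  then obtain i j where p: "p = (i, j)" and ij: "i \<in> lattice_pts \<epsilon> \<Omega>" "j \<in> lattice_pts \<epsilon> \<Omega>" "norm (i - j) = 1"
    by (auto simp: neighbours_def)
  have step: "j - i \<in> unit_steps"
    using ij by (intro lattice_norm_1 lattice_diff) (auto simp: lattice_pts_iff norm_minus_commute)
  show "p \<in> {(i, i + e) | i e. i \<in> lattice_pts \<epsilon> \<Omega> \<and> e \<in> unit_steps \<and> i + e \<in> lattice_pts \<epsilon> \<Omega>}"
    unfolding p mem_Collect_eq by (intro exI[of _ i] exI[of _ "j - i"]) (simp add: ij step)
qed (auto simp: neighbours_def norm_unit_steps)

lemma finite_lattice_ball: "finite {i \<in> int_lattice. norm i \<le> R}"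
proof (rule finite_subset)
  show "{i \<in> int_lattice. norm i \<le> R} \<subseteq>
      (\<lambda>(a, b). vector [of_int a, of_int b]) ` ({-\<lceil>R\<rceil>..\<lceil>R\<rceil>} \<times> {-\<lceil>R\<rceil>..\<lceil>R\<rceil>})"
  proof
    fix i :: "real^2" assume "i \<in> {i \<in> int_lattice. norm i \<le> R}"
    then have i: "i \<in> int_lattice" "norm i \<le> R" by simp_all
    obtain a b where ab: "i $ 1 = of_int a" "i $ 2 = of_int b" "i = vector [of_int a, of_int b]"
      by (rule lattice_cases[OF i(1)])
    have "\<bar>i $ 1\<bar> \<le> R" "\<bar>i $ 2\<bar> \<le> R"
      by (rule order_trans[OF component_le_norm_cart i(2)])+
    then have "\<bar>a\<bar> \<le> \<lceil>R\<rceil>" "\<bar>b\<bar> \<le> \<lceil>R\<rceil>" unfolding ab(1,2) by linarith+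
    then have "(a, b) \<in> {-\<lceil>R\<rceil>..\<lceil>R\<rceil>} \<times> {-\<lceil>R\<rceil>..\<lceil>R\<rceil>}"
      unfolding mem_Times_iff fst_conv snd_conv atLeastAtMost_iff by linarith
    then show "i \<in> (\<lambda>(a, b). vector [of_int a, of_int b]) ` ({-\<lceil>R\<rceil>..\<lceil>R\<rceil>} \<times> {-\<lceil>R\<rceil>..\<lceil>R\<rceil>})"
      by (rule rev_image_eqI) (simp add: ab(3))
  qed
qed simp

lemma finite_idx_image:
  assumes "bounded A" "\<epsilon> > 0"
  shows "finite (idx \<epsilon> ` A)"
proof -
  obtain R where R: "\<And>x. x \<in> A \<Longrightarrow> norm x \<le> R" using assms(1) by (auto simp: bounded_iff)
  have "norm (idx \<epsilon> x) \<le> (R + \<epsilon>) / \<epsilon>" if "x \<in> A" for x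
  proof -
    have "norm (\<epsilon> *\<^sub>R idx \<epsilon> x) \<le> norm x + dist x (\<epsilon> *\<^sub>R idx \<epsilon> x)"
      using norm_triangle_sub[of "\<epsilon> *\<^sub>R idx \<epsilon> x" x] by (simp add: dist_norm norm_minus_commute)
    also have "\<dots> \<le> R + \<epsilon>" using R[OF that] dist_idx_le[OF assms(2), of x] by simp
    finally show ?thesis using assms(2) by (simp add: field_simps)
  qed
  then have "idx \<epsilon> ` A \<subseteq> {i \<in> int_lattice. norm i \<le> (R + \<epsilon>) / \<epsilon>}" by auto
  then show ?thesis using finite_lattice_ball finite_subset by blast
qed

lemma finite_lattice_pts:
  assumes "bounded \<Omega>" "\<epsilon> > 0"
  shows "finite (lattice_pts \<epsilon> \<Omega>)"
proof (rule finite_subset)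
  show "lattice_pts \<epsilon> \<Omega> \<subseteq> idx \<epsilon> ` \<Omega>"
  proof
    fix i assume "i \<in> lattice_pts \<epsilon> \<Omega>"
    then have i: "i \<in> int_lattice" "\<epsilon> *\<^sub>R i \<in> \<Omega>" unfolding lattice_pts_iff by blast+
    have "idx \<epsilon> (\<epsilon> *\<^sub>R i) \<in> idx \<epsilon> ` \<Omega>" using i(2) by (rule imageI)
    then show "i \<in> idx \<epsilon> ` \<Omega>" by (simp only: idx_scaled[OF i(1) assms(2)])
  qed
qed (rule finite_idx_image[OF assms])

lemma borel_measurable_idx [measurable]: "idx \<epsilon> \<in> borel_measurable borel"
proof (rule borel_measurable_euclidean_space[THEN iffD2, rule_format])
  fix b :: "real^2" assume "b \<in> Basis"
  then obtain k where b: "b = axis k 1" by (auto simp: Basis_vec_def)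
  have "(\<lambda>x. idx \<epsilon> x \<bullet> b) = (\<lambda>x. of_int \<lfloor>(x \<bullet> b) / \<epsilon> + 1 / 2\<rfloor>)"
    unfolding b cart_eq_inner_axis[symmetric] idx_def vec_lambda_beta ..
  moreover have "(\<lambda>x. of_int \<lfloor>(x \<bullet> b) / \<epsilon> + 1 / 2\<rfloor> :: real) \<in> borel_measurable borel"
    by measurable
  ultimately show "(\<lambda>x. idx \<epsilon> x \<bullet> b) \<in> borel_measurable borel" by simp
qed

lemma cell_borel: "cells \<epsilon> {i} \<in> sets borel"
proof -
  have "cells \<epsilon> {i} = idx \<epsilon> -` {i} \<inter> space borel" by (auto simp: cells_def)
  also have "\<dots> \<in> sets borel" by (rule measurable_sets[OF borel_measurable_idx]) simp
  finally show ?thesis .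
qed

text \<open>The half-open cell lies between the open and the closed box with the same corners, which
  have equal measure.\<close>

lemma emeasure_cell:
  assumes "i \<in> int_lattice" "\<epsilon> > 0"
  shows "emeasure lebesgue (cells \<epsilon> {i}) = ennreal (\<epsilon>\<^sup>2)"
proof -
  define a b :: "real^2" where "a = (\<chi> k. \<epsilon> * (i $ k - 1 / 2))" and "b = (\<chi> k. \<epsilon> * (i $ k + 1 / 2))"
  have ab: "a $ k \<le> b $ k" for k using assms(2) by (simp add: a_def b_def)
  have "cells \<epsilon> {i} = {x. \<forall>k. a $ k \<le> x $ k \<and> x $ k < b $ k}"
    by (auto simp: cells_def idx_eq_iff'[OF assms] a_def b_def)
  then have sub: "box a b \<subseteq> cells \<epsilon> {i}" "cells \<epsilon> {i} \<subseteq> cbox a b"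
    by (auto simp: mem_box_cart less_imp_le)
  have ne: "cbox a b \<noteq> {}" using ab by (simp add: interval_ne_empty_cart)
  have "measure lborel (cbox a b) = \<epsilon>\<^sup>2"
    using content_cbox_cart[OF ne] by (simp add: prod_2 a_def b_def power2_eq_square algebra_simps)
  then have c: "emeasure lborel (cbox a b) = ennreal (\<epsilon>\<^sup>2)"
    using emeasure_eq_ennreal_measure[of lborel "cbox a b"] emeasure_lborel_cbox_finite[of a b]
    by (simp add: less_top)
  have "emeasure lborel (box a b) = emeasure lborel (cbox a b)"
    by (simp add: emeasure_lborel_box_eq emeasure_lborel_cbox_eq)
  then have "emeasure lborel (cells \<epsilon> {i}) = ennreal (\<epsilon>\<^sup>2)"
    using emeasure_mono[OF sub(1), of lborel] emeasure_mono[OF sub(2), of lborel] c cell_borel[of \<epsilon> i]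
    by (simp add: antisym)
  then show ?thesis using cell_borel[of \<epsilon> i] by simp
qed

lemma cells_UN: "cells \<epsilon> J = (\<Union>i\<in>J. cells \<epsilon> {i})"
  by (auto simp: cells_def)

lemma disjoint_cells: "disjoint_family_on (\<lambda>i. cells \<epsilon> {i}) J"
  by (auto simp: disjoint_family_on_def cells_def)

lemma lmeasurable_cells:
  assumes "finite J" "J \<subseteq> int_lattice" "\<epsilon> > 0"
  shows "cells \<epsilon> J \<in> lmeasurable"
proof -
  have "cells \<epsilon> {i} \<in> lmeasurable" if "i \<in> J" for i
    using emeasure_cell[of i \<epsilon>] that assms cell_borel[of \<epsilon> i]
    by (intro fmeasurableI) (auto simp: sets_completionI_sets)
  then show ?thesis unfolding cells_UN[of \<epsilon> J] using assms(1) by (intro fmeasurable.finite_UN) auto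
qed

lemma measure_cell: "i \<in> int_lattice \<Longrightarrow> \<epsilon> > 0 \<Longrightarrow> measure lebesgue (cells \<epsilon> {i}) = \<epsilon>\<^sup>2"
  using emeasure_cell[of i \<epsilon>] by (simp only: measure_def enn2real_ennreal zero_le_power2)

lemma measure_cells:
  assumes "finite J" "J \<subseteq> int_lattice" "\<epsilon> > 0"
  shows "measure lebesgue (cells \<epsilon> J) = \<epsilon>\<^sup>2 * card J"
proof -
  have c: "cells \<epsilon> {i} \<in> lmeasurable" if "i \<in> J" for i
    by (rule lmeasurable_cells) (use that assms in auto)
  have "measure lebesgue (\<Union>i\<in>J. cells \<epsilon> {i}) = (\<Sum>i\<in>J. measure lebesgue (cells \<epsilon> {i}))"
  proof (rule measure_finite_Union[OF assms(1) _ disjoint_cells])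
    show "(\<lambda>i. cells \<epsilon> {i}) ` J \<subseteq> sets lebesgue" using fmeasurableD[OF c] by blast
    show "emeasure lebesgue (cells \<epsilon> {i}) \<noteq> \<infinity>" if "i \<in> J" for i
      using fmeasurableD2[OF c[OF that]] unfolding infinity_ennreal_def .
  qed
  then have "measure lebesgue (cells \<epsilon> J) = (\<Sum>i\<in>J. measure lebesgue (cells \<epsilon> {i}))"
    by (simp only: cells_UN[of \<epsilon> J])
  also have "\<dots> = (\<Sum>i\<in>J. \<epsilon>\<^sup>2)" using assms by (intro sum.cong measure_cell) auto
  finally show ?thesis by simp
qed

text \<open>A point of the cell of i is within \<epsilon> of the lattice point, and a unit step
  moves it by another \<epsilon>; the radius \<open>2 * \<epsilon>\<close> thus keeps the cell and
  its four shifted copies inside \<Omega>.\<close>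

definition inner_pts :: "real \<Rightarrow> (real^2) set \<Rightarrow> (real^2) set" where
  "inner_pts \<epsilon> \<Omega> = {i \<in> int_lattice. cball (\<epsilon> *\<^sub>R i) (2 * \<epsilon>) \<subseteq> \<Omega>}"

context
  fixes \<Omega> :: "(real^2) set" and \<epsilon> :: real
  assumes bounded: "bounded \<Omega>" and eps: "\<epsilon> > 0"
begin

lemma inner_pts_subset: "inner_pts \<epsilon> \<Omega> \<subseteq> lattice_pts \<epsilon> \<Omega>"
  using eps by (force simp: inner_pts_def lattice_pts_iff)

lemma inner_pts_lattice: "inner_pts \<epsilon> \<Omega> \<subseteq> int_lattice"
  by (auto simp: inner_pts_def)

lemma finite_inner_pts: "finite (inner_pts \<epsilon> \<Omega>)"
  using inner_pts_subset finite_lattice_pts[OF bounded eps] by (rule finite_subset)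

lemma inner_pts_step:
  assumes "i \<in> inner_pts \<epsilon> \<Omega>" "e \<in> unit_steps"
  shows "i + e \<in> lattice_pts \<epsilon> \<Omega>"
proof -
  have "dist (\<epsilon> *\<^sub>R i) (\<epsilon> *\<^sub>R (i + e)) = \<epsilon>"
    using norm_unit_steps[OF assms(2)] eps by (simp add: dist_norm algebra_simps)
  then have "\<epsilon> *\<^sub>R (i + e) \<in> cball (\<epsilon> *\<^sub>R i) (2 * \<epsilon>)" using eps by simp
  then show ?thesis
    using assms unit_steps_subset by (auto simp: inner_pts_def lattice_pts_iff intro: lattice_add)
qed

lemma inner_cells_shift:
  assumes "x \<in> cells \<epsilon> (inner_pts \<epsilon> \<Omega>)" "norm e \<le> 1"
  shows "x + \<epsilon> *\<^sub>R e \<in> \<Omega>"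
proof -
  have "dist (\<epsilon> *\<^sub>R idx \<epsilon> x) (x + \<epsilon> *\<^sub>R e) \<le> dist x (\<epsilon> *\<^sub>R idx \<epsilon> x) + dist x (x + \<epsilon> *\<^sub>R e)"
    by (metis dist_commute dist_triangle)
  also have "\<dots> \<le> \<epsilon> + \<epsilon>"
    using dist_idx_le[OF eps, of x] assms(2) eps by (intro add_mono) (auto simp: dist_norm)
  finally show ?thesis using assms(1) by (auto simp: cells_def inner_pts_def)
qed

lemma inner_cells_subset: "cells \<epsilon> (inner_pts \<epsilon> \<Omega>) \<subseteq> \<Omega>"
  using inner_cells_shift[of _ 0] by auto

text \<open>The lattice point of the cell of x is within \<epsilon> of x and has a point outside
  \<Omega> within \<open>2 * \<epsilon>\<close>; the width of the layer is the sum of the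
  two.\<close>

lemma Diff_inner_cells: "\<Omega> - cells \<epsilon> (inner_pts \<epsilon> \<Omega>) \<subseteq> bdry_nbhd \<Omega> (3 * \<epsilon>)"
proof
  fix x assume x: "x \<in> \<Omega> - cells \<epsilon> (inner_pts \<epsilon> \<Omega>)"
  then obtain y where y: "y \<notin> \<Omega>" "dist (\<epsilon> *\<^sub>R idx \<epsilon> x) y \<le> 2 * \<epsilon>"
    by (auto simp: cells_def inner_pts_def subset_eq)
  have "dist x y \<le> 3 * \<epsilon>"
    using dist_triangle[of x y "\<epsilon> *\<^sub>R idx \<epsilon> x"] dist_idx_le[OF eps, of x] y by simp
  then show "x \<in> bdry_nbhd \<Omega> (3 * \<epsilon>)" using x y eps by (intro bdry_nbhd_crossing[of x \<Omega> y]) auto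
qed

lemma cells_outer: "cells \<epsilon> (lattice_pts \<epsilon> \<Omega> - inner_pts \<epsilon> \<Omega>) \<subseteq> bdry_nbhd \<Omega> (3 * \<epsilon>)"
proof
  fix x assume x: "x \<in> cells \<epsilon> (lattice_pts \<epsilon> \<Omega> - inner_pts \<epsilon> \<Omega>)"
  then obtain y where y: "y \<notin> \<Omega>" "dist (\<epsilon> *\<^sub>R idx \<epsilon> x) y \<le> 2 * \<epsilon>"
    by (auto simp: cells_def inner_pts_def subset_eq)
  have "dist x y \<le> 3 * \<epsilon>"
    using dist_triangle[of x y "\<epsilon> *\<^sub>R idx \<epsilon> x"] dist_idx_le[OF eps, of x] y by simp
  moreover have "dist x (\<epsilon> *\<^sub>R idx \<epsilon> x) \<le> 3 * \<epsilon>" using dist_idx_le[OF eps, of x] eps by simp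
  moreover have "\<epsilon> *\<^sub>R idx \<epsilon> x \<in> \<Omega>" using x by (simp add: cells_def lattice_pts_iff)
  ultimately show "x \<in> bdry_nbhd \<Omega> (3 * \<epsilon>)" using y by (intro bdry_nbhd_crossing)
qed

text \<open>The cells of these points are disjoint, have area \<open>\<epsilon>\<^sup>2\<close> each
  and lie in the layer, so a count becomes an area.\<close>

lemma card_outer_le:
  "\<epsilon>\<^sup>2 * card (lattice_pts \<epsilon> \<Omega> - inner_pts \<epsilon> \<Omega>) \<le> measure lebesgue (bdry_nbhd \<Omega> (3 * \<epsilon>))"
proof -
  let ?J = "lattice_pts \<epsilon> \<Omega> - inner_pts \<epsilon> \<Omega>"
  have J: "finite ?J" "?J \<subseteq> int_lattice"
    using finite_lattice_pts[OF bounded eps] by (auto simp: lattice_pts_iff)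
  have "measure lebesgue (cells \<epsilon> ?J) \<le> measure lebesgue (bdry_nbhd \<Omega> (3 * \<epsilon>))"
    using lmeasurable_cells[OF J eps] lmeasurable_bdry_nbhd[OF bounded]
    by (intro measure_mono_fmeasurable cells_outer) (auto simp: fmeasurableD)
  then show ?thesis by (simp add: measure_cells[OF J eps])
qed

end

section \<open>Approximation in L1\<close>

text \<open>Measurability provides continuous functions g n that converge almost everywhere, without
  any domination. A spatial cutoff and the projection of the values onto the ball of radius k make f
  and all g n bounded with bounded support, and the continuity of the projection preserves the
  convergence. The truncation level k is chosen for f first, then n by dominated
  convergence.\<close>

lemma continuous_L1_approximation:
  fixes f :: "'a::euclidean_space \<Rightarrow> 'b::euclidean_space"
  assumes f: "integrable lebesgue f" and "0 < \<eta>"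
  obtains \<psi> where "continuous_on UNIV \<psi>" "integrable lebesgue \<psi>" "(\<integral>x. norm (f x - \<psi> x) \<partial>lebesgue) < \<eta>"
proof -
  have [measurable]: "f \<in> borel_measurable lebesgue" using f by simp
  obtain N g where N: "negligible N" and g: "\<And>n. continuous_on UNIV (g n)"
    and lim: "\<And>x. x \<notin> N \<Longrightarrow> (\<lambda>n. g n x) \<longlonglongrightarrow> f x"
    using lebesgue_measurable_imp_measurable_on[of f UNIV] unfolding measurable_on_def by auto
  define P where "P k = closest_point (cball (0::'b) (real k))" for k
  define cut where "cut k x = max 0 (min 1 (real k + 1 - norm x))" for k and x :: 'a
  have cP: "continuous_on UNIV (P k)" for k
    unfolding P_def by (rule continuous_on_closest_point) auto
  have P_bound: "norm (P k y) \<le> real k" for k y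
    using closest_point_in_set[of "cball (0::'b) (real k)" y] by (simp add: P_def)
  have P_self: "norm y \<le> real k \<Longrightarrow> P k y = y" for k y
    by (simp add: P_def closest_point_self)
  have P_le: "norm (P k y) \<le> norm y" for k y
    using closest_point_lipschitz[of "cball (0::'b) (real k)" y 0] P_self[of 0 k]
    by (simp add: P_def)
  have ccut: "continuous_on UNIV (cut k)" for k unfolding cut_def by (intro continuous_intros)
  have cut01: "0 \<le> cut k x" "cut k x \<le> 1" for k x by (simp_all add: cut_def)
  have cut0: "cut k x = 0" if "x \<notin> cball 0 (real k + 1)" for k x using that by (simp add: cut_def)
  have cut1: "cut k x = 1" if "norm x \<le> real k" for k x using that by (simp add: cut_def)
  have [measurable]: "P k \<in> borel_measurable borel" for k
    using cP by (intro borel_measurable_continuous_onI)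
  have [measurable]: "cut k \<in> borel_measurable lebesgue" "g n \<in> borel_measurable lebesgue" for k n
    using ccut g by (simp_all add: measurable_completion borel_measurable_continuous_onI)
  have "(\<lambda>k. \<integral>x. norm (f x - cut k x *\<^sub>R P k (f x)) \<partial>lebesgue) \<longlonglongrightarrow> (\<integral>x. 0 \<partial>(lebesgue :: 'a measure))"
  proof (rule integral_dominated_convergence[where w = "\<lambda>x. 2 * norm (f x)"])
    show "integrable lebesgue (\<lambda>x. 2 * norm (f x))" using f by simp
    show "AE x in lebesgue. (\<lambda>k. norm (f x - cut k x *\<^sub>R P k (f x))) \<longlonglongrightarrow> 0"
    proof (rule AE_I2)
      fix x
      obtain k0 :: nat where k0: "max (norm x) (norm (f x)) \<le> real k0" using real_arch_simple by blast
      have "norm (f x - cut k x *\<^sub>R P k (f x)) = 0" if "k \<ge> k0" for k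
      proof -
        have "norm x \<le> real k" "norm (f x) \<le> real k" using k0 that by linarith+
        then show ?thesis by (simp add: P_self cut1)
      qed
      then show "(\<lambda>k. norm (f x - cut k x *\<^sub>R P k (f x))) \<longlonglongrightarrow> 0"
        by (intro tendsto_eventually) (auto simp: eventually_sequentially)
    qed
    fix k
    have "norm (f x - cut k x *\<^sub>R P k (f x)) \<le> 2 * norm (f x)" for x
    proof -
      have "norm (cut k x *\<^sub>R P k (f x)) \<le> norm (f x)"
        using cut01[of k x] P_le[of k "f x"] mult_mono[of "cut k x" 1 "norm (P k (f x))" "norm (f x)"] by simp
      then show ?thesis using norm_triangle_ineq4[of "f x" "cut k x *\<^sub>R P k (f x)"] by simp
    qed
    then show "AE x in lebesgue. norm (norm (f x - cut k x *\<^sub>R P k (f x))) \<le> 2 * norm (f x)" by simp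
  qed measurable
  then have "\<forall>\<^sub>F k in sequentially. (\<integral>x. norm (f x - cut k x *\<^sub>R P k (f x)) \<partial>lebesgue) < \<eta> / 2"
    using \<open>0 < \<eta>\<close> by (intro order_tendstoD(2)[where y = "0"]) auto
  then obtain k where k: "(\<integral>x. norm (f x - cut k x *\<^sub>R P k (f x)) \<partial>lebesgue) < \<eta> / 2"
    by (auto simp: eventually_sequentially)
  define D where "D x = real k * indicator (cball 0 (real k + 1)) x" for x :: 'a
  have "integrable lebesgue (indicator (cball (0::'a) (real k + 1)) :: 'a \<Rightarrow> real)"
    using lmeasurable_cball by (simp only: lmeasurable_iff_integrable)
  then have D: "integrable lebesgue D" "integrable lebesgue (\<lambda>x. 2 * D x)" unfolding D_def by auto
  have bnd: "norm (cut k x *\<^sub>R P k y) \<le> D x" for x y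
    using cut01[of k x] P_bound[of k y] cut0[of x k] mult_mono[of "cut k x" 1 "norm (P k y)" "real k"]
    by (auto simp: D_def indicator_def)
  have int: "integrable lebesgue (\<lambda>x. cut k x *\<^sub>R P k (q x))" if [measurable]: "q \<in> borel_measurable lebesgue" for q
  proof (rule Bochner_Integration.integrable_bound[OF D(1)])
    show "(\<lambda>x. cut k x *\<^sub>R P k (q x)) \<in> borel_measurable lebesgue" by measurable
    have "norm (cut k x *\<^sub>R P k (q x)) \<le> norm (D x)" for x
      unfolding real_norm_def[of "D x"] by (rule order_trans[OF bnd abs_ge_self])
    then show "AE x in lebesgue. norm (cut k x *\<^sub>R P k (q x)) \<le> norm (D x)" by simp
  qed
  have int\<psi>: "integrable lebesgue (\<lambda>x. cut k x *\<^sub>R P k (g n x))" "integrable lebesgue (\<lambda>x. cut k x *\<^sub>R P k (f x))" for n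
    by (rule int, measurable)+
  have "(\<lambda>n. \<integral>x. norm (cut k x *\<^sub>R P k (f x) - cut k x *\<^sub>R P k (g n x)) \<partial>lebesgue) \<longlonglongrightarrow> (\<integral>x. 0 \<partial>(lebesgue :: 'a measure))"
  proof (rule integral_dominated_convergence[where w = "\<lambda>x. 2 * D x"])
    have "AE x in lebesgue. x \<notin> N" using N by (simp add: AE_not_in negligible_iff_null_sets)
    then show "AE x in lebesgue. (\<lambda>n. norm (cut k x *\<^sub>R P k (f x) - cut k x *\<^sub>R P k (g n x))) \<longlonglongrightarrow> 0"
    proof eventually_elim
      case (elim x)
      have "isCont (P k) (f x)" using cP[of k] by (simp add: continuous_on_eq_continuous_at)
      then have "(\<lambda>n. P k (g n x)) \<longlonglongrightarrow> P k (f x)" using lim[OF elim] by (rule isCont_tendsto_compose)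
      then have "(\<lambda>n. norm (cut k x *\<^sub>R P k (f x) - cut k x *\<^sub>R P k (g n x))) \<longlonglongrightarrow>
          norm (cut k x *\<^sub>R P k (f x) - cut k x *\<^sub>R P k (f x))" by (intro tendsto_intros)
      then show ?case by simp
    qed
    fix n
    have "norm (cut k x *\<^sub>R P k (f x) - cut k x *\<^sub>R P k (g n x)) \<le> 2 * D x" for x
      using norm_triangle_ineq4[of "cut k x *\<^sub>R P k (f x)" "cut k x *\<^sub>R P k (g n x)"] bnd[of x "f x"] bnd[of x "g n x"]
      by linarith
    then show "AE x in lebesgue. norm (norm (cut k x *\<^sub>R P k (f x) - cut k x *\<^sub>R P k (g n x))) \<le> 2 * D x" by simp
    show "(\<lambda>x. norm (cut k x *\<^sub>R P k (f x) - cut k x *\<^sub>R P k (g n x))) \<in> borel_measurable lebesgue"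
      by measurable
  qed (use D in simp_all)
  then have "\<forall>\<^sub>F n in sequentially. (\<integral>x. norm (cut k x *\<^sub>R P k (f x) - cut k x *\<^sub>R P k (g n x)) \<partial>lebesgue) < \<eta> / 2"
    using \<open>0 < \<eta>\<close> by (intro order_tendstoD(2)[where y = "0"]) auto
  then obtain n where n: "(\<integral>x. norm (cut k x *\<^sub>R P k (f x) - cut k x *\<^sub>R P k (g n x)) \<partial>lebesgue) < \<eta> / 2"
    by (auto simp: eventually_sequentially)
  let ?\<psi> = "\<lambda>x. cut k x *\<^sub>R P k (g n x)" and ?f = "\<lambda>x. cut k x *\<^sub>R P k (f x)"
  have "(\<integral>x. norm (f x - ?\<psi> x) \<partial>lebesgue) \<le> (\<integral>x. norm (f x - ?f x) + norm (?f x - ?\<psi> x) \<partial>lebesgue)"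
  proof (rule integral_mono)
    fix x show "norm (f x - ?\<psi> x) \<le> norm (f x - ?f x) + norm (?f x - ?\<psi> x)"
      using norm_triangle_ineq[of "f x - ?f x" "?f x - ?\<psi> x"] by simp
  qed (use f int\<psi> in auto)
  also have "\<dots> = (\<integral>x. norm (f x - ?f x) \<partial>lebesgue) + (\<integral>x. norm (?f x - ?\<psi> x) \<partial>lebesgue)"
    by (rule Bochner_Integration.integral_add) (use f int\<psi> in auto)
  finally have "(\<integral>x. norm (f x - ?\<psi> x) \<partial>lebesgue) < \<eta>" using k n by simp
  moreover have "continuous_on UNIV ?\<psi>"
    by (intro continuous_on_scaleR ccut continuous_on_compose2[OF cP g]) auto
  ultimately show thesis using int\<psi> that by blast
qed

text \<open>The measure is the completed one, so even the measurability of the translate needs an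
  argument; it comes from the affine change of variables with all scaling factors equal to
  1.\<close>

lemma lebesgue_integral_translation:
  fixes F :: "'a::euclidean_space \<Rightarrow> 'b::{banach, second_countable_topology}"
  assumes "F \<in> borel_measurable lebesgue"
  shows "(\<integral>x. F (h + x) \<partial>lebesgue) = (\<integral>x. F x \<partial>lebesgue)"
    and "(\<lambda>x. F (h + x)) \<in> borel_measurable lebesgue"
proof -
  have T: "(\<lambda>x. h + (\<Sum>j\<in>Basis. (1 * (x \<bullet> j)) *\<^sub>R j)) = (\<lambda>x::'a. h + x)"
    by (simp add: euclidean_representation)
  have m: "(\<lambda>x. h + x) \<in> lebesgue \<rightarrow>\<^sub>M lebesgue"
    using lebesgue_affine_measurable[of "\<lambda>_::'a. 1" h] unfolding T by simp
  have "lebesgue = distr lebesgue lebesgue (\<lambda>x. h + x)"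
    using lebesgue_affine_euclidean[of "\<lambda>_::'a. 1" h] unfolding T by (simp add: density_1)
  then show "(\<integral>x. F (h + x) \<partial>lebesgue) = (\<integral>x. F x \<partial>lebesgue)"
    using integral_distr[OF m assms] by simp
  show "(\<lambda>x. F (h + x)) \<in> borel_measurable lebesgue"
    using measurable_compose[OF m assms] .
qed

lemma integrable_inner_bounded:
  fixes \<phi> G :: "'a \<Rightarrow> 'b::euclidean_space"
  assumes "integrable M \<phi>" and [measurable]: "G \<in> borel_measurable M" and "\<And>x. norm (G x) \<le> C"
  shows "integrable M (\<lambda>x. \<phi> x \<bullet> G x)"
proof (rule Bochner_Integration.integrable_bound)
  show "integrable M (\<lambda>x. C * norm (\<phi> x))" using assms(1) by simp
  have [measurable]: "\<phi> \<in> borel_measurable M" using assms(1) by simp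
  show "(\<lambda>x. \<phi> x \<bullet> G x) \<in> borel_measurable M" by measurable
  have "norm (\<phi> x \<bullet> G x) \<le> norm (C * norm (\<phi> x))" for x
  proof -
    have "\<bar>\<phi> x \<bullet> G x\<bar> \<le> norm (\<phi> x) * norm (G x)" by (rule Cauchy_Schwarz_ineq2)
    also have "\<dots> \<le> norm (\<phi> x) * C" using assms(3) by (intro mult_left_mono) auto
    also have "\<dots> \<le> \<bar>C * norm (\<phi> x)\<bar>" by (simp add: mult.commute)
    finally show ?thesis by simp
  qed
  then show "AE x in M. norm (\<phi> x \<bullet> G x) \<le> norm (C * norm (\<phi> x))" by simp
qed

lemma integral_inner_bounded_le:
  fixes \<phi> G :: "'a \<Rightarrow> 'b::euclidean_space"
  assumes "integrable M \<phi>" "G \<in> borel_measurable M" "\<And>x. norm (G x) \<le> C"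
  shows "\<bar>\<integral>x. \<phi> x \<bullet> G x \<partial>M\<bar> \<le> C * (\<integral>x. norm (\<phi> x) \<partial>M)"
proof -
  have "\<bar>\<integral>x. \<phi> x \<bullet> G x \<partial>M\<bar> \<le> (\<integral>x. norm (\<phi> x \<bullet> G x) \<partial>M)"
    using integral_norm_bound[of M "\<lambda>x. \<phi> x \<bullet> G x"] by simp
  also have "\<dots> \<le> (\<integral>x. C * norm (\<phi> x) \<partial>M)"
  proof (rule integral_mono)
    fix x
    have "\<bar>\<phi> x \<bullet> G x\<bar> \<le> norm (\<phi> x) * norm (G x)" by (rule Cauchy_Schwarz_ineq2)
    also have "\<dots> \<le> norm (\<phi> x) * C" using assms(3) by (intro mult_left_mono) auto
    finally show "norm (\<phi> x \<bullet> G x) \<le> C * norm (\<phi> x)" by (simp add: mult.commute)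
  qed (use assms integrable_inner_bounded[OF assms] in auto)
  finally show ?thesis by simp
qed

text \<open>Continuity of translations in L1, in dual form: \<delta> serves all fields G bounded by
  1 and supported in \<Omega>, since the lattice fields vary with \<epsilon>. A continuous \<psi>
  close to \<phi> replaces it in both pairings at the cost of \<eta> / 3 each; the last third is the
  uniform continuity of \<psi>.\<close>

lemma uniform_shift_pairing:
  fixes \<phi> :: "'a::euclidean_space \<Rightarrow> 'b::euclidean_space"
  assumes "bounded \<Omega>" and \<phi>: "integrable lebesgue \<phi>" and "0 < \<eta>"
  obtains \<delta> where "\<delta> > 0" "\<And>h G. norm h < \<delta> \<Longrightarrow> G \<in> borel_measurable lebesgue \<Longrightarrow> (\<And>x. norm (G x) \<le> 1) \<Longrightarrow>
      (\<And>x. x \<notin> \<Omega> \<Longrightarrow> G x = 0) \<Longrightarrow>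
      \<bar>(\<integral>x. \<phi> x \<bullet> G (h + x) \<partial>lebesgue) - (\<integral>x. \<phi> x \<bullet> G x \<partial>lebesgue)\<bar> \<le> \<eta>"
proof -
  obtain \<psi> where \<psi>: "continuous_on UNIV \<psi>" "integrable lebesgue \<psi>" "(\<integral>x. norm (\<phi> x - \<psi> x) \<partial>lebesgue) < \<eta> / 3"
    using continuous_L1_approximation[OF \<phi>, of "\<eta> / 3"] \<open>0 < \<eta>\<close> by (metis divide_pos_pos zero_less_numeral)
  obtain R where R: "\<Omega> \<subseteq> cball 0 R" "R > 0" using bounded_subset_ballD[OF \<open>bounded \<Omega>\<close>, of 0] ball_subset_cball by (metis subset_trans)
  define m where "m = measure lebesgue (cball (0::'a) R)"
  have "m \<ge> 0" by (simp add: m_def)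
  \<comment> \<open>The margin 1 leaves room for a shift with \<open>norm h < 1\<close>.\<close>
  have "uniformly_continuous_on (cball 0 (R + 1)) \<psi>"
    using \<psi>(1) by (intro compact_uniformly_continuous compact_cball) (auto intro: continuous_on_subset)
  moreover have "\<eta> / 3 / (m + 1) > 0" using \<open>0 < \<eta>\<close> \<open>m \<ge> 0\<close> by simp
  ultimately obtain d where d: "d > 0" "\<And>x y. x \<in> cball 0 (R + 1) \<Longrightarrow> y \<in> cball 0 (R + 1) \<Longrightarrow>
      dist y x < d \<Longrightarrow> dist (\<psi> y) (\<psi> x) < \<eta> / 3 / (m + 1)"
    unfolding uniformly_continuous_on_def by metis
  show thesis
  proof (rule that[of "min d 1"])
    fix h :: 'a and G :: "'a \<Rightarrow> 'b"
    assume h: "norm h < min d 1" and G: "G \<in> borel_measurable lebesgue" "\<And>x. norm (G x) \<le> 1"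
      "\<And>x. x \<notin> \<Omega> \<Longrightarrow> G x = 0"
    note Gh = lebesgue_integral_translation(2)[OF G(1), of h]
    have \<psi>m: "\<psi> \<in> borel_measurable lebesgue" using \<psi>(2) by simp
    note \<psi>h = lebesgue_integral_translation(2)[OF \<psi>m, of "-h"]
    have \<phi>\<psi>: "integrable lebesgue (\<lambda>x. \<phi> x - \<psi> x)" using \<phi> \<psi>(2) by simp
    have 1: "\<bar>(\<integral>x. \<phi> x \<bullet> G (h + x) \<partial>lebesgue) - (\<integral>x. \<psi> x \<bullet> G (h + x) \<partial>lebesgue)\<bar> \<le> \<eta> / 3"
    proof -
      have "(\<integral>x. \<phi> x \<bullet> G (h + x) \<partial>lebesgue) - (\<integral>x. \<psi> x \<bullet> G (h + x) \<partial>lebesgue)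
          = (\<integral>x. (\<phi> x - \<psi> x) \<bullet> G (h + x) \<partial>lebesgue)"
        unfolding inner_diff_left
        by (rule Bochner_Integration.integral_diff[symmetric]) (rule integrable_inner_bounded, fact, fact Gh, rule G(2))+
      then show ?thesis using integral_inner_bounded_le[OF \<phi>\<psi> Gh G(2)] \<psi>(3) by simp
    qed
    have 2: "\<bar>(\<integral>x. \<phi> x \<bullet> G x \<partial>lebesgue) - (\<integral>x. \<psi> x \<bullet> G x \<partial>lebesgue)\<bar> \<le> \<eta> / 3"
    proof -
      have "(\<integral>x. \<phi> x \<bullet> G x \<partial>lebesgue) - (\<integral>x. \<psi> x \<bullet> G x \<partial>lebesgue) = (\<integral>x. (\<phi> x - \<psi> x) \<bullet> G x \<partial>lebesgue)"
        unfolding inner_diff_left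
        by (rule Bochner_Integration.integral_diff[symmetric]) (rule integrable_inner_bounded, fact, fact G(1), rule G(2))+
      then show ?thesis using integral_inner_bounded_le[OF \<phi>\<psi> G(1) G(2)] \<psi>(3) by simp
    qed
    have F: "(\<lambda>x. \<psi> (- h + x) \<bullet> G x) \<in> borel_measurable lebesgue"
      using \<psi>h G(1) by (intro borel_measurable_inner)
    \<comment> \<open>Translation invariance moves the shift from the arbitrary field G to the fixed
      function \<psi>.\<close>
    have shift: "(\<integral>x. \<psi> x \<bullet> G (h + x) \<partial>lebesgue) = (\<integral>x. \<psi> (- h + x) \<bullet> G x \<partial>lebesgue)"
      using lebesgue_integral_translation(1)[OF F, of h] by (simp add: algebra_simps)
    let ?I = "\<lambda>x::'a. \<eta> / 3 / (m + 1) * indicator (cball 0 R) x :: real"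
    have "integrable lebesgue (indicator (cball (0::'a) R) :: 'a \<Rightarrow> real)"
      using lmeasurable_cball by (simp only: lmeasurable_iff_integrable)
    then have I: "integrable lebesgue ?I" by (intro integrable_mult_right) 
    have pt: "norm ((\<psi> (- h + x) - \<psi> x) \<bullet> G x) \<le> ?I x" for x
    proof (cases "x \<in> \<Omega>")
      case True
      then have x: "x \<in> cball 0 R" using R by blast
      have "norm (- h + x) \<le> R + 1" using norm_triangle_ineq[of "-h" x] x h by simp
      then have "dist (\<psi> (- h + x)) (\<psi> x) < \<eta> / 3 / (m + 1)" using x h by (intro d(2)) (auto simp: dist_norm norm_minus_commute)
      then have "norm (\<psi> (- h + x) - \<psi> x) \<le> \<eta> / 3 / (m + 1)" by (simp only: dist_norm)
      then have "norm (\<psi> (- h + x) - \<psi> x) * norm (G x) \<le> \<eta> / 3 / (m + 1) * 1"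
        using G(2)[of x] \<open>0 < \<eta>\<close> \<open>m \<ge> 0\<close> by (intro mult_mono) auto
      then show ?thesis using x Cauchy_Schwarz_ineq2[of "\<psi> (- h + x) - \<psi> x" "G x"] by simp
    next
      case False
      then show ?thesis using G(3) \<open>0 < \<eta>\<close> \<open>m \<ge> 0\<close> by simp
    qed
    have \<psi>i: "integrable lebesgue (\<lambda>x. \<psi> x \<bullet> G x)" by (rule integrable_inner_bounded) fact+
    have Dm: "(\<lambda>x. (\<psi> (- h + x) - \<psi> x) \<bullet> G x) \<in> borel_measurable lebesgue"
      using \<psi>h \<psi>m G(1) by (intro borel_measurable_inner borel_measurable_diff)
    have Di: "integrable lebesgue (\<lambda>x. (\<psi> (- h + x) - \<psi> x) \<bullet> G x)"
      by (rule Bochner_Integration.integrable_bound[OF I Dm]) (intro AE_I2 order_trans[OF pt], simp only: real_norm_def abs_ge_self)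
    have "(\<integral>x. \<psi> (- h + x) \<bullet> G x \<partial>lebesgue) - (\<integral>x. \<psi> x \<bullet> G x \<partial>lebesgue)
        = (\<integral>x. (\<psi> (- h + x) - \<psi> x) \<bullet> G x \<partial>lebesgue)"
    proof -
      have "(\<integral>x. (\<psi> (- h + x) - \<psi> x) \<bullet> G x + \<psi> x \<bullet> G x \<partial>lebesgue)
          = (\<integral>x. (\<psi> (- h + x) - \<psi> x) \<bullet> G x \<partial>lebesgue) + (\<integral>x. \<psi> x \<bullet> G x \<partial>lebesgue)"
        by (rule Bochner_Integration.integral_add[OF Di \<psi>i])
      then show ?thesis by (simp add: inner_diff_left)
    qed
    moreover have "\<bar>\<integral>x. (\<psi> (- h + x) - \<psi> x) \<bullet> G x \<partial>lebesgue\<bar> \<le> (\<integral>x. ?I x \<partial>lebesgue)"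
      using order_trans[OF integral_norm_bound integral_mono[OF integrable_norm[OF Di] I pt]] by simp
    moreover have "(\<integral>x. ?I x \<partial>lebesgue) = \<eta> / 3 / (m + 1) * m" by (simp add: m_def)
    moreover have "\<eta> / 3 / (m + 1) * m \<le> \<eta> / 3" using \<open>0 < \<eta>\<close> \<open>m \<ge> 0\<close> by (simp add: field_simps)
    ultimately show "\<bar>(\<integral>x. \<phi> x \<bullet> G (h + x) \<partial>lebesgue) - (\<integral>x. \<phi> x \<bullet> G x \<partial>lebesgue)\<bar> \<le> \<eta>"
      using 1 2 unfolding shift by linarith
  qed (use d in auto)
qed

section \<open>The weak* topology\<close>

lemma set_integral_bounded:
  fixes k :: "'a::euclidean_space \<Rightarrow> 'b::euclidean_space"
  assumes A: "A \<in> lmeasurable" and k: "k \<in> borel_measurable lebesgue"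
    and C: "\<And>x. x \<in> A \<Longrightarrow> norm (k x) \<le> C"
  shows "set_integrable lebesgue A k"
    and "norm (LINT x:A|lebesgue. k x) \<le> C * measure lebesgue A"
proof -
  have iA: "integrable lebesgue (indicator A :: 'a \<Rightarrow> real)" using A by (simp only: lmeasurable_iff_integrable)
  have [measurable]: "A \<in> sets lebesgue" using A by (rule fmeasurableD)
  note k[measurable]
  have bd: "norm (indicator A x *\<^sub>R k x) \<le> C * indicator A x" for x
    using C[of x] by (simp add: indicator_def)
  show *: "set_integrable lebesgue A k" unfolding set_integrable_def
  proof (rule Bochner_Integration.integrable_bound)
    show "integrable lebesgue (\<lambda>x. C * indicator A x)" using iA by (intro integrable_mult_right)
    show "AE x in lebesgue. norm (indicator A x *\<^sub>R k x) \<le> norm (C * indicator A x)"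
      by (intro AE_I2) (simp only: real_norm_def, rule order_trans[OF bd abs_ge_self])
  qed measurable
  have "norm (LINT x:A|lebesgue. k x) \<le> (\<integral>x. C * indicator A x \<partial>lebesgue)"
    unfolding set_lebesgue_integral_def
    by (rule order_trans[OF integral_norm_bound integral_mono[OF integrable_norm]])
       (use * iA bd in \<open>auto simp only: set_integrable_def intro!: integrable_mult_right\<close>)
  then show "norm (LINT x:A|lebesgue. k x) \<le> C * measure lebesgue A" by simp
qed

lemma integral_lebesgue_on_eq:
  fixes f :: "'a::euclidean_space \<Rightarrow> 'b::{banach, second_countable_topology}"
  assumes "A \<in> sets lebesgue"
  shows "integral\<^sup>L (lebesgue_on A) f = (LINT x:A|lebesgue. f x)"
  unfolding set_lebesgue_integral_def using assms by (intro integral_restrict_space) simp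

lemma set_integral_cells:
  fixes F :: "real^2 \<Rightarrow> 'b::euclidean_space"
  assumes J: "finite J" "J \<subseteq> int_lattice" "\<epsilon> > 0"
  shows "set_integrable lebesgue (cells \<epsilon> J) (\<lambda>x. F (idx \<epsilon> x))"
    and "(LINT x:cells \<epsilon> J|lebesgue. F (idx \<epsilon> x)) = (\<Sum>i\<in>J. \<epsilon>\<^sup>2 *\<^sub>R F i)"
proof -
  have c: "cells \<epsilon> {i} \<in> lmeasurable" if "i \<in> J" for i
    by (rule lmeasurable_cells) (use that J in auto)
  have eq: "indicator (cells \<epsilon> {i}) x *\<^sub>R F (idx \<epsilon> x) = indicator (cells \<epsilon> {i}) x *\<^sub>R F i" for i x
    by (auto simp: cells_def indicator_def)
  have int: "set_integrable lebesgue (cells \<epsilon> {i}) (\<lambda>x. F (idx \<epsilon> x))" if "i \<in> J" for i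
    unfolding set_integrable_def eq
    using c[OF that] by (intro integrable_scaleR_left) (simp only: lmeasurable_iff_integrable)
  then show "set_integrable lebesgue (cells \<epsilon> J) (\<lambda>x. F (idx \<epsilon> x))"
    unfolding cells_UN[of \<epsilon> J] using J(1) c by (intro set_integrable_UN) (auto intro: fmeasurableD)
  have "(LINT x:(\<Union>i\<in>J. cells \<epsilon> {i})|lebesgue. F (idx \<epsilon> x)) = (\<Sum>i\<in>J. LINT x:cells \<epsilon> {i}|lebesgue. F (idx \<epsilon> x))"
    by (rule set_integral_finite_Union[OF J(1) disjoint_cells int fmeasurableD[OF c]])
  also have "\<dots> = (\<Sum>i\<in>J. \<epsilon>\<^sup>2 *\<^sub>R F i)"
  proof (rule sum.cong[OF refl])
    fix i assume i: "i \<in> J"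
    have "(LINT x:cells \<epsilon> {i}|lebesgue. F (idx \<epsilon> x)) = (LINT x:cells \<epsilon> {i}|lebesgue. F i)"
      unfolding set_lebesgue_integral_def eq ..
    also have "\<dots> = measure lebesgue (cells \<epsilon> {i}) *\<^sub>R F i"
      using c[OF i] fmeasurableD2[OF c[OF i]] by (intro set_integral_const) (auto intro: fmeasurableD)
    also have "measure lebesgue (cells \<epsilon> {i}) = \<epsilon>\<^sup>2" using i J by (intro measure_cell) auto
    finally show "(LINT x:cells \<epsilon> {i}|lebesgue. F (idx \<epsilon> x)) = \<epsilon>\<^sup>2 *\<^sub>R F i" .
  qed
  finally show "(LINT x:cells \<epsilon> J|lebesgue. F (idx \<epsilon> x)) = (\<Sum>i\<in>J. \<epsilon>\<^sup>2 *\<^sub>R F i)"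
    unfolding cells_UN[of \<epsilon> J, symmetric] .
qed

lemma sum_neighbours:
  assumes "finite (lattice_pts \<epsilon> \<Omega>)"
  shows "(\<Sum>(i, j)\<in>neighbours \<epsilon> \<Omega>. F i j) =
    (\<Sum>i\<in>lattice_pts \<epsilon> \<Omega>. \<Sum>e\<in>unit_steps. if i + e \<in> lattice_pts \<epsilon> \<Omega> then F i (i + e) else (0::real))"
proof -
  let ?L = "lattice_pts \<epsilon> \<Omega>"
  let ?S = "{p \<in> ?L \<times> unit_steps. fst p + snd p \<in> ?L}"
  have "neighbours \<epsilon> \<Omega> = (\<lambda>p. (fst p, fst p + snd p)) ` ?S"
  proof (intro equalityI subsetI)
    fix p assume "p \<in> neighbours \<epsilon> \<Omega>"
    then obtain i e where "p = (i, i + e)" "i \<in> ?L" "e \<in> unit_steps" "i + e \<in> ?L"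
      unfolding neighbours_eq by blast
    then show "p \<in> (\<lambda>p. (fst p, fst p + snd p)) ` ?S" by (intro image_eqI[of _ _ "(i, e)"]) auto
  qed (auto simp: neighbours_eq)
  moreover have "inj_on (\<lambda>p. (fst p, fst p + snd p)) ?S" by (auto simp: inj_on_def prod_eq_iff)
  ultimately have "(\<Sum>(i, j)\<in>neighbours \<epsilon> \<Omega>. F i j) = (\<Sum>p\<in>?S. F (fst p) (fst p + snd p))"
    by (simp add: sum.reindex case_prod_unfold o_def)
  also have "\<dots> = (\<Sum>p\<in>?L \<times> unit_steps. if fst p + snd p \<in> ?L then F (fst p) (fst p + snd p) else 0)"
    using assms by (intro sum.inter_filter finite_cartesian_product finite_unit_steps)
  also have "\<dots> = (\<Sum>i\<in>?L. \<Sum>e\<in>unit_steps. if i + e \<in> ?L then F i (i + e) else 0)"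
    by (simp add: sum.cartesian_product case_prod_unfold)
  finally show ?thesis .
qed

text \<open>Clamping the argument to [a, b] extends g to a globally monotone, hence Borel, function.
  For an empty interval no such q exists.\<close>

lemma borel_measurable_mono_on_compose:
  fixes g :: "real \<Rightarrow> real"
  assumes g: "mono_on {a..b} g" and q: "q \<in> borel_measurable M" "\<And>x. q x \<in> {a..b}"
  shows "(\<lambda>x. g (q x)) \<in> borel_measurable M"
proof (cases "a \<le> b")
  case True
  define gc where "gc t = g (max a (min b t))" for t
  have "mono gc" unfolding gc_def using True by (intro monoI mono_onD[OF g]) auto
  then have "(\<lambda>x. gc (q x)) \<in> borel_measurable M"
    using measurable_compose[OF q(1)] borel_measurable_mono by blast
  moreover have "gc (q x) = g (q x)" for x using q(2)[of x] by (simp add: gc_def)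
  ultimately show ?thesis by simp
next
  case False
  with q(2) show ?thesis by auto
qed

lemma borel_measurable_rad [measurable]: "rad \<in> borel_measurable borel"
  unfolding rad_def by (intro borel_measurable_continuous_onI continuous_intros)

section \<open>Neighbourhoods in the weak-star topology and fields with values in K\<close>

lemma openin_weak_star_pairing:
  assumes "\<phi> \<in> L1_sym \<Omega>" "open V"
  shows "openin (weak_star \<Omega>) {Q \<in> Linf \<Omega> sym_matrices. (\<integral>x. Q x \<bullet> \<phi> x \<partial>lebesgue_on \<Omega>) \<in> V}"
  unfolding weak_star_def by (rule topology_generated_by_Basis) (use assms in blast)

text \<open>Induction on the generation of the topology: an intersection merges the two finite
  families and takes the smaller tolerance, a union inherits from the member that contains Q, and a
  subbasic set leaves an interval around the pairing of Q.\<close>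

lemma weak_star_nbhd:
  assumes "openin (weak_star \<Omega>) U" "Q \<in> U"
  obtains \<Phi> \<eta> where "finite \<Phi>" "\<Phi> \<subseteq> L1_sym \<Omega>" "\<eta> > 0"
    "\<And>Q'. Q' \<in> Linf \<Omega> sym_matrices \<Longrightarrow>
      (\<And>\<phi>. \<phi> \<in> \<Phi> \<Longrightarrow> \<bar>(\<integral>x. Q' x \<bullet> \<phi> x \<partial>lebesgue_on \<Omega>) - (\<integral>x. Q x \<bullet> \<phi> x \<partial>lebesgue_on \<Omega>)\<bar> < \<eta>) \<Longrightarrow> Q' \<in> U"
proof -
  define I where "I Q \<phi> = (\<integral>x. Q x \<bullet> \<phi> x \<partial>lebesgue_on \<Omega>)" for Q \<phi> :: "real^2 \<Rightarrow> real^2^2"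
  have "\<exists>\<Phi> \<eta>. finite \<Phi> \<and> \<Phi> \<subseteq> L1_sym \<Omega> \<and> \<eta> > 0 \<and>
      (\<forall>Q'\<in>Linf \<Omega> sym_matrices. (\<forall>\<phi>\<in>\<Phi>. \<bar>I Q' \<phi> - I Q \<phi>\<bar> < \<eta>) \<longrightarrow> Q' \<in> U)"
    if "generate_topology_on {{Q \<in> Linf \<Omega> sym_matrices. (\<integral>x. Q x \<bullet> \<phi> x \<partial>lebesgue_on \<Omega>) \<in> V} | \<phi> V.
        \<phi> \<in> L1_sym \<Omega> \<and> open V} U" "Q \<in> U" for U
    using that
  proof (induction rule: generate_topology_on.induct)
    case Empty
    then show ?case by simp
  next
    case (Int a b)
    then have "Q \<in> a" "Q \<in> b" by auto
    from Int.IH(1)[OF this(1)] obtain \<Phi>1 \<eta>1 where "finite \<Phi>1" "\<Phi>1 \<subseteq> L1_sym \<Omega>" "\<eta>1 > 0"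
      "\<forall>Q'\<in>Linf \<Omega> sym_matrices. (\<forall>\<phi>\<in>\<Phi>1. \<bar>I Q' \<phi> - I Q \<phi>\<bar> < \<eta>1) \<longrightarrow> Q' \<in> a" by blast
    moreover from Int.IH(2)[OF \<open>Q \<in> b\<close>] obtain \<Phi>2 \<eta>2 where "finite \<Phi>2" "\<Phi>2 \<subseteq> L1_sym \<Omega>" "\<eta>2 > 0"
      "\<forall>Q'\<in>Linf \<Omega> sym_matrices. (\<forall>\<phi>\<in>\<Phi>2. \<bar>I Q' \<phi> - I Q \<phi>\<bar> < \<eta>2) \<longrightarrow> Q' \<in> b" by blast
    ultimately show ?case by (intro exI[of _ "\<Phi>1 \<union> \<Phi>2"] exI[of _ "min \<eta>1 \<eta>2"]) auto
  next
    case (UN K)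
    then obtain k where k: "k \<in> K" "Q \<in> k" by blast
    from UN.IH[OF k] k(1) show ?case by blast
  next
    case (Basis s)
    then obtain \<phi> V where s: "s = {Q \<in> Linf \<Omega> sym_matrices. (\<integral>x. Q x \<bullet> \<phi> x \<partial>lebesgue_on \<Omega>) \<in> V}"
      "\<phi> \<in> L1_sym \<Omega>" "open V" by blast
    have "I Q \<phi> \<in> V" using Basis s(1) by (simp add: I_def)
    then obtain d where d: "d > 0" "ball (I Q \<phi>) d \<subseteq> V" using \<open>open V\<close> by (auto simp: open_contains_ball)
    have "Q' \<in> s" if "Q' \<in> Linf \<Omega> sym_matrices" "\<bar>I Q' \<phi> - I Q \<phi>\<bar> < d" for Q'
    proof -
      have "I Q' \<phi> \<in> ball (I Q \<phi>) d" using that(2) by (simp add: dist_real_def abs_minus_commute)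
      then show ?thesis using d that(1) by (auto simp: s(1) I_def)
    qed
    then show ?case using s(2) d(1) by (intro exI[of _ "{\<phi>}"] exI[of _ d]) auto
  qed
  moreover have "generate_topology_on {{Q \<in> Linf \<Omega> sym_matrices. (\<integral>x. Q x \<bullet> \<phi> x \<partial>lebesgue_on \<Omega>) \<in> V} | \<phi> V.
        \<phi> \<in> L1_sym \<Omega> \<and> open V} U"
    using assms(1) unfolding weak_star_def openin_topology_generated_by_iff .
  ultimately have "\<exists>\<Phi> \<eta>. finite \<Phi> \<and> \<Phi> \<subseteq> L1_sym \<Omega> \<and> \<eta> > 0 \<and>
      (\<forall>Q'\<in>Linf \<Omega> sym_matrices. (\<forall>\<phi>\<in>\<Phi>. \<bar>I Q' \<phi> - I Q \<phi>\<bar> < \<eta>) \<longrightarrow> Q' \<in> U)"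
    using assms(2) by blast
  then obtain \<Phi> \<eta> where "finite \<Phi>" "\<Phi> \<subseteq> L1_sym \<Omega>" "\<eta> > 0"
    "\<forall>Q'\<in>Linf \<Omega> sym_matrices. (\<forall>\<phi>\<in>\<Phi>. \<bar>I Q' \<phi> - I Q \<phi>\<bar> < \<eta>) \<longrightarrow> Q' \<in> U" by blast
  then show thesis by (intro that[of \<Phi> \<eta>]) (auto simp: I_def)
qed

lemma measurable_closest_point_K_set:
  assumes "Q \<in> borel_measurable M"
  shows "(\<lambda>x. closest_point K_set (Q x)) \<in> borel_measurable M"
proof -
  have "closest_point K_set \<in> borel_measurable borel"
    using convex_K_set closed_K_set half_id_in_K_set
    by (intro borel_measurable_continuous_onI continuous_on_closest_point) auto
  then show ?thesis using measurable_compose[OF assms] by blast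
qed

lemma closest_point_K_set: "closest_point K_set Q \<in> K_set"
  using closed_K_set half_id_in_K_set by (intro closest_point_in_set) auto

text \<open>The projection onto K changes nothing where Q already lies in K, and membership then
  holds at every point of the plane. Later estimates are pointwise and make sense outside \<Omega>
  as well; the default value 0 is itself moved into K by the projection.\<close>

lemma K_set_representative:
  assumes "\<Omega> \<in> sets lebesgue" "Q \<in> Linf \<Omega> K_set"
  obtains Q' where "Q' \<in> borel_measurable lebesgue" "\<And>x. Q' x \<in> K_set" "AE x in lebesgue_on \<Omega>. Q' x = Q x"
proof (rule that[of "\<lambda>x. closest_point K_set (if x \<in> \<Omega> then Q x else 0)"])
  have "(\<lambda>x. if x \<in> \<Omega> then Q x else 0) \<in> borel_measurable lebesgue"
    using assms by (simp add: borel_measurable_if Linf_def)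
  then show "(\<lambda>x. closest_point K_set (if x \<in> \<Omega> then Q x else 0)) \<in> borel_measurable lebesgue"
    by (rule measurable_closest_point_K_set)
  have "AE x in lebesgue_on \<Omega>. Q x \<in> K_set" using assms(2) by (simp add: Linf_def)
  moreover have "AE x in lebesgue_on \<Omega>. x \<in> \<Omega>" by (rule AE_I2) (simp add: space_restrict_space)
  ultimately show "AE x in lebesgue_on \<Omega>. closest_point K_set (if x \<in> \<Omega> then Q x else 0) = Q x"
    by eventually_elim (simp add: closest_point_self)
qed (rule closest_point_K_set)

text \<open>\<open>L\<^sup>\<infinity>(\<Omega>; K)\<close> is weakly* closed: the field of normal vectors \<open>Q - closest_point K Q\<close> separates.\<close>

lemma Linf_K_set_separation:
  assumes \<Omega>: "\<Omega> \<in> lmeasurable" and Q: "Q \<in> Linf \<Omega> sym_matrices" "Q \<notin> Linf \<Omega> K_set"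
  obtains \<phi> c where "\<phi> \<in> L1_sym \<Omega>" "c < (\<integral>x. Q x \<bullet> \<phi> x \<partial>lebesgue_on \<Omega>)"
    "\<And>P. P \<in> Linf \<Omega> K_set \<Longrightarrow> (\<integral>x. P x \<bullet> \<phi> x \<partial>lebesgue_on \<Omega>) \<le> c"
proof -
  define M where "M = lebesgue_on \<Omega>"
  interpret finite_measure M unfolding M_def using \<Omega> by (rule finite_measure_lebesgue_on)
  define R where "R x = closest_point K_set (Q x)" for x
  have Qm[measurable]: "Q \<in> borel_measurable M" using Q(1) by (simp add: Linf_def M_def)
  have Rm[measurable]: "R \<in> borel_measurable M" unfolding R_def by (rule measurable_closest_point_K_set[OF Qm])
  have R: "R x \<in> K_set" for x unfolding R_def by (rule closest_point_K_set)
  obtain C where C: "AE x in M. norm (Q x) \<le> C" using Q(1) unfolding Linf_def M_def by blast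
  define \<phi> where "\<phi> x = Q x - R x" for x
  have \<phi>m[measurable]: "\<phi> \<in> borel_measurable M" unfolding \<phi>_def by measurable
  have \<phi>b: "AE x in M. norm (\<phi> x) \<le> C + 1"
    using C
  proof eventually_elim
    case (elim x)
    show ?case unfolding \<phi>_def using elim norm_triangle_ineq4[of "Q x" "R x"] norm_K_set_le[OF R[of x]] by linarith
  qed
  have int\<phi>: "integrable M \<phi>" by (rule integrable_const_bound[OF \<phi>b \<phi>m])
  have "AE x in M. \<phi> x \<in> sym_matrices"
  proof -
    have "AE x in M. Q x \<in> sym_matrices" using Q(1) unfolding Linf_def M_def by blast
    then show ?thesis
    proof eventually_elim
      case (elim x)
      then show ?case using subsetD[OF K_set_subset_sym R[of x]] by (simp add: \<phi>_def sym_matrices_iff)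
    qed
  qed
  then have L1: "\<phi> \<in> L1_sym \<Omega>" using int\<phi> unfolding L1_sym_def M_def by blast
  have intP: "integrable M (\<lambda>x. P x \<bullet> \<phi> x)" if [measurable]: "P \<in> borel_measurable M" and "AE x in M. norm (P x) \<le> D" for P D
  proof (rule integrable_const_bound)
    show "AE x in M. norm (P x \<bullet> \<phi> x) \<le> D * (C + 1)"
      using that(2) \<phi>b
    proof eventually_elim
      case (elim x)
      have "norm (P x \<bullet> \<phi> x) \<le> norm (P x) * norm (\<phi> x)" by (simp add: Cauchy_Schwarz_ineq2)
      also have "\<dots> \<le> D * (C + 1)" using elim norm_ge_zero order_trans by (intro mult_mono) blast+
      finally show ?case .
    qed
  qed measurable
  have iQ: "integrable M (\<lambda>x. Q x \<bullet> \<phi> x)" by (rule intP[OF Qm C])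
  have iR: "integrable M (\<lambda>x. R x \<bullet> \<phi> x)" by (rule intP[OF Rm, of 1]) (simp add: norm_K_set_le[OF R])
  have diff: "(\<integral>x. Q x \<bullet> \<phi> x \<partial>M) - (\<integral>x. R x \<bullet> \<phi> x \<partial>M) = (\<integral>x. \<phi> x \<bullet> \<phi> x \<partial>M)"
    using Bochner_Integration.integral_diff[OF iQ iR] by (simp add: \<phi>_def inner_diff_left)
  have "(\<integral>x. \<phi> x \<bullet> \<phi> x \<partial>M) \<noteq> 0"
  proof
    assume "(\<integral>x. \<phi> x \<bullet> \<phi> x \<partial>M) = 0"
    moreover have "integrable M (\<lambda>x. \<phi> x \<bullet> \<phi> x)" by (rule intP[OF \<phi>m \<phi>b])
    ultimately have "AE x in M. \<phi> x \<bullet> \<phi> x = 0" by (subst (asm) integral_nonneg_eq_0_iff_AE) auto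
    then have "AE x in M. Q x \<in> K_set"
    proof eventually_elim
      case (elim x)
      then have "Q x = R x" by (simp add: \<phi>_def)
      then show ?case using R[of x] by simp
    qed
    then have "Q \<in> Linf \<Omega> K_set" using Q(1) unfolding Linf_def M_def by blast
    with Q(2) show False by contradiction
  qed
  then have pos: "(\<integral>x. \<phi> x \<bullet> \<phi> x \<partial>M) > 0" by (simp add: less_le integral_nonneg_AE)
  show thesis
  proof (rule that[OF L1, of "\<integral>x. R x \<bullet> \<phi> x \<partial>M"])
    show "(\<integral>x. R x \<bullet> \<phi> x \<partial>M) < (\<integral>x. Q x \<bullet> \<phi> x \<partial>lebesgue_on \<Omega>)"
      using diff pos unfolding M_def[symmetric] by linarith
    fix P assume P: "P \<in> Linf \<Omega> K_set"
    then have Pm: "P \<in> borel_measurable M" and PK: "AE x in M. P x \<in> K_set" unfolding Linf_def M_def by blast+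
    have "AE x in M. norm (P x) \<le> 1" using PK by eventually_elim (rule norm_K_set_le)
    then have iP: "integrable M (\<lambda>x. P x \<bullet> \<phi> x)" by (rule intP[OF Pm])
    have "(\<integral>x. P x \<bullet> \<phi> x \<partial>M) \<le> (\<integral>x. R x \<bullet> \<phi> x \<partial>M)"
    proof (rule integral_mono_AE[OF iP iR])
      show "AE x in M. P x \<bullet> \<phi> x \<le> R x \<bullet> \<phi> x" using PK
      proof eventually_elim
        case (elim x)
        have "(Q x - R x) \<bullet> (P x - R x) \<le> 0"
          unfolding R_def using closest_point_dot[OF convex_K_set closed_K_set elim] .
        then show ?case by (simp add: \<phi>_def inner_diff_left inner_diff_right inner_commute)
      qed
    qed
    then show "(\<integral>x. P x \<bullet> \<phi> x \<partial>lebesgue_on \<Omega>) \<le> (\<integral>x. R x \<bullet> \<phi> x \<partial>M)" by (simp add: M_def)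
  qed
qed

section \<open>The lower bound\<close>

text \<open>The common setting of both inequalities. Q is a representative of the limit field with
  values in K everywhere, and the regularity of the boundary is carried by the negligibility of the
  frontier.\<close>

locale spin_system =
  fixes \<Omega> :: "(real^2) set" and h :: "real \<Rightarrow> real" and B :: real and Q :: "real^2 \<Rightarrow> real^2^2"
  assumes open_\<Omega>: "open \<Omega>" and bounded_\<Omega>: "bounded \<Omega>" and frontier_\<Omega>: "negligible (frontier \<Omega>)"
    and h_bound: "\<And>t. t \<in> {0..1} \<Longrightarrow> \<bar>h t\<bar> \<le> B"
    and Q_measurable: "Q \<in> borel_measurable lebesgue" and Q_K: "\<And>x. Q x \<in> K_set"
begin

abbreviation "g \<equiv> ndcx_lsc_envelope h"
abbreviation "bdry r \<equiv> measure lebesgue (bdry_nbhd \<Omega> r)"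

definition "limit_density = (LINT x:\<Omega>|lebesgue. g (rad (Q x)))"

lemma \<Omega>_lmeasurable: "\<Omega> \<in> lmeasurable"
  using bounded_\<Omega> open_\<Omega> by (rule lmeasurable_open)

lemma \<Omega>_sets: "\<Omega> \<in> sets lebesgue"
  using \<Omega>_lmeasurable by (rule fmeasurableD)

lemma B_nonneg: "0 \<le> B"
  using h_bound[of 0] by simp

lemma g_props:
  shows g_mono: "mono_on {0..1} g" and g_convex: "convex_on {0..1} g" and g_lsc: "lsc_on {0..1} g"
    and g_le_h: "\<And>t. t \<in> {0..1} \<Longrightarrow> g t \<le> h t"
proof -
  have "bounded (h ` {0..1})" using h_bound by (auto simp: bounded_iff intro!: exI[of _ B])
  from ndcx_lsc_envelope_greatest(1)[OF this]
  show "mono_on {0..1} g" "convex_on {0..1} g" "lsc_on {0..1} g" "\<And>t. t \<in> {0..1} \<Longrightarrow> g t \<le> h t"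
    unfolding ndcx_lsc_minorants_def by blast+
qed

lemma g_bound: "t \<in> {0..1} \<Longrightarrow> \<bar>g t\<bar> \<le> B"
  using envelope_bounds[where h = h and B = B] h_bound by blast

lemma rad_01: "M \<in> K_set \<Longrightarrow> rad M \<in> {0..1}"
  using rad_nonneg rad_le_1 by simp

lemma scaled_01: "0 \<le> c \<Longrightarrow> c \<le> 1 \<Longrightarrow> t \<in> {0..1} \<Longrightarrow> c * t \<in> {0..1::real}"
  by (simp add: mult_le_one)

lemma rad_Q_measurable: "(\<lambda>x. c * rad (Q x)) \<in> borel_measurable lebesgue"
proof -
  have "(\<lambda>x. rad (Q x)) \<in> borel_measurable lebesgue"
    using measurable_compose[OF Q_measurable borel_measurable_rad] .
  then show ?thesis by (intro borel_measurable_times borel_measurable_const)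
qed

lemma g_rad_measurable:
  assumes "0 \<le> c" "c \<le> 1"
  shows "(\<lambda>x. g (c * rad (Q x))) \<in> borel_measurable lebesgue"
  using g_mono rad_Q_measurable scaled_01[OF assms rad_01[OF Q_K]]
  by (rule borel_measurable_mono_on_compose)

lemma g_rad_bound: "0 \<le> c \<Longrightarrow> c \<le> 1 \<Longrightarrow> \<bar>g (c * rad (Q x))\<bar> \<le> B"
  by (intro g_bound scaled_01 rad_01 Q_K)

text \<open>Left continuity of g gives convergence at every radius, including 1, and the constant B
  on \<Omega> dominates. The double successor keeps the subtracted number strictly between 0 and 1,
  so that it can serve as \<tau>.\<close>

lemma scaled_density_tendsto:
  "(\<lambda>n. LINT x:\<Omega>|lebesgue. g ((1 - inverse (real (Suc (Suc n)))) * rad (Q x))) \<longlonglongrightarrow> limit_density"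
  unfolding set_lebesgue_integral_def limit_density_def
proof (rule integral_dominated_convergence[where w = "\<lambda>x. B * indicator \<Omega> x"])
  define c where "c n = 1 - inverse (real (Suc (Suc n)))" for n
  have c: "0 \<le> c n" "c n \<le> 1" for n by (simp_all add: c_def inverse_le_1_iff)
  show "integrable lebesgue (\<lambda>x. B * indicator \<Omega> x)"
    using \<Omega>_lmeasurable by (intro integrable_mult_right) (simp only: lmeasurable_iff_integrable)
  have [measurable]: "\<Omega> \<in> sets lebesgue" by (rule \<Omega>_sets)
  have [measurable]: "(\<lambda>x. g (c n * rad (Q x))) \<in> borel_measurable lebesgue" "(\<lambda>x. g (rad (Q x))) \<in> borel_measurable lebesgue" for n
    using g_rad_measurable[OF c] g_rad_measurable[of 1] by simp_all
  show "(\<lambda>x. indicator \<Omega> x *\<^sub>R g (rad (Q x))) \<in> borel_measurable lebesgue" by measurable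
  fix n
  have "(\<lambda>x. indicator \<Omega> x *\<^sub>R g (c n * rad (Q x))) \<in> borel_measurable lebesgue" by measurable
  then show "(\<lambda>x. indicator \<Omega> x *\<^sub>R g ((1 - inverse (real (Suc (Suc n)))) * rad (Q x))) \<in> borel_measurable lebesgue"
    by (simp only: c_def)
  show "AE x in lebesgue. norm (indicator \<Omega> x *\<^sub>R g ((1 - inverse (real (Suc (Suc n)))) * rad (Q x))) \<le> B * indicator \<Omega> x"
    using g_rad_bound[OF c] unfolding c_def by (intro AE_I2) (simp add: indicator_def)
next
  define c where "c n = 1 - inverse (real (Suc (Suc n)))" for n
  have c: "0 \<le> c n" "c n \<le> 1" for n by (simp_all add: c_def inverse_le_1_iff)
  have "(\<lambda>n. 1 - inverse (real (Suc n))) \<longlonglongrightarrow> 1 - 0"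
    by (intro tendsto_diff tendsto_const LIMSEQ_inverse_real_of_nat)
  then have c1: "c \<longlonglongrightarrow> 1" unfolding c_def using LIMSEQ_Suc by force
  have "(\<lambda>n. g (c n * rad (Q x))) \<longlonglongrightarrow> g (rad (Q x))" for x
  proof (rule lsc_mono_tendsto[OF g_mono g_convex g_lsc rad_01[OF Q_K]])
    show "(\<lambda>n. c n * rad (Q x)) \<longlonglongrightarrow> rad (Q x)" using tendsto_mult[OF c1 tendsto_const[of "rad (Q x)"]] by simp
    show "0 \<le> c n * rad (Q x)" "c n * rad (Q x) \<le> rad (Q x)" for n
      using c[of n] rad_nonneg[of "Q x"] by (simp_all add: mult_left_le_one_le)
  qed
  then show "AE x in lebesgue. (\<lambda>n. indicator \<Omega> x *\<^sub>R g ((1 - inverse (real (Suc (Suc n)))) * rad (Q x)))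
      \<longlonglongrightarrow> indicator \<Omega> x *\<^sub>R g (rad (Q x))"
    unfolding c_def by (intro AE_I2 tendsto_scaleR tendsto_const)
qed

text \<open>The tangent plane of the convex function \<open>M \<mapsto> g (rad M)\<close> at a point slightly inside \<open>Q x\<close>, where
  the slope stays bounded; pairing with its direction is the linear functional used for the lower bound.\<close>

definition tangent :: "real \<Rightarrow> real^2 \<Rightarrow> real^2^2" where
  "tangent \<tau> x = (if x \<in> \<Omega> then (right_slope g ((1 - \<tau>) * rad (Q x)) * sqrt 2) *\<^sub>R sgn (Q x - half_id) else 0)"

context
  fixes \<tau> :: real
  assumes \<tau>: "0 < \<tau>" "\<tau> < 1"
begin

lemma scaled_rad: "(1 - \<tau>) * rad (Q x) \<in> {0..1-\<tau>}"
  using \<tau> rad_nonneg[of "Q x"] mult_left_mono[OF rad_le_1[OF Q_K[of x]], of "1 - \<tau>"] by simp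

text \<open>The chord ending at 1 bounds the right slope: its length is at least \<tau>, and two
  values of g differ by at most \<open>2 * B\<close>.\<close>

lemma slope_bounds:
  "0 \<le> right_slope g ((1 - \<tau>) * rad (Q x))" "right_slope g ((1 - \<tau>) * rad (Q x)) \<le> 2 * B / \<tau>"
proof -
  define t where "t = (1 - \<tau>) * rad (Q x)"
  have t: "0 \<le> t" "t \<le> 1 - \<tau>" using scaled_rad[of x] by (simp_all add: t_def)
  then have t1: "t < 1" using \<tau> by simp
  show "0 \<le> right_slope g ((1 - \<tau>) * rad (Q x))"
    using right_slope_nonneg[OF g_mono g_convex t(1) t1] by (simp add: t_def)
  have "right_slope g t \<le> (g 1 - g t) / (1 - t)"
    by (rule right_slope_le_chord[OF g_mono g_convex t(1) t1]) simp
  also have "\<dots> \<le> 2 * B / \<tau>"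
    using g_bound[of 1] g_bound[of t] t t1 \<tau> B_nonneg by (intro frac_le) auto
  finally show "right_slope g ((1 - \<tau>) * rad (Q x)) \<le> 2 * B / \<tau>" by (simp add: t_def)
qed

lemma tangent_bound: "norm (tangent \<tau> x) \<le> 2 * B / \<tau> * sqrt 2"
proof -
  define s where "s = right_slope g ((1 - \<tau>) * rad (Q x))"
  have s: "0 \<le> s * sqrt 2" "s * sqrt 2 \<le> 2 * B / \<tau> * sqrt 2"
    unfolding s_def by (intro mult_nonneg_nonneg mult_right_mono slope_bounds real_sqrt_ge_zero; simp)+
  have "norm (tangent \<tau> x) \<le> \<bar>s * sqrt 2\<bar> * norm (sgn (Q x - half_id))"
    by (simp add: tangent_def s_def)
  also have "\<dots> \<le> \<bar>s * sqrt 2\<bar> * 1" by (intro mult_left_mono) (simp_all add: norm_sgn)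
  finally show ?thesis using s by linarith
qed

lemma tangent_measurable: "tangent \<tau> \<in> borel_measurable lebesgue"
proof -
  have [measurable]: "\<Omega> \<in> sets lebesgue" by (rule \<Omega>_sets)
  have "mono_on {0..1-\<tau>} (right_slope g)"
    using right_slope_mono[OF g_mono g_convex] \<tau> by (auto intro: mono_on_subset)
  then have [measurable]: "(\<lambda>x. right_slope g ((1 - \<tau>) * rad (Q x))) \<in> borel_measurable lebesgue"
    using rad_Q_measurable scaled_rad by (rule borel_measurable_mono_on_compose)
  note Q_measurable[measurable]
  have [measurable]: "(\<lambda>x. Q x - half_id) \<in> borel_measurable lebesgue" by measurable
  have "(\<lambda>x. sgn (Q x - half_id)) = (\<lambda>x. inverse (norm (Q x - half_id)) *\<^sub>R (Q x - half_id))"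
    by (simp add: sgn_div_norm)
  then have [measurable]: "(\<lambda>x. sgn (Q x - half_id)) \<in> borel_measurable lebesgue"
    by (simp only:) measurable
  have "(\<lambda>x. indicator \<Omega> x *\<^sub>R ((right_slope g ((1 - \<tau>) * rad (Q x)) * sqrt 2) *\<^sub>R sgn (Q x - half_id))) \<in> borel_measurable lebesgue"
    by measurable
  also have "(\<lambda>x. indicator \<Omega> x *\<^sub>R ((right_slope g ((1 - \<tau>) * rad (Q x)) * sqrt 2) *\<^sub>R sgn (Q x - half_id))) = tangent \<tau>"
    by (auto simp: tangent_def fun_eq_iff indicator_def)
  finally show ?thesis .
qed

lemma tangent_integrable: "integrable lebesgue (tangent \<tau>)"
proof -
  have "set_integrable lebesgue \<Omega> (tangent \<tau>)"
    by (rule set_integral_bounded(1)[OF \<Omega>_lmeasurable tangent_measurable tangent_bound])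
  moreover have "(\<lambda>x. indicator \<Omega> x *\<^sub>R tangent \<tau> x) = tangent \<tau>"
    by (auto simp: tangent_def indicator_def fun_eq_iff)
  ultimately show ?thesis by (simp add: set_integrable_def)
qed

lemma tangent_L1_sym: "tangent \<tau> \<in> L1_sym \<Omega>"
proof -
  interpret finite_measure "lebesgue_on \<Omega>" using \<Omega>_lmeasurable by (rule finite_measure_lebesgue_on)
  have "integrable (lebesgue_on \<Omega>) (tangent \<tau>)"
    by (rule integrable_const_bound[of _ "2 * B / \<tau> * sqrt 2"])
       (use tangent_bound tangent_measurable in \<open>auto intro: measurable_restrict_space1\<close>)
  moreover have "tangent \<tau> x \<in> sym_matrices" for x
    using subsetD[OF K_set_subset_sym Q_K[of x]]
    by (simp add: tangent_def sym_matrices_iff sgn_div_norm)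
  ultimately show ?thesis by (simp add: L1_sym_def)
qed

text \<open>By Cauchy-Schwarz, the inner product of the direction \<open>sgn (p - half_id)\<close>
  with \<open>M - half_id\<close> is at most the norm of the latter, with equality at M = p; at the
  centre of the disc the direction is 0. Since the slope is nonnegative, \<open>rad p\<close> may
  then be lowered to the shrunk radius, and the support line of g at that radius finishes. The plane
  is anchored at p itself although its slope is taken further inside.\<close>

lemma support_plane:
  assumes p: "p \<in> K_set" and M: "M \<in> K_set"
  shows "g ((1 - \<tau>) * rad p) + ((right_slope g ((1 - \<tau>) * rad p) * sqrt 2) *\<^sub>R sgn (p - half_id)) \<bullet> (M - p)
    \<le> g (rad M)"
proof -
  define t s D where "t = (1 - \<tau>) * rad p" and "s = right_slope g t" and "D = p - half_id"
  have "0 \<le> (1 - \<tau>) * rad p" "(1 - \<tau>) * rad p \<le> (1 - \<tau>) * 1"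
    using \<tau> rad_nonneg[of p] rad_le_1[OF p] by (intro mult_nonneg_nonneg mult_left_mono; simp)+
  then have t: "0 \<le> t" "t < 1" using \<tau>(1) unfolding t_def mult_1_right by linarith+
  have s: "0 \<le> s" unfolding s_def by (rule right_slope_nonneg[OF g_mono g_convex t])
  have 1: "sgn D \<bullet> D = norm D" by (cases "D = 0") (simp_all add: sgn_div_norm dot_square_norm power2_eq_square)
  have "sgn D \<bullet> (M - half_id) \<le> norm (sgn D) * norm (M - half_id)" by (rule norm_cauchy_schwarz)
  also have "\<dots> \<le> 1 * norm (M - half_id)" by (intro mult_right_mono) (simp_all add: norm_sgn)
  finally have 2: "sgn D \<bullet> (M - half_id) \<le> norm (M - half_id)" by simp
  have "((s * sqrt 2) *\<^sub>R sgn D) \<bullet> (M - p) = s * (sqrt 2 * (sgn D \<bullet> (M - half_id) - sgn D \<bullet> D))"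
    by (simp add: D_def inner_diff_right algebra_simps)
  also have "\<dots> \<le> s * (sqrt 2 * (norm (M - half_id) - norm D))"
    using s 1 2 by (intro mult_left_mono) auto
  also have "sqrt 2 * (norm (M - half_id) - norm D) = rad M - rad p"
    by (simp add: rad_def D_def right_diff_distrib)
  also have "s * (rad M - rad p) \<le> s * (rad M - t)"
    using s \<tau> rad_nonneg[of p] unfolding t_def by (intro mult_left_mono) (simp_all add: mult_left_le_one_le)
  finally have "g t + ((s * sqrt 2) *\<^sub>R sgn D) \<bullet> (M - p) \<le> g t + s * (rad M - t)" by simp
  also have "\<dots> \<le> g (rad M)"
    unfolding s_def using rad_01[OF M] by (intro right_slope_support[OF g_mono g_convex t]) auto
  finally show ?thesis by (simp only: t_def s_def D_def)
qed

lemma tangent_plane: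
  assumes "x \<in> \<Omega>" "M \<in> K_set"
  shows "g ((1 - \<tau>) * rad (Q x)) + tangent \<tau> x \<bullet> (M - Q x) \<le> g (rad M)"
  using support_plane[OF Q_K[of x] assms(2)] assms(1) by (simp only: tangent_def if_True)

end

lemma integral_pairing_eq:
  assumes \<phi>: "\<And>x. x \<notin> \<Omega> \<Longrightarrow> \<phi> x = 0"
  shows "(\<integral>x. P x \<bullet> \<phi> x \<partial>lebesgue_on \<Omega>) = (\<integral>x. \<phi> x \<bullet> P x \<partial>lebesgue)"
proof -
  have "indicator \<Omega> x *\<^sub>R (P x \<bullet> \<phi> x) = \<phi> x \<bullet> P x" for x
    using \<phi>[of x] by (cases "x \<in> \<Omega>") (simp_all add: inner_commute)
  then show ?thesis unfolding integral_lebesgue_on_eq[OF \<Omega>_sets] set_lebesgue_integral_def by simp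
qed

text \<open>For a fixed step e the bond midpoints are the mean of the field and its shift. On inner
  cells the tangent plane evaluated at this mean stays below the bond energy. Its linear part has a
  nearly nonnegative integral: weak-star closeness controls the pairing with the field, and the
  uniform shift estimate controls the pairing with the shifted field.\<close>

lemma bond_lower_bound:
  assumes \<epsilon>: "0 < \<epsilon>" and e: "e \<in> unit_steps" and \<tau>: "0 < \<tau>" "\<tau> < 1"
    and P: "P \<in> C_eps \<epsilon> \<Omega>" "\<And>i. i \<in> lattice_pts \<epsilon> \<Omega> \<Longrightarrow> norm (u i) = 1 \<and> P (\<epsilon> *\<^sub>R i) = tensor (u i) (u i)"
    and Pm: "G \<in> borel_measurable lebesgue" and G: "\<And>x. G x = (if x \<in> \<Omega> then P x else 0)"
    and shift: "\<bar>(\<integral>x. tangent \<tau> x \<bullet> G (\<epsilon> *\<^sub>R e + x) \<partial>lebesgue) - (\<integral>x. tangent \<tau> x \<bullet> G x \<partial>lebesgue)\<bar> \<le> \<eta>"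
    and near: "(\<integral>x. tangent \<tau> x \<bullet> Q x \<partial>lebesgue) - \<eta> < (\<integral>x. tangent \<tau> x \<bullet> G x \<partial>lebesgue)"
  shows "(LINT x:\<Omega>|lebesgue. g ((1 - \<tau>) * rad (Q x))) - 2 * \<eta> - (B + 2 * (2 * B / \<tau> * sqrt 2)) * bdry (3 * \<epsilon>)
    \<le> (\<Sum>i\<in>inner_pts \<epsilon> \<Omega>. \<epsilon>\<^sup>2 * h \<bar>u i \<bullet> u (i + e)\<bar>)"
proof -
  define \<phi> where "\<phi> = tangent \<tau>"
  define C where "C = 2 * B / \<tau> * sqrt 2"
  define J where "J = inner_pts \<epsilon> \<Omega>"
  define A where "A = cells \<epsilon> J"
  \<comment> \<open>The deviation of the bond midpoint from Q. As G extends the lattice field by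
    zero, the shifted term is defined everywhere; on inner cells both points lie in \<Omega> and the
    default is not met.\<close>
  define V where "V x = (1 / 2) *\<^sub>R (G x + G (\<epsilon> *\<^sub>R e + x)) - Q x" for x
  define k where "k x = g ((1 - \<tau>) * rad (Q x)) + \<phi> x \<bullet> V x" for x
  define H where "H i = h \<bar>u i \<bullet> u (i + e)\<bar>" for i
  note J = finite_inner_pts[OF bounded_\<Omega> \<epsilon>] inner_pts_lattice[OF bounded_\<Omega> \<epsilon>] \<epsilon>
  have C: "norm (\<phi> x) \<le> C" for x unfolding \<phi>_def C_def by (rule tangent_bound[OF \<tau>])
  have \<phi>0: "\<phi> x = 0" if "x \<notin> \<Omega>" for x using that by (simp add: \<phi>_def tangent_def)
  have \<phi>i: "integrable lebesgue \<phi>" unfolding \<phi>_def by (rule tangent_integrable[OF \<tau>])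
  have \<phi>m: "\<phi> \<in> borel_measurable lebesgue" using \<phi>i by simp
  have PK: "P x \<in> K_set" if "x \<in> \<Omega>" for x
    using that P(1) S1_tensor_subset_K_set by (auto simp: C_eps_def)
  have G1: "norm (G x) \<le> 1" for x unfolding G using PK norm_K_set_le by simp
  have Gem: "(\<lambda>x. G (\<epsilon> *\<^sub>R e + x)) \<in> borel_measurable lebesgue" by (rule lebesgue_integral_translation(2)[OF Pm])
  have Q1: "norm (Q x) \<le> 1" for x by (rule norm_K_set_le[OF Q_K])
  have Vm: "V \<in> borel_measurable lebesgue" unfolding V_def
    using Pm Gem Q_measurable by (intro borel_measurable_diff borel_measurable_scaleR borel_measurable_const borel_measurable_add)
  have V2: "norm (V x) \<le> 2" for x
  proof -
    have "norm (G x + G (\<epsilon> *\<^sub>R e + x)) \<le> 2" using norm_triangle_ineq[of "G x" "G (\<epsilon> *\<^sub>R e + x)"] G1[of x] G1[of "\<epsilon> *\<^sub>R e + x"] by linarith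
    then show ?thesis unfolding V_def
      using norm_triangle_ineq4[of "(1 / 2) *\<^sub>R (G x + G (\<epsilon> *\<^sub>R e + x))" "Q x"] Q1[of x] by simp
  qed
  have \<phi>V: "norm (\<phi> x \<bullet> V x) \<le> 2 * C" for x
  proof -
    have "norm (\<phi> x \<bullet> V x) \<le> norm (\<phi> x) * norm (V x)" by (simp add: Cauchy_Schwarz_ineq2)
    also have "\<dots> \<le> C * 2" using C[of x] V2[of x] norm_ge_zero order_trans by (intro mult_mono) blast+
    finally show ?thesis by simp
  qed
  have gm: "(\<lambda>x. g ((1 - \<tau>) * rad (Q x))) \<in> borel_measurable lebesgue"
    using \<tau> by (intro g_rad_measurable) auto
  have gb: "norm (g ((1 - \<tau>) * rad (Q x))) \<le> B" for x
    using g_rad_bound[of "1 - \<tau>" x] \<tau> by simp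
  have \<phi>Vm: "(\<lambda>x. \<phi> x \<bullet> V x) \<in> borel_measurable lebesgue" using \<phi>m Vm by (rule borel_measurable_inner)
  have km: "k \<in> borel_measurable lebesgue" unfolding k_def using gm \<phi>Vm by (rule borel_measurable_add)
  \<comment> \<open>Here B bounds g, C the tangent field and 2 the deviation V. The same constant
    prices the part of \<Omega> outside the inner cells.\<close>
  have kb: "norm (k x) \<le> B + 2 * C" for x
    unfolding k_def using norm_triangle_ineq[of "g ((1 - \<tau>) * rad (Q x))" "\<phi> x \<bullet> V x"] gb[of x] \<phi>V[of x] by linarith
  have Alm: "A \<in> lmeasurable" unfolding A_def J_def by (rule lmeasurable_cells[OF J])
  have A\<Omega>: "A \<subseteq> \<Omega>" unfolding A_def J_def by (rule inner_cells_subset[OF bounded_\<Omega> \<epsilon>])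
  have Dlm: "\<Omega> - A \<in> lmeasurable" using \<Omega>_lmeasurable Alm by (intro fmeasurable_Diff fmeasurableD)
  have "measure lebesgue (\<Omega> - A) \<le> bdry (3 * \<epsilon>)"
    unfolding A_def J_def using Dlm lmeasurable_bdry_nbhd[OF bounded_\<Omega>]
    by (intro measure_mono_fmeasurable Diff_inner_cells[OF bounded_\<Omega> \<epsilon>]) (auto simp: A_def J_def fmeasurableD)
  moreover have "0 \<le> B + 2 * C" using kb[of 0] norm_ge_zero order_trans by blast
  ultimately have D: "(LINT x:(\<Omega> - A)|lebesgue. k x) \<le> (B + 2 * C) * bdry (3 * \<epsilon>)"
    using set_integral_bounded(2)[OF Dlm km kb] mult_left_mono[of "measure lebesgue (\<Omega> - A)" "bdry (3 * \<epsilon>)" "B + 2 * C"]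
    by simp
  have "(LINT x:(A \<union> (\<Omega> - A))|lebesgue. k x) = (LINT x:A|lebesgue. k x) + (LINT x:(\<Omega> - A)|lebesgue. k x)"
    by (intro set_integral_Un set_integral_bounded(1)[OF Alm km kb] set_integral_bounded(1)[OF Dlm km kb]) auto
  moreover have "A \<union> (\<Omega> - A) = \<Omega>" using A\<Omega> by auto
  ultimately have split: "(LINT x:\<Omega>|lebesgue. k x) = (LINT x:A|lebesgue. k x) + (LINT x:(\<Omega> - A)|lebesgue. k x)" by simp
  have pt: "k x \<le> H (idx \<epsilon> x)" if x: "x \<in> A" for x
  proof -
    define i where "i = idx \<epsilon> x"
    have i: "i \<in> inner_pts \<epsilon> \<Omega>" using x by (simp add: A_def J_def cells_def i_def)
    have il: "i \<in> lattice_pts \<epsilon> \<Omega>" using inner_pts_subset[OF bounded_\<Omega> \<epsilon>] i by blast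
    have jl: "i + e \<in> lattice_pts \<epsilon> \<Omega>" by (rule inner_pts_step[OF bounded_\<Omega> \<epsilon> i e])
    have e1: "norm e \<le> 1" "e \<in> int_lattice" using norm_unit_steps[OF e] unit_steps_subset e by auto
    have const: "P y = tensor (u j) (u j)" if "y \<in> \<Omega>" "idx \<epsilon> y = j" "j \<in> lattice_pts \<epsilon> \<Omega>" for y j
    proof -
      have "j \<in> int_lattice" using that(3) by (simp add: lattice_pts_iff)
      then have "y \<in> (\<lambda>w. \<epsilon> *\<^sub>R (j + w)) ` unit_cell" using mem_scaled_unit_cell_iff[OF _ \<epsilon>] that(2) by blast
      then show ?thesis using P that by (auto simp: C_eps_def)
    qed
    have x\<Omega>: "x \<in> \<Omega>" using A\<Omega> x by blast
    have y\<Omega>: "\<epsilon> *\<^sub>R e + x \<in> \<Omega>"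
      using inner_cells_shift[OF bounded_\<Omega> \<epsilon> _ e1(1)] x by (simp add: A_def J_def add.commute)
    have "G x = tensor (u i) (u i)" using const[OF x\<Omega> i_def[symmetric] il] x\<Omega> by (simp add: G)
    moreover have "idx \<epsilon> (\<epsilon> *\<^sub>R e + x) = i + e"
      using idx_shift[OF e1(2) \<epsilon>, of x] by (simp add: add.commute i_def)
    then have "G (\<epsilon> *\<^sub>R e + x) = tensor (u (i + e)) (u (i + e))" using const[OF y\<Omega> _ jl] y\<Omega> by (simp add: G)
    ultimately have Vx: "V x = (1 / 2) *\<^sub>R (tensor (u i) (u i) + tensor (u (i + e)) (u (i + e))) - Q x"
      by (simp add: V_def)
    have u: "norm (u i) = 1" "norm (u (i + e)) = 1" using P(2) il jl by auto
    have "k x \<le> g (rad ((1 / 2) *\<^sub>R (tensor (u i) (u i) + tensor (u (i + e)) (u (i + e)))))"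
      unfolding k_def Vx \<phi>_def
      by (rule tangent_plane[OF \<tau> x\<Omega> midpoint_in_K_set]) (rule tensor_in_K_set, fact u)+
    also have "\<dots> = g \<bar>u i \<bullet> u (i + e)\<bar>" by (simp add: rad_midpoint_tensor u)
    also have "\<dots> \<le> h \<bar>u i \<bullet> u (i + e)\<bar>"
      using Cauchy_Schwarz_ineq2[of "u i" "u (i + e)"] u by (intro g_le_h) simp
    finally show ?thesis by (simp add: H_def i_def)
  qed
  have "(LINT x:A|lebesgue. k x) \<le> (LINT x:A|lebesgue. H (idx \<epsilon> x))"
    using set_integral_bounded(1)[OF Alm km kb] set_integral_cells(1)[OF J, of H] pt
    by (intro set_integral_mono) (auto simp: A_def J_def)
  also have "\<dots> = (\<Sum>i\<in>J. \<epsilon>\<^sup>2 * H i)" unfolding A_def J_def using set_integral_cells(2)[OF J, of H] by simp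
  finally have upper: "(LINT x:\<Omega>|lebesgue. k x) - (B + 2 * C) * bdry (3 * \<epsilon>) \<le> (\<Sum>i\<in>J. \<epsilon>\<^sup>2 * H i)"
    using split D by linarith
  have "(LINT x:\<Omega>|lebesgue. k x) = (LINT x:\<Omega>|lebesgue. g ((1 - \<tau>) * rad (Q x))) + (LINT x:\<Omega>|lebesgue. \<phi> x \<bullet> V x)"
    unfolding k_def
    by (intro set_integral_add set_integral_bounded(1)[OF \<Omega>_lmeasurable gm gb] set_integral_bounded(1)[OF \<Omega>_lmeasurable \<phi>Vm \<phi>V])
  moreover have "(LINT x:\<Omega>|lebesgue. \<phi> x \<bullet> V x) = (\<integral>x. \<phi> x \<bullet> V x \<partial>lebesgue)"
    unfolding set_lebesgue_integral_def using \<phi>0 by (intro Bochner_Integration.integral_cong) (auto simp: indicator_def)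
  moreover have "(\<integral>x. \<phi> x \<bullet> V x \<partial>lebesgue) = (1 / 2) * ((\<integral>x. \<phi> x \<bullet> G x \<partial>lebesgue)
      + (\<integral>x. \<phi> x \<bullet> G (\<epsilon> *\<^sub>R e + x) \<partial>lebesgue)) - (\<integral>x. \<phi> x \<bullet> Q x \<partial>lebesgue)"
  proof -
    note i1 = integrable_inner_bounded[OF \<phi>i Pm G1] and i2 = integrable_inner_bounded[OF \<phi>i Gem G1]
      and i3 = integrable_inner_bounded[OF \<phi>i Q_measurable Q1]
    have "(\<integral>x. \<phi> x \<bullet> V x \<partial>lebesgue) = (\<integral>x. (1 / 2) * (\<phi> x \<bullet> G x + \<phi> x \<bullet> G (\<epsilon> *\<^sub>R e + x)) - \<phi> x \<bullet> Q x \<partial>lebesgue)"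
      by (simp add: V_def inner_diff_right inner_add_right)
    also have "\<dots> = (\<integral>x. (1 / 2) * (\<phi> x \<bullet> G x + \<phi> x \<bullet> G (\<epsilon> *\<^sub>R e + x)) \<partial>lebesgue) - (\<integral>x. \<phi> x \<bullet> Q x \<partial>lebesgue)"
      using i1 i2 i3 by (intro Bochner_Integration.integral_diff integrable_mult_right Bochner_Integration.integrable_add)
    also have "(\<integral>x. (1 / 2) * (\<phi> x \<bullet> G x + \<phi> x \<bullet> G (\<epsilon> *\<^sub>R e + x)) \<partial>lebesgue) = (1 / 2) * (\<integral>x. \<phi> x \<bullet> G x + \<phi> x \<bullet> G (\<epsilon> *\<^sub>R e + x) \<partial>lebesgue)"
      by (rule integral_mult_right_zero)
    also have "(\<integral>x. \<phi> x \<bullet> G x + \<phi> x \<bullet> G (\<epsilon> *\<^sub>R e + x) \<partial>lebesgue) = (\<integral>x. \<phi> x \<bullet> G x \<partial>lebesgue) + (\<integral>x. \<phi> x \<bullet> G (\<epsilon> *\<^sub>R e + x) \<partial>lebesgue)"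
      using i1 i2 by (rule Bochner_Integration.integral_add)
    finally show ?thesis .
  qed
  \<comment> \<open>The unshifted half loses less than \<eta> / 2, the shifted half less than
    \<eta>; the sum is below \<open>2 * \<eta>\<close>.\<close>
  ultimately show ?thesis using upper shift near unfolding \<phi>_def[symmetric] C_def[symmetric] J_def[symmetric] H_def[symmetric]
    by (simp add: abs_le_iff field_simps)
qed

text \<open>All four bonds starting at an inner point occur in the energy. Every other starting
  point carries at most four bonds, each bounded below by \<open>- (\<epsilon>\<^sup>2 * B)\<close>,
  and the number of these points is controlled by the area of the layer.\<close>

lemma energy_lower_bound:
  assumes \<epsilon>: "0 < \<epsilon>" and u: "\<And>i. i \<in> lattice_pts \<epsilon> \<Omega> \<Longrightarrow> norm (u i) = 1"
  shows "(\<Sum>e\<in>unit_steps. \<Sum>i\<in>inner_pts \<epsilon> \<Omega>. \<epsilon>\<^sup>2 * h \<bar>u i \<bullet> u (i + e)\<bar>) - 4 * B * bdry (3 * \<epsilon>)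
    \<le> (\<Sum>(i, j)\<in>neighbours \<epsilon> \<Omega>. \<epsilon>\<^sup>2 * h \<bar>u i \<bullet> u j\<bar>)"
proof -
  let ?L = "lattice_pts \<epsilon> \<Omega>" and ?J = "inner_pts \<epsilon> \<Omega>"
  define E where "E i e = (if i + e \<in> ?L then \<epsilon>\<^sup>2 * h \<bar>u i \<bullet> u (i + e)\<bar> else 0)" for i e
  have fin: "finite ?L" by (rule finite_lattice_pts[OF bounded_\<Omega> \<epsilon>])
  have E: "- (\<epsilon>\<^sup>2 * B) \<le> E i e" if "i \<in> ?L" for i e
  proof (cases "i + e \<in> ?L")
    case True
    have "\<bar>u i \<bullet> u (i + e)\<bar> \<le> 1"
      using Cauchy_Schwarz_ineq2[of "u i" "u (i + e)"] u[OF that] u[OF True] by simp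
    then have "- B \<le> h \<bar>u i \<bullet> u (i + e)\<bar>" using h_bound[of "\<bar>u i \<bullet> u (i + e)\<bar>"] by auto
    then have "\<epsilon>\<^sup>2 * (- B) \<le> \<epsilon>\<^sup>2 * h \<bar>u i \<bullet> u (i + e)\<bar>" by (intro mult_left_mono) auto
    then show ?thesis using True by (simp add: E_def)
  qed (use B_nonneg in \<open>simp add: E_def\<close>)
  have "(\<Sum>(i, j)\<in>neighbours \<epsilon> \<Omega>. \<epsilon>\<^sup>2 * h \<bar>u i \<bullet> u j\<bar>) = (\<Sum>i\<in>?L. \<Sum>e\<in>unit_steps. E i e)"
    unfolding E_def by (rule sum_neighbours[OF fin])
  also have "\<dots> = (\<Sum>i\<in>?L - ?J. \<Sum>e\<in>unit_steps. E i e) + (\<Sum>i\<in>?J. \<Sum>e\<in>unit_steps. E i e)"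
    by (rule sum.subset_diff[OF inner_pts_subset[OF bounded_\<Omega> \<epsilon>] fin])
  also have "(\<Sum>i\<in>?J. \<Sum>e\<in>unit_steps. E i e) = (\<Sum>i\<in>?J. \<Sum>e\<in>unit_steps. \<epsilon>\<^sup>2 * h \<bar>u i \<bullet> u (i + e)\<bar>)"
    using inner_pts_step[OF bounded_\<Omega> \<epsilon>] by (intro sum.cong refl) (simp add: E_def)
  also have "\<dots> = (\<Sum>e\<in>unit_steps. \<Sum>i\<in>?J. \<epsilon>\<^sup>2 * h \<bar>u i \<bullet> u (i + e)\<bar>)" by (rule sum.swap)
  finally have eq: "(\<Sum>(i, j)\<in>neighbours \<epsilon> \<Omega>. \<epsilon>\<^sup>2 * h \<bar>u i \<bullet> u j\<bar>) =
      (\<Sum>i\<in>?L - ?J. \<Sum>e\<in>unit_steps. E i e) + (\<Sum>e\<in>unit_steps. \<Sum>i\<in>?J. \<epsilon>\<^sup>2 * h \<bar>u i \<bullet> u (i + e)\<bar>)" .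
  have "(\<Sum>i\<in>?L - ?J. \<Sum>e\<in>unit_steps. - (\<epsilon>\<^sup>2 * B)) \<le> (\<Sum>i\<in>?L - ?J. \<Sum>e\<in>unit_steps. E i e)"
    by (intro sum_mono E) auto
  moreover have "(\<Sum>i\<in>?L - ?J. \<Sum>e\<in>unit_steps. - (\<epsilon>\<^sup>2 * B)) = - (4 * B * (\<epsilon>\<^sup>2 * card (?L - ?J)))"
    by (simp add: card_unit_steps)
  moreover have "4 * B * (\<epsilon>\<^sup>2 * card (?L - ?J)) \<le> 4 * B * bdry (3 * \<epsilon>)"
    using card_outer_le[OF bounded_\<Omega> \<epsilon>] B_nonneg by (intro mult_left_mono) auto
  ultimately show ?thesis unfolding eq by linarith
qed

lemma bdry_small:
  assumes "0 < d" "0 < c"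
  shows "\<forall>\<^sub>F \<epsilon> in at_right 0. bdry (c * \<epsilon>) < d"
proof -
  have "filterlim (\<lambda>\<epsilon>::real. c * \<epsilon>) (at_right 0) (at_right 0)"
    unfolding filterlim_at using assms(2)
    by (auto simp: eventually_at_right_field intro!: tendsto_eq_intros exI[of _ 1])
  then have "((\<lambda>\<epsilon>. bdry (c * \<epsilon>)) \<longlongrightarrow> 0) (at_right 0)"
    by (rule filterlim_compose[OF measure_bdry_nbhd_tendsto[OF bounded_\<Omega> frontier_\<Omega>]])
  then show ?thesis using assms(1) by (rule order_tendstoD)
qed

text \<open>The gap between c and the limit fixes \<tau> and with it the test field, before
  \<epsilon> enters. The condition on the pairing therefore describes one half-space neighbourhood
  of Q in which all energies are at least c once \<epsilon> is small.\<close>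

lemma lower_bound:
  assumes c: "c < 4 * limit_density"
  obtains \<phi> \<eta> where "\<phi> \<in> L1_sym \<Omega>" "0 < \<eta>"
    "\<forall>\<^sub>F \<epsilon> in at_right 0. \<forall>P u. P \<in> Linf \<Omega> sym_matrices \<longrightarrow> director_field \<epsilon> \<Omega> P u \<longrightarrow>
      (\<integral>x. Q x \<bullet> \<phi> x \<partial>lebesgue_on \<Omega>) - \<eta> < (\<integral>x. P x \<bullet> \<phi> x \<partial>lebesgue_on \<Omega>) \<longrightarrow>
      c \<le> (\<Sum>(i, j)\<in>neighbours \<epsilon> \<Omega>. \<epsilon>\<^sup>2 * h \<bar>u i \<bullet> u j\<bar>)"
proof -
  have "c / 4 < limit_density" using c by simp
  then have "\<forall>\<^sub>F n in sequentially. c / 4 < (LINT x:\<Omega>|lebesgue. g ((1 - inverse (real (Suc (Suc n)))) * rad (Q x)))"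
    by (rule order_tendstoD(1)[OF scaled_density_tendsto])
  then obtain n where n: "c / 4 < (LINT x:\<Omega>|lebesgue. g ((1 - inverse (real (Suc (Suc n)))) * rad (Q x)))"
    by (auto simp: eventually_sequentially)
  define \<tau> where "\<tau> = inverse (real (Suc (Suc n)))"
  have \<tau>: "0 < \<tau>" "\<tau> < 1" by (simp_all add: \<tau>_def inverse_less_1_iff)
  define d where "d = 4 * (LINT x:\<Omega>|lebesgue. g ((1 - \<tau>) * rad (Q x))) - c"
  have d: "d > 0" using n by (simp add: d_def \<tau>_def)
  define C where "C = B + 2 * (2 * B / \<tau> * sqrt 2)"
  have C: "0 \<le> C" using B_nonneg \<tau> by (simp add: C_def)
  \<comment> \<open>Each of the four steps loses \<open>2 * \<eta>\<close>, in total d / 2; the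
    other half of the gap d pays for the boundary layer.\<close>
  define \<eta> where "\<eta> = d / 16"
  have \<eta>: "0 < \<eta>" using d by (simp add: \<eta>_def)
  obtain \<delta> where \<delta>: "\<delta> > 0" "\<And>h G. norm h < \<delta> \<Longrightarrow> G \<in> borel_measurable lebesgue \<Longrightarrow> (\<And>x. norm (G x) \<le> 1) \<Longrightarrow>
      (\<And>x. x \<notin> \<Omega> \<Longrightarrow> G x = 0) \<Longrightarrow>
      \<bar>(\<integral>x. tangent \<tau> x \<bullet> G (h + x) \<partial>lebesgue) - (\<integral>x. tangent \<tau> x \<bullet> G x \<partial>lebesgue)\<bar> \<le> \<eta>"
    using uniform_shift_pairing[OF bounded_\<Omega> tangent_integrable[OF \<tau>] \<eta>] by blast
  have "\<forall>\<^sub>F \<epsilon> in at_right 0. bdry (3 * \<epsilon>) < d / 2 / (4 * C + 4 * B + 1)"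
    using d C B_nonneg by (intro bdry_small divide_pos_pos) auto
  moreover have "\<forall>\<^sub>F \<epsilon> in at_right (0::real). 0 < \<epsilon> \<and> \<epsilon> < \<delta>"
    using \<delta>(1) unfolding eventually_at_right_field by (intro exI[of _ \<delta>]) simp
  ultimately have ev: "\<forall>\<^sub>F \<epsilon> in at_right 0. \<forall>P u. P \<in> Linf \<Omega> sym_matrices \<longrightarrow> director_field \<epsilon> \<Omega> P u \<longrightarrow>
      (\<integral>x. Q x \<bullet> tangent \<tau> x \<partial>lebesgue_on \<Omega>) - \<eta> < (\<integral>x. P x \<bullet> tangent \<tau> x \<partial>lebesgue_on \<Omega>) \<longrightarrow>
      c \<le> (\<Sum>(i, j)\<in>neighbours \<epsilon> \<Omega>. \<epsilon>\<^sup>2 * h \<bar>u i \<bullet> u j\<bar>)"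
  proof eventually_elim
    case (elim \<epsilon>)
    show ?case
    proof (intro allI impI)
      fix P u assume P: "P \<in> Linf \<Omega> sym_matrices" and dir: "director_field \<epsilon> \<Omega> P u"
        and near: "(\<integral>x. Q x \<bullet> tangent \<tau> x \<partial>lebesgue_on \<Omega>) - \<eta> < (\<integral>x. P x \<bullet> tangent \<tau> x \<partial>lebesgue_on \<Omega>)"
      have \<epsilon>: "0 < \<epsilon>" "\<epsilon> < \<delta>" using elim by auto
      obtain P' where P': "P' \<in> C_eps \<epsilon> \<Omega>" "AE x in lebesgue_on \<Omega>. P' x = P x"
        "\<And>i. i \<in> lattice_pts \<epsilon> \<Omega> \<Longrightarrow> norm (u i) = 1 \<and> P' (\<epsilon> *\<^sub>R i) = tensor (u i) (u i)"
        using dir unfolding director_field_def by blast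
      define G where "G x = (if x \<in> \<Omega> then P' x else 0)" for x
      \<comment> \<open>G has the exact cell structure, while measurability is known for P; G
        inherits it from G0 by equality almost everywhere in the complete measure.\<close>
      define G0 where "G0 x = (if x \<in> \<Omega> then P x else 0)" for x
      have G0m: "G0 \<in> borel_measurable lebesgue"
        unfolding G0_def using P \<Omega>_sets by (simp add: borel_measurable_if Linf_def)
      have "AE x in lebesgue. x \<in> \<Omega> \<longrightarrow> P' x = P x"
        using P'(2) \<Omega>_sets by (simp add: AE_restrict_space_iff)
      then have ae: "AE x in lebesgue. G0 x = G x" by eventually_elim (simp add: G0_def G_def)
      have Gm: "G \<in> borel_measurable lebesgue" by (rule borel_measurable_AE[OF G0m ae])
      have tm: "tangent \<tau> \<in> borel_measurable lebesgue" by (rule tangent_measurable[OF \<tau>])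
      have "(\<integral>x. P x \<bullet> tangent \<tau> x \<partial>lebesgue_on \<Omega>) = (\<integral>x. tangent \<tau> x \<bullet> P x \<partial>lebesgue)"
        by (rule integral_pairing_eq) (simp add: tangent_def)
      also have "\<dots> = (\<integral>x. tangent \<tau> x \<bullet> G0 x \<partial>lebesgue)"
        by (intro Bochner_Integration.integral_cong) (auto simp: G0_def tangent_def)
      also have "\<dots> = (\<integral>x. tangent \<tau> x \<bullet> G x \<partial>lebesgue)"
      proof (rule integral_cong_AE)
        show "AE x in lebesgue. tangent \<tau> x \<bullet> G0 x = tangent \<tau> x \<bullet> G x" using ae by eventually_elim simp
      qed (use tm Gm G0m in \<open>auto intro: borel_measurable_inner\<close>)
      finally have near': "(\<integral>x. tangent \<tau> x \<bullet> Q x \<partial>lebesgue) - \<eta> < (\<integral>x. tangent \<tau> x \<bullet> G x \<partial>lebesgue)"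
        using near integral_pairing_eq[of "tangent \<tau>" Q] by (simp add: tangent_def)
      have G1: "norm (G x) \<le> 1" for x
        using P'(1) S1_tensor_subset_K_set by (auto simp: G_def C_eps_def intro!: norm_K_set_le)
      have bond: "(LINT x:\<Omega>|lebesgue. g ((1 - \<tau>) * rad (Q x))) - 2 * \<eta> - C * bdry (3 * \<epsilon>)
          \<le> (\<Sum>i\<in>inner_pts \<epsilon> \<Omega>. \<epsilon>\<^sup>2 * h \<bar>u i \<bullet> u (i + e)\<bar>)" if e: "e \<in> unit_steps" for e
        unfolding C_def
      proof (rule bond_lower_bound[OF \<epsilon>(1) e \<tau> P'(1) P'(3) Gm G_def _ near'])
        show "\<bar>(\<integral>x. tangent \<tau> x \<bullet> G (\<epsilon> *\<^sub>R e + x) \<partial>lebesgue) - (\<integral>x. tangent \<tau> x \<bullet> G x \<partial>lebesgue)\<bar> \<le> \<eta>"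
          by (rule \<delta>(2)[OF _ Gm G1]) (use \<epsilon> norm_unit_steps[OF e] in \<open>auto simp: G_def\<close>)
      qed
      have "(\<Sum>e\<in>unit_steps. (LINT x:\<Omega>|lebesgue. g ((1 - \<tau>) * rad (Q x))) - 2 * \<eta> - C * bdry (3 * \<epsilon>))
          \<le> (\<Sum>e\<in>unit_steps. \<Sum>i\<in>inner_pts \<epsilon> \<Omega>. \<epsilon>\<^sup>2 * h \<bar>u i \<bullet> u (i + e)\<bar>)"
        by (rule sum_mono[OF bond])
      then have bonds: "4 * ((LINT x:\<Omega>|lebesgue. g ((1 - \<tau>) * rad (Q x))) - 2 * \<eta> - C * bdry (3 * \<epsilon>))
          \<le> (\<Sum>e\<in>unit_steps. \<Sum>i\<in>inner_pts \<epsilon> \<Omega>. \<epsilon>\<^sup>2 * h \<bar>u i \<bullet> u (i + e)\<bar>)"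
        by (simp add: card_unit_steps)
      have small: "(4 * C + 4 * B) * bdry (3 * \<epsilon>) \<le> d / 2"
      proof -
        have "(4 * C + 4 * B) * bdry (3 * \<epsilon>) \<le> (4 * C + 4 * B + 1) * bdry (3 * \<epsilon>)"
          by (intro mult_right_mono) auto
        also have "\<dots> \<le> (4 * C + 4 * B + 1) * (d / 2 / (4 * C + 4 * B + 1))"
          using elim C B_nonneg by (intro mult_left_mono) auto
        also have "\<dots> = d / 2"
        proof -
          have "4 * C + 4 * B + 1 \<noteq> 0" using C B_nonneg by linarith
          then show ?thesis by (metis nonzero_mult_div_cancel_left times_divide_eq_right)
        qed
        finally show ?thesis .
      qed
      have arith: "4 * I - 4 * (2 * ((4 * I - c) / 16)) - 4 * X \<le> S \<Longrightarrow> 4 * X + 4 * Y \<le> (4 * I - c) / 2 \<Longrightarrow>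
          S - 4 * Y \<le> T \<Longrightarrow> c \<le> T" for I X Y S T :: real
        by (simp add: field_simps)
      from small have small': "4 * (C * bdry (3 * \<epsilon>)) + 4 * (B * bdry (3 * \<epsilon>)) \<le> d / 2"
        by (simp only: distrib_right mult.assoc)
      have energy: "(\<Sum>e\<in>unit_steps. \<Sum>i\<in>inner_pts \<epsilon> \<Omega>. \<epsilon>\<^sup>2 * h \<bar>u i \<bullet> u (i + e)\<bar>) - 4 * (B * bdry (3 * \<epsilon>))
          \<le> (\<Sum>(i, j)\<in>neighbours \<epsilon> \<Omega>. \<epsilon>\<^sup>2 * h \<bar>u i \<bullet> u j\<bar>)"
        using energy_lower_bound[OF \<epsilon>(1), of u] P'(3) by (simp only: mult.assoc)
      from bonds small' energy show "c \<le> (\<Sum>(i, j)\<in>neighbours \<epsilon> \<Omega>. \<epsilon>\<^sup>2 * h \<bar>u i \<bullet> u j\<bar>)"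
        unfolding right_diff_distrib d_def \<eta>_def by (rule arith)
    qed
  qed
  show thesis by (rule that[OF tangent_L1_sym[OF \<tau>] \<eta> ev])
qed

end

section \<open>Blocks of lattice points\<close>

text \<open>The lattice is divided into blocks of \<open>L \<times> (m L)\<close> points, each a column of \<open>m\<close> squares of \<open>L \<times> L\<close>
  points. For a lattice point, \<open>bkey\<close> is its block, \<open>bphase\<close> the number of its square in the block, and
  \<open>bpar\<close> its checkerboard colour; \<open>bpt\<close> lists the points of a block.\<close>

definition bkey :: "nat \<Rightarrow> nat \<Rightarrow> real^2 \<Rightarrow> int \<times> int" where
  "bkey L m i = (\<lfloor>i $ 1\<rfloor> div int L, (\<lfloor>i $ 2\<rfloor> div int L) div int m)"

definition bphase :: "nat \<Rightarrow> nat \<Rightarrow> real^2 \<Rightarrow> nat" where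
  "bphase L m i = nat ((\<lfloor>i $ 2\<rfloor> div int L) mod int m)"

definition bpar :: "nat \<Rightarrow> real^2 \<Rightarrow> bool" where
  "bpar L i \<longleftrightarrow> even (\<lfloor>i $ 1\<rfloor> mod int L + \<lfloor>i $ 2\<rfloor> mod int L)"

definition bpt :: "nat \<Rightarrow> nat \<Rightarrow> int \<times> int \<Rightarrow> nat \<times> nat \<times> nat \<Rightarrow> real^2" where
  "bpt L m \<kappa> = (\<lambda>(r, k, s). vector [of_int (fst \<kappa> * int L + int r), of_int ((snd \<kappa> * int m + int k) * int L + int s)])"

definition bidx :: "nat \<Rightarrow> nat \<Rightarrow> (nat \<times> nat \<times> nat) set" where
  "bidx L m = {..<L} \<times> {..<m} \<times> {..<L}"

definition block :: "nat \<Rightarrow> nat \<Rightarrow> int \<times> int \<Rightarrow> (real^2) set" where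
  "block L m \<kappa> = {i \<in> int_lattice. bkey L m i = \<kappa>}"

lemma div_mult_add:
  assumes "r < L"
  shows "(a * int L + int r) div int L = a" "(a * int L + int r) mod int L = int r"
  using assms by simp_all

lemma bpt_nth:
  "bpt L m \<kappa> (r, k, s) $ 1 = of_int (fst \<kappa> * int L + int r)"
  "bpt L m \<kappa> (r, k, s) $ 2 = of_int ((snd \<kappa> * int m + int k) * int L + int s)"
  by (simp_all only: bpt_def prod.case vector_2)

lemma bpt_in_lattice: "bpt L m \<kappa> p \<in> int_lattice"
  by (cases p) (simp add: int_lattice_def forall_2 bpt_nth del: of_int_add of_int_mult)

lemma bpt_data:
  assumes "(r, k, s) \<in> bidx L m"
  shows "bkey L m (bpt L m \<kappa> (r, k, s)) = \<kappa>" "bphase L m (bpt L m \<kappa> (r, k, s)) = k"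
    "bpar L (bpt L m \<kappa> (r, k, s)) = even (r + s)"
proof -
  have *: "r < L" "k < m" "s < L" using assms by (auto simp: bidx_def)
  show "bkey L m (bpt L m \<kappa> (r, k, s)) = \<kappa>"
    unfolding bkey_def bpt_nth floor_of_int div_mult_add[OF *(1)] div_mult_add[OF *(3)] div_mult_add[OF *(2)] by simp
  show "bphase L m (bpt L m \<kappa> (r, k, s)) = k"
    unfolding bphase_def bpt_nth floor_of_int div_mult_add[OF *(3)] div_mult_add[OF *(2)] by simp
  show "bpar L (bpt L m \<kappa> (r, k, s)) = even (r + s)"
    unfolding bpar_def bpt_nth floor_of_int div_mult_add[OF *(3)] div_mult_add[OF *(1)] by simp
qed

context
  fixes L m :: nat
  assumes L: "0 < L" and m: "0 < m"
begin

lemma block_cases: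
  assumes "i \<in> block L m \<kappa>"
  obtains p where "p \<in> bidx L m" "i = bpt L m \<kappa> p"
proof -
  have i: "i \<in> int_lattice" "bkey L m i = \<kappa>" using assms by (auto simp: block_def)
  obtain a b where ab: "i $ 1 = of_int a" "i $ 2 = of_int b" "i = vector [of_int a, of_int b]"
    by (rule lattice_cases[OF i(1)])
  let ?c = "b div int L"
  have \<kappa>: "\<kappa> = (a div int L, ?c div int m)" using i(2) by (simp add: bkey_def ab(1,2))
  let ?p = "(nat (a mod int L), nat (?c mod int m), nat (b mod int L))"
  have pos: "0 \<le> a mod int L" "a mod int L < int L" "0 \<le> ?c mod int m" "?c mod int m < int m"
    "0 \<le> b mod int L" "b mod int L < int L" using L m by simp_all
  then have "?p \<in> bidx L m" by (simp add: bidx_def nat_less_iff)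
  moreover have "i = bpt L m \<kappa> ?p"
  proof -
    have "a = a div int L * int L + a mod int L" "?c = ?c div int m * int m + ?c mod int m"
      "b = ?c * int L + b mod int L" by simp_all
    then have "bpt L m \<kappa> ?p = vector [of_int a, of_int b]"
      using pos by (simp only: bpt_def prod.case \<kappa> fst_conv snd_conv int_nat_eq if_True)
    then show ?thesis using ab(3) by simp
  qed
  ultimately show thesis by (rule that)
qed

lemma bij_betw_bpt: "bij_betw (bpt L m \<kappa>) (bidx L m) (block L m \<kappa>)"
proof (rule bij_betwI')
  fix p q assume p: "p \<in> bidx L m" and q: "q \<in> bidx L m"
  obtain r k s r' k' s' where pq: "p = (r, k, s)" "q = (r', k', s')" by (cases p, cases q) auto
  show "bpt L m \<kappa> p = bpt L m \<kappa> q \<longleftrightarrow> p = q"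
  proof
    assume eq: "bpt L m \<kappa> p = bpt L m \<kappa> q"
    have k: "k = k'" using bpt_data(2)[of r k s L m \<kappa>] bpt_data(2)[of r' k' s' L m \<kappa>] p q eq by (simp add: pq)
    have "fst \<kappa> * int L + int r = fst \<kappa> * int L + int r'"
      using eq bpt_nth(1)[of L m \<kappa>] unfolding pq by (metis of_int_eq_iff)
    moreover have "(snd \<kappa> * int m + int k) * int L + int s = (snd \<kappa> * int m + int k') * int L + int s'"
      using eq bpt_nth(2)[of L m \<kappa>] unfolding pq by (metis of_int_eq_iff)
    ultimately show "p = q" using k by (simp add: pq)
  qed simp
next
  fix p assume "p \<in> bidx L m"
  then show "bpt L m \<kappa> p \<in> block L m \<kappa>"
    using bpt_data(1)[of _ _ _ L m \<kappa>] bpt_in_lattice by (cases p) (auto simp: block_def)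
next
  fix i assume "i \<in> block L m \<kappa>"
  then show "\<exists>p\<in>bidx L m. i = bpt L m \<kappa> p" by (rule block_cases) blast
qed

lemma finite_bidx: "finite (bidx L m)"
  by (simp add: bidx_def)

lemma finite_block: "finite (block L m \<kappa>)"
  using bij_betw_finite[OF bij_betw_bpt] finite_bidx by blast

lemma block_lattice: "block L m \<kappa> \<subseteq> int_lattice"
  by (auto simp: block_def)

lemma sum_block: "(\<Sum>i\<in>block L m \<kappa>. F i) = (\<Sum>p\<in>bidx L m. F (bpt L m \<kappa> p))"
  by (rule sum.reindex_bij_betw[OF bij_betw_bpt, symmetric])

lemma sum_bidx: "(\<Sum>p\<in>bidx L m. F p) = (\<Sum>r<L. \<Sum>k<m. \<Sum>s<L. F (r, k, s))"
  unfolding bidx_def sum.cartesian_product' ..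

lemma sum_block_phase:
  fixes F :: "nat \<Rightarrow> real"
  shows "(\<Sum>i\<in>block L m \<kappa>. F (bphase L m i)) = (real L)\<^sup>2 * (\<Sum>k<m. F k)"
proof -
  have "(\<Sum>i\<in>block L m \<kappa>. F (bphase L m i)) = (\<Sum>p\<in>bidx L m. F (fst (snd p)))"
    unfolding sum_block by (intro sum.cong refl) (auto simp: bpt_data(2))
  also have "\<dots> = (\<Sum>r<L. \<Sum>k<m. \<Sum>s<L. F k)"
    unfolding sum_bidx fst_conv snd_conv ..
  finally show ?thesis by (simp add: sum_distrib_left power2_eq_square mult.assoc)
qed

lemma card_block: "real (card (block L m \<kappa>)) = (real L)\<^sup>2 * real m"
  using sum_block_phase[of "\<lambda>_. 1" \<kappa>] by simp

lemma checkerboard_row: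
  fixes X Y :: "'a::real_vector"
  shows "(\<Sum>s<2 * l. if even (r + s) then X else Y) = real l *\<^sub>R (X + Y)"
  by (induction l) (auto simp: algebra_simps scaleR_add_left)

text \<open>For even L each column of a square contains both colours equally often, so every square
  averages to the midpoint of its two values.\<close>

lemma sum_block_checkerboard:
  fixes X Y :: "nat \<Rightarrow> 'a::real_vector"
  assumes "even L"
  shows "(\<Sum>i\<in>block L m \<kappa>. if bpar L i then X (bphase L m i) else Y (bphase L m i))
    = (real L)\<^sup>2 *\<^sub>R (\<Sum>k<m. (1 / 2) *\<^sub>R (X k + Y k))"
proof -
  obtain l where l: "L = 2 * l" using assms by blast
  have "(\<Sum>i\<in>block L m \<kappa>. if bpar L i then X (bphase L m i) else Y (bphase L m i))
      = (\<Sum>p\<in>bidx L m. if even (fst p + snd (snd p)) then X (fst (snd p)) else Y (fst (snd p)))"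
    unfolding sum_block by (intro sum.cong refl) (auto simp: bpt_data(2,3))
  also have "\<dots> = (\<Sum>r<L. \<Sum>k<m. \<Sum>s<L. if even (r + s) then X k else Y k)"
    unfolding sum_bidx fst_conv snd_conv ..
  also have "\<dots> = (\<Sum>r<L. \<Sum>k<m. real l *\<^sub>R (X k + Y k))"
    unfolding l checkerboard_row ..
  also have "\<dots> = (real L * real l) *\<^sub>R (\<Sum>k<m. X k + Y k)"
    by (simp add: scaleR_sum_right sum_constant_scaleR)
  also have "\<dots> = (real L)\<^sup>2 *\<^sub>R (\<Sum>k<m. (1 / 2) *\<^sub>R (X k + Y k))"
    by (simp add: l power2_eq_square flip: scaleR_sum_right)
  finally show ?thesis .
qed

lemma dist_block_le:
  assumes "i \<in> block L m \<kappa>" "j \<in> block L m \<kappa>"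
  shows "norm (i - j) \<le> real L + real m * real L"
proof -
  obtain p where p: "p \<in> bidx L m" "i = bpt L m \<kappa> p" by (rule block_cases[OF assms(1)])
  obtain q where q: "q \<in> bidx L m" "j = bpt L m \<kappa> q" by (rule block_cases[OF assms(2)])
  obtain r k s where pp: "p = (r, k, s)" by (cases p) auto
  obtain r' k' s' where qq: "q = (r', k', s')" by (cases q) auto
  have b: "r < L" "k < m" "s < L" "r' < L" "k' < m" "s' < L" using p q by (auto simp: pp qq bidx_def)
  have le: "k * L + s \<le> m * L" if "k < m" "s < L" for k s
  proof -
    have "k * L + s \<le> Suc k * L" using that by simp
    also have "\<dots> \<le> m * L" using that by (intro mult_right_mono) auto
    finally show ?thesis .
  qed
  have "(i - j) $ 1 = real r - real r'" "(i - j) $ 2 = real (k * L + s) - real (k' * L + s')"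
    by (simp_all add: p q pp qq bpt_nth algebra_simps)
  moreover have "\<bar>real r - real r'\<bar> \<le> real L" using b by linarith
  moreover have "real (k * L + s) \<le> real (m * L)" "real (k' * L + s') \<le> real (m * L)"
    using le b by (simp_all only: of_nat_le_iff)
  then have "\<bar>real (k * L + s) - real (k' * L + s')\<bar> \<le> real (m * L)"
    using of_nat_0_le_iff[of "k * L + s", where 'a = real] of_nat_0_le_iff[of "k' * L + s'", where 'a = real]
    by linarith
  then have "\<bar>real (k * L + s) - real (k' * L + s')\<bar> \<le> real m * real L" unfolding of_nat_mult .
  ultimately show ?thesis
    using norm_le_l1_cart[of "i - j"] by (simp add: sum_2)
qed

text \<open>Such a bond stays in one square of one block and joins opposite colours, hence the two
  directions of a single phase; its energy is then known exactly.\<close>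

definition inside_step :: "real^2 \<Rightarrow> real^2 \<Rightarrow> bool" where
  "inside_step e i \<longleftrightarrow> bkey L m (i + e) = bkey L m i \<and> bphase L m (i + e) = bphase L m i \<and> bpar L (i + e) \<noteq> bpar L i"

lemma inside_stepI:
  assumes "(r, k, s) \<in> bidx L m" "(r', k, s') \<in> bidx L m" "odd (r + s + r' + s')"
    "bpt L m \<kappa> (r, k, s) + e = bpt L m \<kappa> (r', k, s')"
  shows "inside_step e (bpt L m \<kappa> (r, k, s))"
proof -
  have "even (r + s) \<noteq> even (r' + s')" using assms(3) by presburger
  then show ?thesis
    unfolding inside_step_def assms(4) bpt_data[OF assms(1)] bpt_data[OF assms(2)] by blast
qed

text \<open>The bonds that leave their square in a given direction start on one side of it: L points
  in each of the m squares, a fraction 1 / L of the block. A step between consecutive squares of a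
  block counts as crossing, because the phase changes.\<close>

lemma card_crossing_le:
  assumes "e \<in> unit_steps"
  shows "card {i \<in> block L m \<kappa>. \<not> inside_step e i} \<le> L * m"
proof -
  have count: "card {i \<in> block L m \<kappa>. \<not> inside_step e i} \<le> L * m"
    if A: "A \<subseteq> bidx L m" "card A = L * m" and good: "\<And>p. p \<in> bidx L m - A \<Longrightarrow> inside_step e (bpt L m \<kappa> p)" for A
  proof -
    have "{i \<in> block L m \<kappa>. \<not> inside_step e i} \<subseteq> bpt L m \<kappa> ` A"
    proof
      fix i assume i: "i \<in> {i \<in> block L m \<kappa>. \<not> inside_step e i}"
      then obtain p where p: "p \<in> bidx L m" "i = bpt L m \<kappa> p" using block_cases[of i \<kappa>] by blast
      then have "p \<in> A" using good[of p] i by blast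
      then show "i \<in> bpt L m \<kappa> ` A" using p(2) by blast
    qed
    then have "card {i \<in> block L m \<kappa>. \<not> inside_step e i} \<le> card (bpt L m \<kappa> ` A)"
      by (intro card_mono finite_imageI finite_subset[OF A(1) finite_bidx])
    also have "\<dots> \<le> card A" by (rule card_image_le[OF finite_subset[OF A(1) finite_bidx]])
    finally show ?thesis unfolding A(2) .
  qed
  have pt: "bpt L m \<kappa> (r, k, s) + e = bpt L m \<kappa> (r', k, s')"
    if "e $ 1 = real r' - real r" "e $ 2 = real s' - real s" for r k s r' s'
    unfolding vec_eq_iff forall_2 vector_add_component bpt_nth that by simp
  consider "e = axis 1 1" | "e = - axis 1 1" | "e = axis 2 1" | "e = - axis 2 1"
    using assms by (auto simp: unit_steps_def)
  then show ?thesis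
  proof cases
    case 1
    have e: "e $ 1 = 1" "e $ 2 = 0" by (simp_all add: 1 axis_def)
    show ?thesis
    proof (rule count[of "{L - 1} \<times> {..<m} \<times> {..<L}"])
      fix p assume p: "p \<in> bidx L m - {L - 1} \<times> {..<m} \<times> {..<L}"
      obtain r k s where pp: "p = (r, k, s)" by (cases p) auto
      have "r < L - 1" "k < m" "s < L" using p L by (auto simp: pp bidx_def)
      then show "inside_step e (bpt L m \<kappa> p)" unfolding pp
        by (intro inside_stepI[of r k s "r + 1" s] pt) (auto simp: bidx_def e)
    qed (use L in \<open>auto simp: bidx_def card_cartesian_product\<close>)
  next
    case 2
    have e: "e $ 1 = -1" "e $ 2 = 0" by (simp_all add: 2 axis_def)
    show ?thesis
    proof (rule count[of "{0} \<times> {..<m} \<times> {..<L}"])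
      fix p assume p: "p \<in> bidx L m - {0} \<times> {..<m} \<times> {..<L}"
      obtain r k s where pp: "p = (r, k, s)" by (cases p) auto
      have r: "0 < r" "r < L" "k < m" "s < L" using p L by (auto simp: pp bidx_def)
      then have "odd (r + s + (r - 1) + s)" by (cases r) auto
      then show "inside_step e (bpt L m \<kappa> p)" unfolding pp
        using r by (intro inside_stepI[of r k s "r - 1" s] pt) (auto simp: bidx_def e of_nat_diff)
    qed (use L in \<open>auto simp: bidx_def card_cartesian_product\<close>)
  next
    case 3
    have e: "e $ 1 = 0" "e $ 2 = 1" by (simp_all add: 3 axis_def)
    show ?thesis
    proof (rule count[of "{..<L} \<times> {..<m} \<times> {L - 1}"])
      fix p assume p: "p \<in> bidx L m - {..<L} \<times> {..<m} \<times> {L - 1}"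
      obtain r k s where pp: "p = (r, k, s)" by (cases p) auto
      have "s < L - 1" "k < m" "r < L" using p L by (auto simp: pp bidx_def)
      then show "inside_step e (bpt L m \<kappa> p)" unfolding pp
        by (intro inside_stepI[of r k s r "s + 1"] pt) (auto simp: bidx_def e)
    qed (use L in \<open>auto simp: bidx_def card_cartesian_product\<close>)
  next
    case 4
    have e: "e $ 1 = 0" "e $ 2 = -1" by (simp_all add: 4 axis_def)
    show ?thesis
    proof (rule count[of "{..<L} \<times> {..<m} \<times> {0}"])
      fix p assume p: "p \<in> bidx L m - {..<L} \<times> {..<m} \<times> {0}"
      obtain r k s where pp: "p = (r, k, s)" by (cases p) auto
      have r: "0 < s" "r < L" "k < m" "s < L" using p L by (auto simp: pp bidx_def)
      then have "odd (r + s + r + (s - 1))" by (cases s) auto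
      then show "inside_step e (bpt L m \<kappa> p)" unfolding pp
        using r by (intro inside_stepI[of r k s r "s - 1"] pt) (auto simp: bidx_def e of_nat_diff)
    qed (use L in \<open>auto simp: bidx_def card_cartesian_product\<close>)
  qed
qed

section \<open>Regions of the plane covered by blocks\<close>

definition piece :: "real \<Rightarrow> int \<times> int \<Rightarrow> (real^2) set" where
  "piece \<epsilon> \<kappa> = cells \<epsilon> (block L m \<kappa>)"

lemma mem_piece_iff: "x \<in> piece \<epsilon> \<kappa> \<longleftrightarrow> bkey L m (idx \<epsilon> x) = \<kappa>"
  by (simp add: piece_def cells_def block_def)

lemma disjoint_pieces: "disjoint_family_on (piece \<epsilon>) X"
  by (auto simp: disjoint_family_on_def mem_piece_iff)

context
  fixes \<epsilon> :: real
  assumes \<epsilon>: "0 < \<epsilon>"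
begin

lemma lmeasurable_piece: "piece \<epsilon> \<kappa> \<in> lmeasurable"
  unfolding piece_def by (rule lmeasurable_cells[OF finite_block block_lattice \<epsilon>])

lemma measure_piece: "measure lebesgue (piece \<epsilon> \<kappa>) = \<epsilon>\<^sup>2 * ((real L)\<^sup>2 * real m)"
  unfolding piece_def by (simp add: measure_cells[OF finite_block block_lattice \<epsilon>] card_block)

lemma dist_piece_le:
  assumes "x \<in> piece \<epsilon> \<kappa>" "y \<in> piece \<epsilon> \<kappa>"
  shows "dist x y \<le> (real L + real m * real L + 2) * \<epsilon>"
proof -
  have "norm (idx \<epsilon> x - idx \<epsilon> y) \<le> real L + real m * real L"
    using assms by (intro dist_block_le) (auto simp: piece_def cells_def)
  then have "dist (\<epsilon> *\<^sub>R idx \<epsilon> x) (\<epsilon> *\<^sub>R idx \<epsilon> y) \<le> \<epsilon> * (real L + real m * real L)"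
    using \<epsilon> by (simp add: dist_norm flip: scaleR_diff_right)
  moreover have "dist x y \<le> dist x (\<epsilon> *\<^sub>R idx \<epsilon> x) + dist (\<epsilon> *\<^sub>R idx \<epsilon> x) (\<epsilon> *\<^sub>R idx \<epsilon> y) + dist y (\<epsilon> *\<^sub>R idx \<epsilon> y)"
    using dist_triangle[of x y "\<epsilon> *\<^sub>R idx \<epsilon> x"] dist_triangle[of "\<epsilon> *\<^sub>R idx \<epsilon> x" y "\<epsilon> *\<^sub>R idx \<epsilon> y"]
      dist_commute[of y "\<epsilon> *\<^sub>R idx \<epsilon> y"] by linarith
  ultimately show ?thesis using dist_idx_le[OF \<epsilon>, of x] dist_idx_le[OF \<epsilon>, of y] by (simp add: algebra_simps)
qed

end

end

section \<open>Recovery fields\<close>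

lemma set_integral_inner_right:
  fixes f :: "'a \<Rightarrow> 'b::euclidean_space"
  assumes "set_integrable M A f"
  shows "set_integrable M A (\<lambda>x. c \<bullet> f x)" "(LINT x:A|M. c \<bullet> f x) = c \<bullet> (LINT x:A|M. f x)"
proof -
  have eq: "(\<lambda>x. indicator A x *\<^sub>R (c \<bullet> f x)) = (\<lambda>x. c \<bullet> (indicator A x *\<^sub>R f x))"
    by (simp add: fun_eq_iff)
  show "set_integrable M A (\<lambda>x. c \<bullet> f x)"
    using assms unfolding set_integrable_def eq by (intro integrable_inner_right)
  show "(LINT x:A|M. c \<bullet> f x) = c \<bullet> (LINT x:A|M. f x)"
    using assms unfolding set_integrable_def set_lebesgue_integral_def eq by (intro integral_inner_right)
qed

lemma set_integral_const_lmeasurable: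
  fixes c :: "'b::euclidean_space"
  assumes "A \<in> lmeasurable"
  shows "(LINT x:A|lebesgue. c) = measure lebesgue A *\<^sub>R c"
  by (rule set_integral_const[OF fmeasurableD[OF assms] fmeasurableD2[OF assms, folded infinity_ennreal_def]])

text \<open>Integrating the obtuse-angle inequality for the projection q of the mean p gives
  \<open>(p - q) \<bullet> (p - q) \<le> 0\<close>, so p is its own projection.\<close>

lemma mean_in_K_set:
  assumes R: "R \<in> lmeasurable" "0 < measure lebesgue R"
    and f: "f \<in> borel_measurable lebesgue" "\<And>x. f x \<in> K_set"
  obtains p where "p \<in> K_set" "(LINT x:R|lebesgue. f x) = measure lebesgue R *\<^sub>R p"
proof -
  define \<mu> where "\<mu> = measure lebesgue R"
  define p where "p = (1 / \<mu>) *\<^sub>R (LINT x:R|lebesgue. f x)"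
  define q where "q = closest_point K_set p"
  have eq: "(LINT x:R|lebesgue. f x) = \<mu> *\<^sub>R p" using R(2) by (simp add: p_def \<mu>_def)
  have fi: "set_integrable lebesgue R f"
    by (rule set_integral_bounded(1)[OF R(1) f(1)]) (rule norm_K_set_le[OF f(2)])
  have "(p - q) \<bullet> (f x - q) \<le> 0" for x
    unfolding q_def by (rule closest_point_dot[OF convex_K_set closed_K_set f(2)])
  then have "(p - q) \<bullet> f x \<le> (p - q) \<bullet> q" for x by (simp add: inner_diff_right)
  then have "(LINT x:R|lebesgue. (p - q) \<bullet> f x) \<le> (LINT x:R|lebesgue. (p - q) \<bullet> q)"
    using set_integral_inner_right(1)[OF fi] set_integral_bounded(1)[OF R(1) borel_measurable_const, of "(p - q) \<bullet> q"]
    by (intro set_integral_mono) auto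
  also have "(LINT x:R|lebesgue. (p - q) \<bullet> q) = \<mu> * ((p - q) \<bullet> q)"
    by (simp add: set_integral_const_lmeasurable[OF R(1)] \<mu>_def)
  also have "(LINT x:R|lebesgue. (p - q) \<bullet> f x) = (p - q) \<bullet> (\<mu> *\<^sub>R p)"
    unfolding eq[symmetric] by (rule set_integral_inner_right(2)[OF fi])
  finally have "\<mu> * ((p - q) \<bullet> (p - q)) \<le> 0" by (simp add: inner_diff_right algebra_simps)
  then have "(p - q) \<bullet> (p - q) \<le> 0" using R(2) by (simp add: mult_le_0_iff \<mu>_def)
  then have "p = q" by (metis inner_gt_zero_iff not_le right_minus_eq)
  then have "p \<in> K_set" unfolding q_def using closest_point_K_set[of p] by simp
  then show thesis using eq that by (simp add: \<mu>_def)
qed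

section \<open>Phases and directors on the blocks\<close>

context spin_system
begin

abbreviation "C0 \<equiv> 2 + 2 * B"

text \<open>The radius is shrunk twice: once because Jensen's inequality on a block provides the
  energy at \<open>(1 - \<tau>) * rad p\<close>, and once more when passing from the envelope to the
  convex hull. The loss per phase is at most
  \<open>1 - (1 - \<tau>)\<^sup>2 \<le> 2 * \<tau>\<close>, which gives the linear term in
  m.\<close>

lemma checkerboard_phases:
  assumes p: "p \<in> K_set" and \<tau>: "0 < \<tau>" "\<tau> < 1" and \<eta>: "0 < \<eta>"
  shows "\<exists>u v s. (\<forall>k. norm (u k) = 1 \<and> norm (v k) = 1 \<and> \<bar>u k \<bullet> v k\<bar> = \<bar>s k\<bar> \<and> \<bar>s k\<bar> \<le> 1) \<and>
    (\<forall>m. norm ((\<Sum>k<m. (1 / 2) *\<^sub>R (tensor (u k) (u k) + tensor (v k) (v k))) - real m *\<^sub>R p)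
      \<le> C0 * sqrt (real m) + 2 * \<tau> * real m) \<and>
    (\<forall>m. (\<Sum>k<m. h \<bar>s k\<bar>) \<le> real m * (g ((1 - \<tau>) * rad p) + \<eta>) + C0 * sqrt (real m))"
proof -
  obtain a where a: "norm a = 1" "p = half_id + rad p *\<^sub>R (tensor a a - half_id)" by (rule K_set_polar[OF p])
  define t X where "t = rad p" and "X = tensor a a - half_id"
  have t: "0 \<le> t" "t \<le> 1" using rad_nonneg rad_le_1[OF p] by (simp_all add: t_def)
  have X: "norm X \<le> 1"
  proof -
    have "norm X * 1 \<le> norm X * sqrt 2" by (intro mult_left_mono) simp_all
    then show ?thesis using norm_tensor_diff_half_id[OF a(1)] by (simp add: X_def mult.commute)
  qed
  have t01: "(1 - \<tau>) * t \<in> {0..1}" using t \<tau> by (intro scaled_01) auto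
  obtain s :: "nat \<Rightarrow> real" where s: "\<And>k. \<bar>s k\<bar> \<le> 1"
    "\<And>m. \<bar>(\<Sum>k<m. s k) - real m * ((1 - \<tau>) * ((1 - \<tau>) * t))\<bar> \<le> C0 * sqrt (real m)"
    "\<And>m. (\<Sum>k<m. h \<bar>s k\<bar>) \<le> real m * (g ((1 - \<tau>) * t) + \<eta>) + C0 * sqrt (real m)"
    using phase_sequence[where h = h, OF h_bound t01 \<tau> \<eta>] by blast
  have "\<exists>u v. norm u = 1 \<and> norm v = 1 \<and> \<bar>u \<bullet> v\<bar> = \<bar>s k\<bar> \<and>
      (1 / 2) *\<^sub>R (tensor u u + tensor v v) = half_id + s k *\<^sub>R X" for k
    using checkerboard_vectors[OF a(1) s(1)[of k]] unfolding X_def by blast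
  then obtain u v where uv: "\<And>k. norm (u k) = 1" "\<And>k. norm (v k) = 1" "\<And>k. \<bar>u k \<bullet> v k\<bar> = \<bar>s k\<bar>"
    "\<And>k. (1 / 2) *\<^sub>R (tensor (u k) (u k) + tensor (v k) (v k)) = half_id + s k *\<^sub>R X" by metis
  have "norm ((\<Sum>k<m. (1 / 2) *\<^sub>R (tensor (u k) (u k) + tensor (v k) (v k))) - real m *\<^sub>R p)
      \<le> C0 * sqrt (real m) + 2 * \<tau> * real m" for m
  proof -
    have "(\<Sum>k<m. (1 / 2) *\<^sub>R (tensor (u k) (u k) + tensor (v k) (v k))) = real m *\<^sub>R half_id + (\<Sum>k<m. s k) *\<^sub>R X"
      unfolding uv(4) sum.distrib scaleR_sum_left[symmetric] by (simp add: sum_constant_scaleR)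
    moreover have "real m *\<^sub>R p = real m *\<^sub>R half_id + (real m * t) *\<^sub>R X"
      by (subst a(2)) (simp add: t_def X_def scaleR_add_right)
    ultimately have "(\<Sum>k<m. (1 / 2) *\<^sub>R (tensor (u k) (u k) + tensor (v k) (v k))) - real m *\<^sub>R p
        = ((\<Sum>k<m. s k) - real m * t) *\<^sub>R X" by (simp add: scaleR_diff_left)
    then have "norm ((\<Sum>k<m. (1 / 2) *\<^sub>R (tensor (u k) (u k) + tensor (v k) (v k))) - real m *\<^sub>R p)
        \<le> \<bar>(\<Sum>k<m. s k) - real m * t\<bar>"
      using mult_left_mono[OF X, of "\<bar>(\<Sum>k<m. s k) - real m * t\<bar>"] by simp
    moreover have "\<bar>real m * ((1 - \<tau>) * ((1 - \<tau>) * t)) - real m * t\<bar> \<le> 2 * \<tau> * real m"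
    proof -
      have "t * (\<tau> * (2 - \<tau>)) \<le> 1 * (\<tau> * 2)" using t \<tau> by (intro mult_mono) auto
      moreover have "0 \<le> t * (\<tau> * (2 - \<tau>))" using t \<tau> by simp
      ultimately have "\<bar>t * (\<tau> * (2 - \<tau>))\<bar> \<le> 2 * \<tau>" by simp
      then have "real m * \<bar>t * (\<tau> * (2 - \<tau>))\<bar> \<le> real m * (2 * \<tau>)" by (intro mult_left_mono) auto
      moreover have "real m * ((1 - \<tau>) * ((1 - \<tau>) * t)) - real m * t = - (real m * (t * (\<tau> * (2 - \<tau>))))"
        by (simp add: algebra_simps)
      ultimately show ?thesis by (simp add: abs_mult mult.commute)
    qed
    ultimately show ?thesis using s(2)[of m] by linarith
  qed
  then show ?thesis using uv(1-3) s(1,3) unfolding t_def by blast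
qed

context
  fixes L m :: nat and \<tau> \<eta> \<epsilon> :: real
  assumes L: "0 < L" "even L" and m: "0 < m" and \<tau>: "0 < \<tau>" "\<tau> < 1" and \<eta>: "0 < \<eta>" and \<epsilon>: "0 < \<epsilon>"
begin

abbreviation "pc \<equiv> piece L m \<epsilon>"
abbreviation "vol \<equiv> \<epsilon>\<^sup>2 * ((real L)\<^sup>2 * real m)"

text \<open>Jensen's inequality by a support plane at the mean p, whose linear part integrates to
  zero against the deviation of Q from p. The slope is taken at a radius below 1, where it is
  finite, and this is why the smaller side carries the factor \<open>1 - \<tau>\<close>.\<close>

lemma block_mean:
  shows "\<exists>p. p \<in> K_set \<and> (LINT x:pc \<kappa>|lebesgue. Q x) = vol *\<^sub>R p \<and>
    vol * g ((1 - \<tau>) * rad p) \<le> (LINT x:pc \<kappa>|lebesgue. g (rad (Q x)))"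
proof -
  note R = lmeasurable_piece[OF L(1) m \<epsilon>, of \<kappa>] and vol = measure_piece[OF L(1) m \<epsilon>, of \<kappa>]
  have pos: "0 < measure lebesgue (pc \<kappa>)" unfolding vol using L m \<epsilon> by simp
  obtain p where p: "p \<in> K_set" "(LINT x:pc \<kappa>|lebesgue. Q x) = measure lebesgue (pc \<kappa>) *\<^sub>R p"
    by (rule mean_in_K_set[OF R pos Q_measurable Q_K])
  define D where "D = (right_slope g ((1 - \<tau>) * rad p) * sqrt 2) *\<^sub>R sgn (p - half_id)"
  define c where "c = g ((1 - \<tau>) * rad p) - D \<bullet> p"
  have Qi: "set_integrable lebesgue (pc \<kappa>) Q"
    by (rule set_integral_bounded(1)[OF R Q_measurable]) (rule norm_K_set_le[OF Q_K])
  have ci: "set_integrable lebesgue (pc \<kappa>) (\<lambda>_. c)"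
    by (rule set_integral_bounded(1)[OF R borel_measurable_const]) (rule order_refl)
  have gi: "set_integrable lebesgue (pc \<kappa>) (\<lambda>x. g (rad (Q x)))"
    using g_rad_measurable[of 1] g_rad_bound[of 1] by (intro set_integral_bounded(1)[OF R, of _ B]) auto
  have "c + D \<bullet> Q x \<le> g (rad (Q x))" for x
    using support_plane[OF \<tau> p(1) Q_K[of x]] unfolding D_def[symmetric] c_def by (simp add: inner_diff_right)
  then have "(LINT x:pc \<kappa>|lebesgue. c + D \<bullet> Q x) \<le> (LINT x:pc \<kappa>|lebesgue. g (rad (Q x)))"
    by (intro set_integral_mono set_integral_add(1) ci gi set_integral_inner_right(1) Qi)
  also have "(LINT x:pc \<kappa>|lebesgue. c + D \<bullet> Q x) = (LINT x:pc \<kappa>|lebesgue. c) + (LINT x:pc \<kappa>|lebesgue. D \<bullet> Q x)"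
    by (intro set_integral_add(2) ci set_integral_inner_right(1) Qi)
  also have "(LINT x:pc \<kappa>|lebesgue. c) = vol * c"
    by (simp add: set_integral_const_lmeasurable[OF R] vol)
  also have "(LINT x:pc \<kappa>|lebesgue. D \<bullet> Q x) = vol * (D \<bullet> p)"
    unfolding set_integral_inner_right(2)[OF Qi] p(2) vol by simp
  also have "vol * c + vol * (D \<bullet> p) = vol * g ((1 - \<tau>) * rad p)" by (simp add: c_def algebra_simps)
  finally show ?thesis using p unfolding vol by blast
qed

text \<open>Errors per unit area. The square root comes from averaging m phases and
  \<open>2 * \<tau>\<close> from the double shrinking. In the energy the four steps multiply \<eta>
  and the averaging error, and \<open>8 * B / real L\<close> is four steps times an excess of
  \<open>2 * B\<close> on a fraction 1 / L of the points.\<close>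

abbreviation "mean_error \<equiv> C0 / sqrt (real m) + 2 * \<tau>"
abbreviation "energy_error \<equiv> 4 * \<eta> + 4 * C0 / sqrt (real m) + 8 * B / real L"

lemma sqrt_m: "C0 * sqrt (real m) = real m * (C0 / sqrt (real m))"
proof -
  have "real m * (C0 / sqrt (real m)) = C0 * (real m / sqrt (real m))" by simp
  then show ?thesis by (simp only: real_div_sqrt[OF of_nat_0_le_iff])
qed

text \<open>Blocks are filled independently of each other and nothing is matched across their sides,
  because bonds leaving a square are rare. Bond energies are raised by B to be nonnegative, so that
  they can later be summed over whole blocks that reach beyond \<Omega>.\<close>

lemma recovery_directors:
  obtains w where "\<And>i. norm (w i) = 1"
    "\<And>\<kappa>. norm ((LINT x:pc \<kappa>|lebesgue. tensor (w (idx \<epsilon> x)) (w (idx \<epsilon> x))) - (LINT x:pc \<kappa>|lebesgue. Q x)) \<le> mean_error * vol"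
    "\<And>\<kappa>. (\<Sum>i\<in>block L m \<kappa>. \<Sum>e\<in>unit_steps. \<epsilon>\<^sup>2 * (h \<bar>w i \<bullet> w (i + e)\<bar> + B))
      \<le> 4 * (LINT x:pc \<kappa>|lebesgue. g (rad (Q x))) + 4 * B * vol + energy_error * vol"
proof -
  obtain p where p: "\<And>\<kappa>. p \<kappa> \<in> K_set" "\<And>\<kappa>. (LINT x:pc \<kappa>|lebesgue. Q x) = vol *\<^sub>R p \<kappa>"
    "\<And>\<kappa>. vol * g ((1 - \<tau>) * rad (p \<kappa>)) \<le> (LINT x:pc \<kappa>|lebesgue. g (rad (Q x)))"
    using block_mean by metis
  have "\<forall>\<kappa>. \<exists>u v s. (\<forall>k. norm (u k) = 1 \<and> norm (v k) = 1 \<and> \<bar>u k \<bullet> v k\<bar> = \<bar>s k\<bar> \<and> \<bar>s k\<bar> \<le> 1) \<and>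
    norm ((\<Sum>k<m. (1 / 2) *\<^sub>R (tensor (u k) (u k) + tensor (v k) (v k))) - real m *\<^sub>R p \<kappa>)
      \<le> C0 * sqrt (real m) + 2 * \<tau> * real m \<and>
    (\<Sum>k<m. h \<bar>s k\<bar>) \<le> real m * (g ((1 - \<tau>) * rad (p \<kappa>)) + \<eta>) + C0 * sqrt (real m)"
    (is "\<forall>\<kappa>. \<exists>u v s. ?P \<kappa> u v s")
    using checkerboard_phases[OF p(1) \<tau> \<eta>] by blast
  then obtain u where "\<forall>\<kappa>. \<exists>v s. ?P \<kappa> (u \<kappa>) v s" by (rule choice[THEN exE])
  then obtain v where "\<forall>\<kappa>. \<exists>s. ?P \<kappa> (u \<kappa>) (v \<kappa>) s" by (rule choice[THEN exE])
  then obtain s where uvs: "\<forall>\<kappa>. ?P \<kappa> (u \<kappa>) (v \<kappa>) (s \<kappa>)" by (rule choice[THEN exE])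
  define w where "w i = (if bpar L i then u (bkey L m i) (bphase L m i) else v (bkey L m i) (bphase L m i))" for i
  have u1: "norm (u \<kappa> k) = 1" and v1: "norm (v \<kappa> k) = 1" and uv: "\<bar>u \<kappa> k \<bullet> v \<kappa> k\<bar> = \<bar>s \<kappa> k\<bar>"
    and s1: "\<bar>s \<kappa> k\<bar> \<le> 1" for \<kappa> k
    using uvs by blast+
  have mean: "norm ((\<Sum>k<m. (1 / 2) *\<^sub>R (tensor (u \<kappa> k) (u \<kappa> k) + tensor (v \<kappa> k) (v \<kappa> k))) - real m *\<^sub>R p \<kappa>)
      \<le> C0 * sqrt (real m) + 2 * \<tau> * real m"
    and energy: "(\<Sum>k<m. h \<bar>s \<kappa> k\<bar>) \<le> real m * (g ((1 - \<tau>) * rad (p \<kappa>)) + \<eta>) + C0 * sqrt (real m)" for \<kappa>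
    using uvs by blast+
  have nn: "0 \<le> \<epsilon>\<^sup>2 * (real L)\<^sup>2" by simp
  have w1: "norm (w i) = 1" for i by (simp add: w_def u1 v1)
  show thesis
  proof (rule that[of w])
    fix \<kappa>
    have "(LINT x:pc \<kappa>|lebesgue. tensor (w (idx \<epsilon> x)) (w (idx \<epsilon> x))) = (\<Sum>i\<in>block L m \<kappa>. \<epsilon>\<^sup>2 *\<^sub>R tensor (w i) (w i))"
      unfolding piece_def[OF L(1) m]
      by (rule set_integral_cells(2)[OF finite_block[OF L(1) m] block_lattice[OF L(1) m] \<epsilon>, where F = "\<lambda>i. tensor (w i) (w i)"])
    also have "\<dots> = (\<Sum>i\<in>block L m \<kappa>. if bpar L i then \<epsilon>\<^sup>2 *\<^sub>R tensor (u \<kappa> (bphase L m i)) (u \<kappa> (bphase L m i))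
        else \<epsilon>\<^sup>2 *\<^sub>R tensor (v \<kappa> (bphase L m i)) (v \<kappa> (bphase L m i)))"
      by (intro sum.cong refl) (auto simp: w_def block_def)
    also have "\<dots> = (real L)\<^sup>2 *\<^sub>R (\<Sum>k<m. (1 / 2) *\<^sub>R (\<epsilon>\<^sup>2 *\<^sub>R tensor (u \<kappa> k) (u \<kappa> k) + \<epsilon>\<^sup>2 *\<^sub>R tensor (v \<kappa> k) (v \<kappa> k)))"
      by (rule sum_block_checkerboard[OF L(1) m L(2)])
    also have "\<dots> = (\<epsilon>\<^sup>2 * (real L)\<^sup>2) *\<^sub>R (\<Sum>k<m. (1 / 2) *\<^sub>R (tensor (u \<kappa> k) (u \<kappa> k) + tensor (v \<kappa> k) (v \<kappa> k)))"
      by (simp add: scaleR_sum_right scaleR_add_right mult_ac)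
    finally have "(LINT x:pc \<kappa>|lebesgue. tensor (w (idx \<epsilon> x)) (w (idx \<epsilon> x))) - (LINT x:pc \<kappa>|lebesgue. Q x)
        = (\<epsilon>\<^sup>2 * (real L)\<^sup>2) *\<^sub>R ((\<Sum>k<m. (1 / 2) *\<^sub>R (tensor (u \<kappa> k) (u \<kappa> k) + tensor (v \<kappa> k) (v \<kappa> k))) - real m *\<^sub>R p \<kappa>)"
      unfolding p(2) by (simp add: scaleR_diff_right mult_ac)
    also have "norm \<dots> \<le> (\<epsilon>\<^sup>2 * (real L)\<^sup>2) * (C0 * sqrt (real m) + 2 * \<tau> * real m)"
      unfolding norm_scaleR abs_of_nonneg[OF nn] by (rule mult_left_mono[OF mean nn])
    also have "\<dots> = mean_error * vol" unfolding sqrt_m by (simp add: algebra_simps)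
    finally show "norm ((LINT x:pc \<kappa>|lebesgue. tensor (w (idx \<epsilon> x)) (w (idx \<epsilon> x))) - (LINT x:pc \<kappa>|lebesgue. Q x)) \<le> mean_error * vol" .
    \<comment> \<open>A bond inside a square has exactly the energy of its phase; any other bond
      exceeds it by at most \<open>2 * B\<close>, as both values lie in [-B, B].\<close>
    have bond: "\<epsilon>\<^sup>2 * (h \<bar>w i \<bullet> w (i + e)\<bar> + B) \<le> \<epsilon>\<^sup>2 * (h \<bar>s \<kappa> (bphase L m i)\<bar> + B)
        + (if inside_step L m e i then 0 else \<epsilon>\<^sup>2 * (2 * B))" if i: "i \<in> block L m \<kappa>" for i e
    proof (cases "inside_step L m e i")
      case True
      then have "\<bar>w i \<bullet> w (i + e)\<bar> = \<bar>u \<kappa> (bphase L m i) \<bullet> v \<kappa> (bphase L m i)\<bar>"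
        using i unfolding inside_step_def[OF L(1) m] by (auto simp: w_def block_def inner_commute)
      also have "\<dots> = \<bar>s \<kappa> (bphase L m i)\<bar>" by (rule uv)
      finally show ?thesis using True by simp
    next
      case False
      have "\<bar>w i \<bullet> w (i + e)\<bar> \<le> 1" using Cauchy_Schwarz_ineq2[of "w i" "w (i + e)"] w1 by simp
      then have "h \<bar>w i \<bullet> w (i + e)\<bar> \<le> B" using h_bound[of "\<bar>w i \<bullet> w (i + e)\<bar>"] by auto
      moreover have "- B \<le> h \<bar>s \<kappa> (bphase L m i)\<bar>"
        using h_bound[of "\<bar>s \<kappa> (bphase L m i)\<bar>"] s1[of \<kappa> "bphase L m i"] by (simp add: abs_le_iff[of "h _"])
      ultimately have "h \<bar>w i \<bullet> w (i + e)\<bar> + B \<le> (h \<bar>s \<kappa> (bphase L m i)\<bar> + B) + 2 * B" by linarith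
      then have "\<epsilon>\<^sup>2 * (h \<bar>w i \<bullet> w (i + e)\<bar> + B) \<le> \<epsilon>\<^sup>2 * ((h \<bar>s \<kappa> (bphase L m i)\<bar> + B) + 2 * B)"
        by (intro mult_left_mono) auto
      then show ?thesis using False by (simp add: distrib_left)
    qed
    have step: "(\<Sum>i\<in>block L m \<kappa>. \<epsilon>\<^sup>2 * (h \<bar>w i \<bullet> w (i + e)\<bar> + B))
        \<le> \<epsilon>\<^sup>2 * (real L)\<^sup>2 * ((\<Sum>k<m. h \<bar>s \<kappa> k\<bar>) + real m * B) + \<epsilon>\<^sup>2 * (2 * B) * (real L * real m)"
      if e: "e \<in> unit_steps" for e
    proof -
      have "(\<Sum>i\<in>block L m \<kappa>. \<epsilon>\<^sup>2 * (h \<bar>w i \<bullet> w (i + e)\<bar> + B))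
          \<le> (\<Sum>i\<in>block L m \<kappa>. \<epsilon>\<^sup>2 * (h \<bar>s \<kappa> (bphase L m i)\<bar> + B) + (if inside_step L m e i then 0 else \<epsilon>\<^sup>2 * (2 * B)))"
        by (intro sum_mono bond)
      also have "\<dots> = (\<Sum>i\<in>block L m \<kappa>. \<epsilon>\<^sup>2 * (h \<bar>s \<kappa> (bphase L m i)\<bar> + B))
          + (\<Sum>i\<in>block L m \<kappa>. if inside_step L m e i then 0 else \<epsilon>\<^sup>2 * (2 * B))"
        by (rule sum.distrib)
      also have "(\<Sum>i\<in>block L m \<kappa>. \<epsilon>\<^sup>2 * (h \<bar>s \<kappa> (bphase L m i)\<bar> + B)) = (real L)\<^sup>2 * (\<Sum>k<m. \<epsilon>\<^sup>2 * (h \<bar>s \<kappa> k\<bar> + B))"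
        by (rule sum_block_phase[OF L(1) m, of "\<lambda>k. \<epsilon>\<^sup>2 * (h \<bar>s \<kappa> k\<bar> + B)"])
      also have "\<dots> = \<epsilon>\<^sup>2 * (real L)\<^sup>2 * ((\<Sum>k<m. h \<bar>s \<kappa> k\<bar>) + real m * B)"
        by (simp add: sum.distrib flip: sum_distrib_left)
      also have "(\<Sum>i\<in>block L m \<kappa>. if inside_step L m e i then 0 else \<epsilon>\<^sup>2 * (2 * B))
          = \<epsilon>\<^sup>2 * (2 * B) * real (card {i \<in> block L m \<kappa>. \<not> inside_step L m e i})"
      proof -
        have "(\<Sum>i\<in>block L m \<kappa>. if inside_step L m e i then 0 else \<epsilon>\<^sup>2 * (2 * B))
            = (\<Sum>i\<in>block L m \<kappa>. if \<not> inside_step L m e i then \<epsilon>\<^sup>2 * (2 * B) else 0)"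
          by (intro sum.cong) auto
        then show ?thesis by (simp flip: sum.inter_filter[OF finite_block[OF L(1) m]])
      qed
      also have "\<dots> \<le> \<epsilon>\<^sup>2 * (2 * B) * (real L * real m)"
      proof (rule mult_left_mono)
        show "real (card {i \<in> block L m \<kappa>. \<not> inside_step L m e i}) \<le> real L * real m"
          using card_crossing_le[OF L(1) m e, of \<kappa>] by (simp only: of_nat_le_iff flip: of_nat_mult)
      qed (use B_nonneg in simp)
      finally show ?thesis by simp
    qed
    have "(\<Sum>i\<in>block L m \<kappa>. \<Sum>e\<in>unit_steps. \<epsilon>\<^sup>2 * (h \<bar>w i \<bullet> w (i + e)\<bar> + B))
        = (\<Sum>e\<in>unit_steps. \<Sum>i\<in>block L m \<kappa>. \<epsilon>\<^sup>2 * (h \<bar>w i \<bullet> w (i + e)\<bar> + B))" by (rule sum.swap)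
    also have "\<dots> \<le> (\<Sum>e\<in>unit_steps. \<epsilon>\<^sup>2 * (real L)\<^sup>2 * ((\<Sum>k<m. h \<bar>s \<kappa> k\<bar>) + real m * B) + \<epsilon>\<^sup>2 * (2 * B) * (real L * real m))"
      by (rule sum_mono[OF step])
    also have "\<dots> = 4 * (\<epsilon>\<^sup>2 * (real L)\<^sup>2 * ((\<Sum>k<m. h \<bar>s \<kappa> k\<bar>) + real m * B) + \<epsilon>\<^sup>2 * (2 * B) * (real L * real m))"
      by (simp add: card_unit_steps)
    also have "\<dots> \<le> 4 * (\<epsilon>\<^sup>2 * (real L)\<^sup>2 * (real m * (g ((1 - \<tau>) * rad (p \<kappa>)) + \<eta>) + C0 * sqrt (real m) + real m * B)
        + \<epsilon>\<^sup>2 * (2 * B) * (real L * real m))"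
      using energy by (intro mult_left_mono add_right_mono) auto
    also have "\<dots> = 4 * (vol * g ((1 - \<tau>) * rad (p \<kappa>))) + 4 * B * vol + energy_error * vol"
    proof -
      have "\<epsilon>\<^sup>2 * (2 * B) * (real L * real m) = 2 * B / real L * vol"
        using L(1) by (simp add: power2_eq_square field_simps)
      then show ?thesis unfolding sqrt_m by (simp add: algebra_simps)
    qed
    also have "\<dots> \<le> 4 * (LINT x:pc \<kappa>|lebesgue. g (rad (Q x))) + 4 * B * vol + energy_error * vol"
      using p(3) by (intro add_right_mono mult_left_mono) auto
    finally show "(\<Sum>i\<in>block L m \<kappa>. \<Sum>e\<in>unit_steps. \<epsilon>\<^sup>2 * (h \<bar>w i \<bullet> w (i + e)\<bar> + B))
      \<le> 4 * (LINT x:pc \<kappa>|lebesgue. g (rad (Q x))) + 4 * B * vol + energy_error * vol" .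
  qed (rule w1)
qed

end

end

section \<open>Assembly of the blocks over the domain\<close>

lemma countable_int_lattice: "countable int_lattice"
proof (rule countable_subset)
  show "int_lattice \<subseteq> range (\<lambda>(a, b). vector [of_int a, of_int b])"
  proof
    fix i assume i: "i \<in> int_lattice"
    obtain a b where "i = vector [of_int a, of_int b]" by (rule lattice_cases[OF i])
    then show "i \<in> range (\<lambda>(a, b). vector [of_int a, of_int b])" by (intro image_eqI[of _ _ "(a, b)"]) auto
  qed
qed simp

text \<open>The index takes countably many values, each on a Borel cell, so it is measurable into a
  discrete space and F may be arbitrary.\<close>

lemma measurable_cellwise: "(\<lambda>x. F (idx \<epsilon> x)) \<in> borel_measurable lebesgue"
proof -
  have "idx \<epsilon> \<in> lebesgue \<rightarrow>\<^sub>M count_space int_lattice"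
  proof (rule measurable_count_space_eq_countable[OF countable_int_lattice, THEN iffD2], intro conjI ballI)
    fix i assume "i \<in> int_lattice"
    have "idx \<epsilon> -` {i} \<inter> space lebesgue = cells \<epsilon> {i}" by (auto simp: cells_def)
    then show "idx \<epsilon> -` {i} \<inter> space lebesgue \<in> sets lebesgue"
      using cell_borel[of \<epsilon> i] by (simp only: sets_completionI_sets sets_lborel)
  qed simp
  then show ?thesis
    by (rule measurable_compose) simp
qed

context spin_system
begin

context
  fixes L m :: nat and \<tau> \<eta> \<epsilon> :: real
  assumes L: "0 < L" "even L" and m: "0 < m" and \<tau>: "0 < \<tau>" "\<tau> < 1" and \<eta>: "0 < \<eta>" and \<epsilon>: "0 < \<epsilon>"
begin

abbreviation "diam \<equiv> (real L + real m * real L + 2) * \<epsilon>"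

definition keys :: "(int \<times> int) set" where
  "keys = (\<lambda>x. bkey L m (idx \<epsilon> x)) ` \<Omega>"

text \<open>Whole blocks are kept because the estimates hold block by block. The overhang lies in a
  boundary layer as wide as a block, and Q has values in K there too.\<close>

definition cover :: "(real^2) set" where
  "cover = (\<Union>\<kappa>\<in>keys. piece L m \<epsilon> \<kappa>)"

lemma finite_keys: "finite keys"
proof -
  have "keys = bkey L m ` idx \<epsilon> ` \<Omega>" by (auto simp: keys_def)
  then show ?thesis using finite_idx_image[OF bounded_\<Omega> \<epsilon>] by simp
qed

lemma cover_lmeasurable: "cover \<in> lmeasurable"
  unfolding cover_def using finite_keys lmeasurable_piece[OF L(1) m \<epsilon>] by (intro fmeasurable.finite_UN)

lemma \<Omega>_subset_cover: "\<Omega> \<subseteq> cover"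
  by (auto simp: cover_def keys_def mem_piece_iff[OF L(1) m])

lemma cover_near:
  assumes "y \<in> cover"
  shows "\<exists>x\<in>\<Omega>. dist y x \<le> diam"
proof -
  obtain x where x: "x \<in> \<Omega>" "y \<in> piece L m \<epsilon> (bkey L m (idx \<epsilon> x))" using assms by (auto simp: cover_def keys_def)
  moreover have "x \<in> piece L m \<epsilon> (bkey L m (idx \<epsilon> x))" by (simp add: mem_piece_iff[OF L(1) m])
  ultimately show ?thesis using dist_piece_le[OF L(1) m \<epsilon>] by blast
qed

lemma cover_Diff: "measure lebesgue (cover - \<Omega>) \<le> bdry diam"
proof (rule measure_mono_fmeasurable)
  show "cover - \<Omega> \<subseteq> bdry_nbhd \<Omega> diam"
  proof
    fix y assume y: "y \<in> cover - \<Omega>"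
    then obtain x where "x \<in> \<Omega>" "dist y x \<le> diam" using cover_near[of y] by blast
    then show "y \<in> bdry_nbhd \<Omega> diam"
      using y by (intro bdry_nbhd_crossing[of x \<Omega> y]) (auto intro: order_trans[OF zero_le_dist])
  qed
qed (use lmeasurable_bdry_nbhd[OF bounded_\<Omega>] cover_lmeasurable \<Omega>_sets in \<open>auto intro: fmeasurableD\<close>)

lemma cover_integral_diff:
  fixes f :: "real^2 \<Rightarrow> real"
  assumes f: "f \<in> borel_measurable lebesgue" "\<And>x. x \<in> cover \<Longrightarrow> norm (f x) \<le> C" and C: "0 \<le> C"
  shows "\<bar>(LINT x:cover|lebesgue. f x) - (LINT x:\<Omega>|lebesgue. f x)\<bar> \<le> C * bdry diam"
proof -
  have D: "cover - \<Omega> \<in> lmeasurable" using cover_lmeasurable \<Omega>_sets by (intro fmeasurable_Diff)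
  have "(LINT x:(\<Omega> \<union> (cover - \<Omega>))|lebesgue. f x) = (LINT x:\<Omega>|lebesgue. f x) + (LINT x:(cover - \<Omega>)|lebesgue. f x)"
    using f(2) \<Omega>_subset_cover
    by (intro set_integral_Un set_integral_bounded(1)[OF \<Omega>_lmeasurable f(1), of C] set_integral_bounded(1)[OF D f(1), of C]) auto
  moreover have "\<Omega> \<union> (cover - \<Omega>) = cover" using \<Omega>_subset_cover by blast
  moreover have "norm (LINT x:(cover - \<Omega>)|lebesgue. f x) \<le> C * measure lebesgue (cover - \<Omega>)"
    by (rule set_integral_bounded(2)[OF D f(1)]) (use f(2) in blast)
  moreover have "C * measure lebesgue (cover - \<Omega>) \<le> C * bdry diam" using cover_Diff C by (rule mult_left_mono)
  ultimately show ?thesis by simp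
qed

lemma cover_integral:
  fixes f :: "real^2 \<Rightarrow> real"
  assumes f: "f \<in> borel_measurable lebesgue" "\<And>x. x \<in> cover \<Longrightarrow> norm (f x) \<le> C"
  shows "(LINT x:cover|lebesgue. f x) = (\<Sum>\<kappa>\<in>keys. LINT x:piece L m \<epsilon> \<kappa>|lebesgue. f x)"
  unfolding cover_def
proof (rule set_integral_finite_Union[OF finite_keys disjoint_pieces[OF L(1) m]])
  fix \<kappa> assume \<kappa>: "\<kappa> \<in> keys"
  show "set_integrable lebesgue (piece L m \<epsilon> \<kappa>) f"
    by (rule set_integral_bounded(1)[OF lmeasurable_piece[OF L(1) m \<epsilon>] f(1), of _ C])
       (use f(2) \<kappa> in \<open>auto simp: cover_def\<close>)
  show "piece L m \<epsilon> \<kappa> \<in> sets lebesgue" by (rule fmeasurableD[OF lmeasurable_piece[OF L(1) m \<epsilon>]])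
qed

lemma measure_cover:
  "real (card keys) * (\<epsilon>\<^sup>2 * ((real L)\<^sup>2 * real m)) = measure lebesgue cover"
  "measure lebesgue cover \<le> measure lebesgue \<Omega> + bdry diam"
proof -
  have "(LINT x:cover|lebesgue. (1::real)) = (\<Sum>\<kappa>\<in>keys. LINT x:piece L m \<epsilon> \<kappa>|lebesgue. 1)"
    by (rule cover_integral[of _ 1]) auto
  then show "real (card keys) * (\<epsilon>\<^sup>2 * ((real L)\<^sup>2 * real m)) = measure lebesgue cover"
    by (simp add: set_integral_const_lmeasurable[OF cover_lmeasurable]
        set_integral_const_lmeasurable[OF lmeasurable_piece[OF L(1) m \<epsilon>]] measure_piece[OF L(1) m \<epsilon>])
  show "measure lebesgue cover \<le> measure lebesgue \<Omega> + bdry diam"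
    using cover_integral_diff[of "\<lambda>_. 1" 1]
    by (simp add: set_integral_const_lmeasurable[OF cover_lmeasurable] set_integral_const_lmeasurable[OF \<Omega>_lmeasurable])
qed

lemma diam_ge: "3 * \<epsilon> \<le> diam"
proof -
  have "1 \<le> real L" "0 \<le> real m * real L" using L(1) by simp_all
  then have "3 \<le> real L + real m * real L + 2" by linarith
  then show ?thesis using \<epsilon> by (intro mult_right_mono) auto
qed

context
  fixes w :: "real^2 \<Rightarrow> real^2"
  assumes w1: "\<And>i. norm (w i) = 1"
    and mean: "\<And>\<kappa>. norm ((LINT x:piece L m \<epsilon> \<kappa>|lebesgue. tensor (w (idx \<epsilon> x)) (w (idx \<epsilon> x)))
      - (LINT x:piece L m \<epsilon> \<kappa>|lebesgue. Q x)) \<le> mean_error m \<tau> * (\<epsilon>\<^sup>2 * ((real L)\<^sup>2 * real m))"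
    and energy: "\<And>\<kappa>. (\<Sum>i\<in>block L m \<kappa>. \<Sum>e\<in>unit_steps. \<epsilon>\<^sup>2 * (h \<bar>w i \<bullet> w (i + e)\<bar> + B))
      \<le> 4 * (LINT x:piece L m \<epsilon> \<kappa>|lebesgue. g (rad (Q x))) + 4 * B * (\<epsilon>\<^sup>2 * ((real L)\<^sup>2 * real m))
        + energy_error L m \<eta> * (\<epsilon>\<^sup>2 * ((real L)\<^sup>2 * real m))"
begin

definition "field x = tensor (w (idx \<epsilon> x)) (w (idx \<epsilon> x))"

lemma field_measurable: "field \<in> borel_measurable lebesgue"
  unfolding field_def[abs_def] by (rule measurable_cellwise)

lemma field_S1: "field x \<in> S1_tensor"
  using w1 by (auto simp: field_def S1_tensor_def)

lemma field_norm: "norm (field x - Q x) \<le> 2"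
  using norm_triangle_ineq4[of "field x" "Q x"] norm_K_set_le[OF Q_K[of x]]
    norm_K_set_le[OF subsetD[OF S1_tensor_subset_K_set field_S1[of x]]] by linarith

lemma field_diff_measurable: "(\<lambda>x. field x - Q x) \<in> borel_measurable lebesgue"
  by (intro borel_measurable_diff field_measurable Q_measurable)

lemma director_field_field: "director_field \<epsilon> \<Omega> field w"
  unfolding director_field_def
proof (intro bexI[of _ field] conjI ballI)
  show "field \<in> C_eps \<epsilon> \<Omega>"
    unfolding C_eps_def using field_S1 \<epsilon>
    by (auto simp: lattice_pts_iff mem_scaled_unit_cell_iff field_def)
  show "norm (w i) = 1" for i by (rule w1)
  show "field (\<epsilon> *\<^sub>R i) = tensor (w i) (w i)" if "i \<in> lattice_pts \<epsilon> \<Omega>" for i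
    using that \<epsilon> by (simp add: lattice_pts_iff field_def)
qed simp

lemma w_energy_bound: "\<bar>h \<bar>w i \<bullet> w j\<bar>\<bar> \<le> B"
  using Cauchy_Schwarz_ineq2[of "w i" "w j"] w1 by (intro h_bound) simp

text \<open>Raising each bond by B allows the sum to be enlarged to all points of the blocks; the
  added amount is then subtracted for the bonds that are present. Of the coefficient
  \<open>12 * B\<close>, one third comes from the integral over the overhang, one third from the
  area of the overhang, and one third from the part of \<Omega> missed by the inner cells.\<close>

lemma field_energy:
  "(\<Sum>(i, j)\<in>neighbours \<epsilon> \<Omega>. \<epsilon>\<^sup>2 * h \<bar>w i \<bullet> w j\<bar>)
    \<le> 4 * limit_density + energy_error L m \<eta> * measure lebesgue \<Omega> + (12 * B + energy_error L m \<eta>) * bdry diam"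
proof -
  let ?I = "lattice_pts \<epsilon> \<Omega>" and ?J = "inner_pts \<epsilon> \<Omega>" and ?v = "\<epsilon>\<^sup>2 * ((real L)\<^sup>2 * real m)"
  let ?H = "\<lambda>i e. \<epsilon>\<^sup>2 * (h \<bar>w i \<bullet> w (i + e)\<bar> + B)"
  define \<theta> where "\<theta> = energy_error L m \<eta>"
  have \<theta>: "0 \<le> \<theta>" unfolding \<theta>_def using \<eta> B_nonneg by simp
  have fin: "finite ?I" by (rule finite_lattice_pts[OF bounded_\<Omega> \<epsilon>])
  have H: "0 \<le> ?H i e" for i e
    using w_energy_bound[of i "i + e"] by (intro mult_nonneg_nonneg) (auto simp: abs_le_iff)
  have "(\<Sum>(i, j)\<in>neighbours \<epsilon> \<Omega>. \<epsilon>\<^sup>2 * h \<bar>w i \<bullet> w j\<bar>)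
      = (\<Sum>i\<in>?I. \<Sum>e\<in>unit_steps. if i + e \<in> ?I then \<epsilon>\<^sup>2 * h \<bar>w i \<bullet> w (i + e)\<bar> else 0)"
    by (rule sum_neighbours[OF fin])
  \<comment> \<open>An absent bond contributes 0 on the left and its nonnegative raised energy on
    the right.\<close>
  also have "\<dots> \<le> (\<Sum>i\<in>?I. \<Sum>e\<in>unit_steps. ?H i e - (if i + e \<in> ?I then \<epsilon>\<^sup>2 * B else 0))"
    using H by (intro sum_mono) (auto simp: distrib_left)
  also have "\<dots> = (\<Sum>i\<in>?I. \<Sum>e\<in>unit_steps. ?H i e) - (\<Sum>i\<in>?I. \<Sum>e\<in>unit_steps. if i + e \<in> ?I then \<epsilon>\<^sup>2 * B else 0)"
    by (simp only: sum_subtractf)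
  finally have 1: "(\<Sum>(i, j)\<in>neighbours \<epsilon> \<Omega>. \<epsilon>\<^sup>2 * h \<bar>w i \<bullet> w j\<bar>)
      \<le> (\<Sum>i\<in>?I. \<Sum>e\<in>unit_steps. ?H i e) - (\<Sum>i\<in>?I. \<Sum>e\<in>unit_steps. if i + e \<in> ?I then \<epsilon>\<^sup>2 * B else 0)" .
  have "(\<Sum>i\<in>?I. \<Sum>e\<in>unit_steps. ?H i e) \<le> (\<Sum>i\<in>(\<Union>\<kappa>\<in>keys. block L m \<kappa>). \<Sum>e\<in>unit_steps. ?H i e)"
  proof (rule sum_mono2)
    show "finite (\<Union>\<kappa>\<in>keys. block L m \<kappa>)" using finite_keys finite_block[OF L(1) m] by blast
    show "?I \<subseteq> (\<Union>\<kappa>\<in>keys. block L m \<kappa>)"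
    proof
      fix i assume "i \<in> ?I"
      then have i: "i \<in> int_lattice" "\<epsilon> *\<^sub>R i \<in> \<Omega>" unfolding lattice_pts_iff by blast+
      then have "bkey L m i \<in> keys" unfolding keys_def
        using idx_scaled[OF i(1) \<epsilon>] by (intro image_eqI[of _ _ "\<epsilon> *\<^sub>R i"]) simp_all
      then show "i \<in> (\<Union>\<kappa>\<in>keys. block L m \<kappa>)" using i(1) by (auto simp: block_def)
    qed
  qed (intro sum_nonneg H)
  also have "\<dots> = (\<Sum>\<kappa>\<in>keys. \<Sum>i\<in>block L m \<kappa>. \<Sum>e\<in>unit_steps. ?H i e)"
    using finite_keys finite_block[OF L(1) m] by (intro sum.UNION_disjoint) (auto simp: block_def)
  also have "\<dots> \<le> (\<Sum>\<kappa>\<in>keys. 4 * (LINT x:piece L m \<epsilon> \<kappa>|lebesgue. g (rad (Q x))) + 4 * B * ?v + \<theta> * ?v)"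
    unfolding \<theta>_def by (intro sum_mono energy)
  also have "\<dots> = 4 * (\<Sum>\<kappa>\<in>keys. LINT x:piece L m \<epsilon> \<kappa>|lebesgue. g (rad (Q x))) + (4 * B + \<theta>) * (real (card keys) * ?v)"
    by (simp add: sum.distrib sum_distrib_left algebra_simps)
  also have "(\<Sum>\<kappa>\<in>keys. LINT x:piece L m \<epsilon> \<kappa>|lebesgue. g (rad (Q x))) = (LINT x:cover|lebesgue. g (rad (Q x)))"
    using g_rad_measurable[of 1] g_rad_bound[of 1] by (intro cover_integral[symmetric, of _ B]) auto
  finally have 2: "(\<Sum>i\<in>?I. \<Sum>e\<in>unit_steps. ?H i e)
      \<le> 4 * (LINT x:cover|lebesgue. g (rad (Q x))) + (4 * B + \<theta>) * measure lebesgue cover"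
    unfolding measure_cover(1) .
  have "\<bar>(LINT x:cover|lebesgue. g (rad (Q x))) - (LINT x:\<Omega>|lebesgue. g (rad (Q x)))\<bar> \<le> B * bdry diam"
    using g_rad_measurable[of 1] g_rad_bound[of 1] by (intro cover_integral_diff B_nonneg) auto
  then have 3: "(LINT x:cover|lebesgue. g (rad (Q x))) \<le> limit_density + B * bdry diam"
    unfolding limit_density_def by linarith
  have 4: "(4 * B + \<theta>) * measure lebesgue cover \<le> (4 * B + \<theta>) * (measure lebesgue \<Omega> + bdry diam)"
    using measure_cover(2) B_nonneg \<theta> by (intro mult_left_mono) auto
  \<comment> \<open>The subtracted terms are counted from below: inner points carry all four bonds,
    and their cells fill \<Omega> up to the layer.\<close>
  have "(\<Sum>i\<in>?J. \<Sum>e\<in>unit_steps. if i + e \<in> ?I then \<epsilon>\<^sup>2 * B else 0)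
      \<le> (\<Sum>i\<in>?I. \<Sum>e\<in>unit_steps. if i + e \<in> ?I then \<epsilon>\<^sup>2 * B else 0)"
    using B_nonneg by (intro sum_mono2[OF fin inner_pts_subset[OF bounded_\<Omega> \<epsilon>]] sum_nonneg) auto
  moreover have "(\<Sum>i\<in>?J. \<Sum>e\<in>unit_steps. if i + e \<in> ?I then \<epsilon>\<^sup>2 * B else 0) = (\<Sum>i\<in>?J. \<Sum>e\<in>unit_steps. \<epsilon>\<^sup>2 * B)"
    using inner_pts_step[OF bounded_\<Omega> \<epsilon>] by (intro sum.cong refl) simp
  moreover have "(\<Sum>i\<in>?J. \<Sum>e\<in>unit_steps. \<epsilon>\<^sup>2 * B) = 4 * B * measure lebesgue (cells \<epsilon> ?J)"
    by (simp add: card_unit_steps measure_cells[OF finite_inner_pts[OF bounded_\<Omega> \<epsilon>] inner_pts_lattice[OF bounded_\<Omega> \<epsilon>] \<epsilon>])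
  moreover have "4 * B * (measure lebesgue \<Omega> - bdry diam) \<le> 4 * B * measure lebesgue (cells \<epsilon> ?J)"
  proof (rule mult_left_mono)
    have c: "cells \<epsilon> ?J \<in> lmeasurable"
      by (rule lmeasurable_cells[OF finite_inner_pts[OF bounded_\<Omega> \<epsilon>] inner_pts_lattice[OF bounded_\<Omega> \<epsilon>] \<epsilon>])
    have "\<Omega> \<subseteq> cells \<epsilon> ?J \<union> bdry_nbhd \<Omega> (3 * \<epsilon>)" using Diff_inner_cells[OF bounded_\<Omega> \<epsilon>] by blast
    also have "\<dots> \<subseteq> cells \<epsilon> ?J \<union> bdry_nbhd \<Omega> diam" using bdry_nbhd_mono[OF diam_ge] by blast
    finally have "measure lebesgue \<Omega> \<le> measure lebesgue (cells \<epsilon> ?J \<union> bdry_nbhd \<Omega> diam)"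
      using c lmeasurable_bdry_nbhd[OF bounded_\<Omega>] \<Omega>_sets by (intro measure_mono_fmeasurable fmeasurable.Un)
    also have "\<dots> \<le> measure lebesgue (cells \<epsilon> ?J) + bdry diam"
      using c lmeasurable_bdry_nbhd[OF bounded_\<Omega>] by (intro measure_Un_le) (auto intro: fmeasurableD)
    finally show "measure lebesgue \<Omega> - bdry diam \<le> measure lebesgue (cells \<epsilon> ?J)" by simp
  qed (use B_nonneg in simp)
  ultimately have 5: "4 * B * (measure lebesgue \<Omega> - bdry diam)
      \<le> (\<Sum>i\<in>?I. \<Sum>e\<in>unit_steps. if i + e \<in> ?I then \<epsilon>\<^sup>2 * B else 0)" by linarith
  have arith: "E \<le> 4 * F + \<theta> * M + (12 * B + \<theta>) * b"
    if "E \<le> S - T" "S \<le> 4 * K + V" "K \<le> F + B * b" "V \<le> (4 * B + \<theta>) * (M + b)" "4 * B * (M - b) \<le> T"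
    for E S T K V F M b :: real
    using that by (simp add: algebra_simps)
  show ?thesis using arith[OF 1 2 3 4 5] unfolding \<theta>_def .
qed

lemma field_pairing:
  fixes \<psi> :: "real^2 \<Rightarrow> real^2^2"
  assumes \<psi>: "\<psi> \<in> borel_measurable lebesgue" "\<And>x. x \<in> cover \<Longrightarrow> norm (\<psi> x) \<le> K"
    "\<And>x y. x \<in> cover \<Longrightarrow> y \<in> cover \<Longrightarrow> dist x y \<le> diam \<Longrightarrow> norm (\<psi> x - \<psi> y) \<le> \<omega>" and K: "0 \<le> K"
  shows "\<bar>LINT x:\<Omega>|lebesgue. (field x - Q x) \<bullet> \<psi> x\<bar>
    \<le> (K * mean_error m \<tau> + 2 * \<omega>) * measure lebesgue cover + 2 * K * bdry diam"
proof -
  let ?v = "\<epsilon>\<^sup>2 * ((real L)\<^sup>2 * real m)" and ?V = "\<lambda>x. field x - Q x"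
  have fm: "(\<lambda>x. ?V x \<bullet> \<psi> x) \<in> borel_measurable lebesgue"
    using field_diff_measurable \<psi>(1) by (rule borel_measurable_inner)
  have ip: "norm (?V x \<bullet> y) \<le> 2 * c" if "norm y \<le> c" for x y c
  proof -
    have "norm (?V x \<bullet> y) \<le> norm (?V x) * norm y" by (simp add: Cauchy_Schwarz_ineq2)
    also have "\<dots> \<le> 2 * c" using field_norm[of x] that by (intro mult_mono) auto
    finally show ?thesis .
  qed
  have piece: "\<bar>LINT x:piece L m \<epsilon> \<kappa>|lebesgue. ?V x \<bullet> \<psi> x\<bar> \<le> (K * mean_error m \<tau> + 2 * \<omega>) * ?v" if \<kappa>: "\<kappa> \<in> keys" for \<kappa>
  proof -
    note R = lmeasurable_piece[OF L(1) m \<epsilon>, of \<kappa>]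
    obtain z where z: "z \<in> piece L m \<epsilon> \<kappa>" using \<kappa> by (auto simp: keys_def mem_piece_iff[OF L(1) m])
    have sub: "piece L m \<epsilon> \<kappa> \<subseteq> cover" using \<kappa> by (auto simp: cover_def)
    have Vi: "set_integrable lebesgue (piece L m \<epsilon> \<kappa>) ?V"
      by (rule set_integral_bounded(1)[OF R field_diff_measurable field_norm])
    have dm: "(\<lambda>x. ?V x \<bullet> (\<psi> x - \<psi> z)) \<in> borel_measurable lebesgue"
      by (intro borel_measurable_inner field_diff_measurable borel_measurable_diff \<psi>(1) borel_measurable_const)
    have db: "norm (?V x \<bullet> (\<psi> x - \<psi> z)) \<le> 2 * \<omega>" if "x \<in> piece L m \<epsilon> \<kappa>" for x
      using that z sub dist_piece_le[OF L(1) m \<epsilon> that z] by (intro ip \<psi>(3)) auto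
    have "(LINT x:piece L m \<epsilon> \<kappa>|lebesgue. ?V x \<bullet> \<psi> x)
        = (LINT x:piece L m \<epsilon> \<kappa>|lebesgue. ?V x \<bullet> (\<psi> x - \<psi> z) + \<psi> z \<bullet> ?V x)"
      by (simp add: inner_diff_right inner_commute)
    also have "\<dots> = (LINT x:piece L m \<epsilon> \<kappa>|lebesgue. ?V x \<bullet> (\<psi> x - \<psi> z)) + (LINT x:piece L m \<epsilon> \<kappa>|lebesgue. \<psi> z \<bullet> ?V x)"
      by (rule set_integral_add(2)[OF set_integral_bounded(1)[OF R dm db] set_integral_inner_right(1)[OF Vi]])
    also have "(LINT x:piece L m \<epsilon> \<kappa>|lebesgue. \<psi> z \<bullet> ?V x) = \<psi> z \<bullet> (LINT x:piece L m \<epsilon> \<kappa>|lebesgue. ?V x)"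
      by (rule set_integral_inner_right(2)[OF Vi])
    finally have split: "(LINT x:piece L m \<epsilon> \<kappa>|lebesgue. ?V x \<bullet> \<psi> x)
        = (LINT x:piece L m \<epsilon> \<kappa>|lebesgue. ?V x \<bullet> (\<psi> x - \<psi> z)) + \<psi> z \<bullet> (LINT x:piece L m \<epsilon> \<kappa>|lebesgue. ?V x)" .
    have "\<bar>LINT x:piece L m \<epsilon> \<kappa>|lebesgue. ?V x \<bullet> (\<psi> x - \<psi> z)\<bar> \<le> 2 * \<omega> * ?v"
      using set_integral_bounded(2)[OF R dm db] by (simp only: measure_piece[OF L(1) m \<epsilon>] real_norm_def)
    moreover have "\<bar>\<psi> z \<bullet> (LINT x:piece L m \<epsilon> \<kappa>|lebesgue. ?V x)\<bar> \<le> K * mean_error m \<tau> * ?v"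
    proof -
      have fi: "set_integrable lebesgue (piece L m \<epsilon> \<kappa>) field"
        by (rule set_integral_bounded(1)[OF R field_measurable])
           (rule norm_K_set_le[OF subsetD[OF S1_tensor_subset_K_set field_S1]])
      have Qi: "set_integrable lebesgue (piece L m \<epsilon> \<kappa>) Q"
        by (rule set_integral_bounded(1)[OF R Q_measurable]) (rule norm_K_set_le[OF Q_K])
      have "norm (LINT x:piece L m \<epsilon> \<kappa>|lebesgue. ?V x) \<le> mean_error m \<tau> * ?v"
      proof -
        have eq: "field = (\<lambda>x. tensor (w (idx \<epsilon> x)) (w (idx \<epsilon> x)))" by (simp add: fun_eq_iff field_def)
        show ?thesis unfolding set_integral_diff(2)[OF fi Qi] unfolding eq by (rule mean)
      qed
      then have "norm (\<psi> z) * norm (LINT x:piece L m \<epsilon> \<kappa>|lebesgue. ?V x) \<le> K * (mean_error m \<tau> * ?v)"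
        using \<psi>(2) z sub K by (intro mult_mono) auto
      then show ?thesis
        using Cauchy_Schwarz_ineq2[of "\<psi> z" "LINT x:piece L m \<epsilon> \<kappa>|lebesgue. ?V x"] by (simp only: mult.assoc)
    qed
    ultimately show ?thesis unfolding split distrib_right by linarith
  qed
  have "(LINT x:cover|lebesgue. ?V x \<bullet> \<psi> x) = (\<Sum>\<kappa>\<in>keys. LINT x:piece L m \<epsilon> \<kappa>|lebesgue. ?V x \<bullet> \<psi> x)"
    by (rule cover_integral[OF fm, of "2 * K"]) (intro ip \<psi>(2))
  then have "\<bar>LINT x:cover|lebesgue. ?V x \<bullet> \<psi> x\<bar> \<le> (\<Sum>\<kappa>\<in>keys. (K * mean_error m \<tau> + 2 * \<omega>) * ?v)"
    using order_trans[OF sum_abs sum_mono[OF piece]] by simp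
  also have "\<dots> = (K * mean_error m \<tau> + 2 * \<omega>) * measure lebesgue cover"
    unfolding measure_cover(1)[symmetric] by simp
  finally have "\<bar>LINT x:cover|lebesgue. ?V x \<bullet> \<psi> x\<bar> \<le> (K * mean_error m \<tau> + 2 * \<omega>) * measure lebesgue cover" .
  moreover have "\<bar>(LINT x:cover|lebesgue. ?V x \<bullet> \<psi> x) - (LINT x:\<Omega>|lebesgue. ?V x \<bullet> \<psi> x)\<bar> \<le> 2 * K * bdry diam"
    using K by (intro cover_integral_diff fm ip \<psi>(2)) auto
  ultimately show ?thesis by linarith
qed

end

end

section \<open>Choice of the parameters and the upper bound\<close>

lemma small_errors:
  assumes "0 < d"
  obtains L m :: nat and \<tau> \<eta> :: real where "0 < L" "even L" "0 < m" "0 < \<tau>" "\<tau> < 1" "0 < \<eta>"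
    "mean_error m \<tau> \<le> d" "energy_error L m \<eta> \<le> d"
proof -
  define A where "A = 4 + 4 * C0 + 4 * B"
  have A: "0 < A" using B_nonneg by (simp add: A_def)
  obtain n where n: "inverse (real (Suc n)) < d / A" using reals_Archimedean assms A by (metis divide_pos_pos)
  define N where "N = real (Suc n)"
  have N: "1 \<le> N" by (simp add: N_def)
  have AN: "A / N \<le> d" using n A by (simp add: N_def field_simps)
  have sq: "sqrt (real (Suc n * Suc n)) = N"
    by (simp only: of_nat_mult real_sqrt_abs2 N_def abs_of_nat)
  have L: "real (2 * Suc n) = 2 * N" by (simp add: N_def)
  show thesis
  \<comment> \<open>With L = 2 N and m equal to the square of N, every error term has order 1 / N,
    and A collects the constants of the energy error. The denominator N + 1 keeps \<tau> below 1
    when N = 1.\<close>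
  proof (rule that[of "2 * Suc n" "Suc n * Suc n" "inverse (N + 1)" "inverse N"])
    have "mean_error (Suc n * Suc n) (inverse (N + 1)) \<le> C0 / N + 2 * inverse N"
      unfolding sq using N by (intro add_left_mono mult_left_mono le_imp_inverse_le) auto
    also have "\<dots> = (C0 + 2) / N" by (simp only: divide_inverse distrib_right)
    also have "\<dots> \<le> A / N" using N B_nonneg by (intro divide_right_mono) (auto simp: A_def)
    finally show "mean_error (Suc n * Suc n) (inverse (N + 1)) \<le> d" using AN by linarith
    have "energy_error (2 * Suc n) (Suc n * Suc n) (inverse N) = A / N"
      unfolding sq L A_def using N by (simp add: field_simps)
    then show "energy_error (2 * Suc n) (Suc n * Suc n) (inverse N) \<le> d" using AN by linarith
  qed (use N in \<open>auto simp: inverse_less_1_iff\<close>)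
qed

text \<open>The block sizes, \<tau> and \<eta> depend on r, d and the finite family, not on
  \<epsilon>. Fields with values in K are bounded, so each test field may be exchanged for a
  continuous one, whose oscillation over a block vanishes with \<epsilon>.\<close>

lemma upper_bound:
  assumes \<Phi>: "finite \<Phi>" "\<Phi> \<subseteq> L1_sym \<Omega>" and r: "0 < r" and d: "0 < d"
  shows "\<forall>\<^sub>F \<epsilon> in at_right 0. \<exists>P u. P \<in> Linf \<Omega> sym_matrices \<and> director_field \<epsilon> \<Omega> P u \<and>
    (\<forall>\<phi>\<in>\<Phi>. \<bar>(\<integral>x. P x \<bullet> \<phi> x \<partial>lebesgue_on \<Omega>) - (\<integral>x. Q x \<bullet> \<phi> x \<partial>lebesgue_on \<Omega>)\<bar> < r) \<and>
    (\<Sum>(i, j)\<in>neighbours \<epsilon> \<Omega>. \<epsilon>\<^sup>2 * h \<bar>u i \<bullet> u j\<bar>) \<le> 4 * limit_density + d"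
proof -
  define ext where "ext \<phi> x = indicator \<Omega> x *\<^sub>R \<phi> x" for \<phi> :: "real^2 \<Rightarrow> real^2^2" and x
  have exti: "integrable lebesgue (ext \<phi>)" if "\<phi> \<in> \<Phi>" for \<phi>
  proof -
    have "integrable (lebesgue_on \<Omega>) \<phi>" using that \<Phi>(2) by (auto simp: L1_sym_def)
    then show ?thesis unfolding ext_def[abs_def] using \<Omega>_sets by (simp add: integrable_restrict_space)
  qed
  \<comment> \<open>Two fields in K differ by at most 2 in norm, so an L1 error below r / 8 costs
    less than r / 4 in the pairing.\<close>
  have "\<forall>\<phi>\<in>\<Phi>. \<exists>\<psi>. continuous_on UNIV \<psi> \<and> integrable lebesgue \<psi> \<and> (\<integral>x. norm (ext \<phi> x - \<psi> x) \<partial>lebesgue) < r / 8"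
  proof
    fix \<phi> assume "\<phi> \<in> \<Phi>"
    have "0 < r / 8" using r by simp
    then show "\<exists>\<psi>. continuous_on UNIV \<psi> \<and> integrable lebesgue \<psi> \<and> (\<integral>x. norm (ext \<phi> x - \<psi> x) \<partial>lebesgue) < r / 8"
      using continuous_L1_approximation[OF exti[OF \<open>\<phi> \<in> \<Phi>\<close>]] by blast
  qed
  then obtain \<psi> where "\<forall>\<phi>\<in>\<Phi>. continuous_on UNIV (\<psi> \<phi>) \<and> integrable lebesgue (\<psi> \<phi>) \<and>
      (\<integral>x. norm (ext \<phi> x - \<psi> \<phi> x) \<partial>lebesgue) < r / 8" by (rule bchoice[THEN exE])
  then have \<psi>: "\<And>\<phi>. \<phi> \<in> \<Phi> \<Longrightarrow> continuous_on UNIV (\<psi> \<phi>)" "\<And>\<phi>. \<phi> \<in> \<Phi> \<Longrightarrow> integrable lebesgue (\<psi> \<phi>)"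
    "\<And>\<phi>. \<phi> \<in> \<Phi> \<Longrightarrow> (\<integral>x. norm (ext \<phi> x - \<psi> \<phi> x) \<partial>lebesgue) < r / 8" by blast+
  obtain R where R: "\<Omega> \<subseteq> ball 0 R" using bounded_subset_ballD[OF bounded_\<Omega>] by blast
  \<comment> \<open>This ball contains the cover as soon as the block diameter is at most 1.\<close>
  let ?B = "cball (0 :: real^2) (R + 1)"
  have "bounded (\<Union>\<phi>\<in>\<Phi>. \<psi> \<phi> ` ?B)"
  proof (rule bounded_UN[OF \<Phi>(1)], rule ballI)
    fix \<phi> assume "\<phi> \<in> \<Phi>"
    then have "continuous_on ?B (\<psi> \<phi>)" using \<psi>(1) continuous_on_subset by blast
    then show "bounded (\<psi> \<phi> ` ?B)" by (intro compact_imp_bounded compact_continuous_image compact_cball)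
  qed
  then obtain K where K: "0 < K" "\<And>\<phi> x. \<phi> \<in> \<Phi> \<Longrightarrow> x \<in> ?B \<Longrightarrow> norm (\<psi> \<phi> x) \<le> K"
    unfolding bounded_pos by blast
  \<comment> \<open>Bounds the area of the cover once the boundary layer has area at most 1.\<close>
  define M where "M = measure lebesgue \<Omega> + 1"
  have M: "1 \<le> M" by (simp add: M_def)
  define \<omega> where "\<omega> = r / 16 / M"
  have \<omega>: "0 < \<omega>" using r M by (simp add: \<omega>_def)
  \<comment> \<open>The first entry gives \<open>K * d1 * M \<le> r / 8\<close>, which together with
    \<open>2 * \<omega> * M = r / 8\<close> uses r / 4; the second gives the energy error d / 2 on
    \<Omega>. The boundary layer receives another r / 4 and d / 2.\<close>
  define d1 where "d1 = min (r / 8 / (K * M)) (d / 2 / M)"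
  have d1: "0 < d1" using r d K M by (simp add: d1_def)
  obtain L m :: nat and \<tau> \<eta> :: real where pr: "0 < L" "even L" "0 < m" "0 < \<tau>" "\<tau> < 1" "0 < \<eta>"
    and err: "mean_error m \<tau> \<le> d1" "energy_error L m \<eta> \<le> d1"
    by (rule small_errors[OF d1])
  define c where "c = real L + real m * real L + 2"
  have c: "2 \<le> c" by (simp add: c_def)
  have ev1: "\<forall>\<^sub>F \<epsilon> in at_right 0. bdry (c * \<epsilon>) < min 1 (min (r / 4 / (2 * K)) (d / 2 / (12 * B + d1)))"
    using r d K d1 B_nonneg c by (intro bdry_small) (auto intro!: divide_pos_pos add_nonneg_pos)
  have ev2: "\<forall>\<^sub>F \<epsilon> in at_right 0. \<forall>\<phi>\<in>\<Phi>. \<forall>x\<in>?B. \<forall>y\<in>?B. dist x y \<le> c * \<epsilon> \<longrightarrow> norm (\<psi> \<phi> x - \<psi> \<phi> y) \<le> \<omega>"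
  proof (rule eventually_ball_finite[OF \<Phi>(1)], rule ballI)
    fix \<phi> assume "\<phi> \<in> \<Phi>"
    then have "continuous_on ?B (\<psi> \<phi>)" using \<psi>(1) continuous_on_subset by blast
    then have "uniformly_continuous_on ?B (\<psi> \<phi>)" by (intro compact_uniformly_continuous compact_cball)
    then obtain e where e: "0 < e" "\<And>x y. x \<in> ?B \<Longrightarrow> y \<in> ?B \<Longrightarrow> dist y x < e \<Longrightarrow> dist (\<psi> \<phi> y) (\<psi> \<phi> x) < \<omega>"
      using \<omega> unfolding uniformly_continuous_on_def by metis
    show "\<forall>\<^sub>F \<epsilon> in at_right 0. \<forall>x\<in>?B. \<forall>y\<in>?B. dist x y \<le> c * \<epsilon> \<longrightarrow> norm (\<psi> \<phi> x - \<psi> \<phi> y) \<le> \<omega>"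
      unfolding eventually_at_right_field
    proof (intro exI[of _ "e / c"] conjI allI impI ballI)
      fix \<epsilon> x y assume h: "0 < \<epsilon>" "\<epsilon> < e / c" "x \<in> ?B" "y \<in> ?B" "dist x y \<le> c * \<epsilon>"
      then have "c * \<epsilon> < e" using c by (simp add: field_simps)
      then show "norm (\<psi> \<phi> x - \<psi> \<phi> y) \<le> \<omega>" using e(2)[OF h(4,3)] h(5) by (simp add: dist_norm)
    qed (use e c in auto)
  qed
  have ev3: "\<forall>\<^sub>F \<epsilon> in at_right (0::real). 0 < \<epsilon> \<and> c * \<epsilon> \<le> 1"
    unfolding eventually_at_right_field using c by (intro exI[of _ "1 / c"]) (auto simp: field_simps)
  from ev1 ev2 ev3 show ?thesis
  proof eventually_elim
    case (elim \<epsilon>)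
    define b where "b = bdry (c * \<epsilon>)"
    have b: "0 \<le> b" "b \<le> 1" "b \<le> r / 4 / (2 * K)" "b \<le> d / 2 / (12 * B + d1)" using elim(1) by (simp_all add: b_def)
    have \<epsilon>: "0 < \<epsilon>" "c * \<epsilon> \<le> 1" using elim(3) by auto
    obtain w where w: "\<And>i. norm (w i) = 1"
      "\<And>\<kappa>. norm ((LINT x:piece L m \<epsilon> \<kappa>|lebesgue. tensor (w (idx \<epsilon> x)) (w (idx \<epsilon> x))) - (LINT x:piece L m \<epsilon> \<kappa>|lebesgue. Q x))
        \<le> mean_error m \<tau> * (\<epsilon>\<^sup>2 * ((real L)\<^sup>2 * real m))"
      "\<And>\<kappa>. (\<Sum>i\<in>block L m \<kappa>. \<Sum>e\<in>unit_steps. \<epsilon>\<^sup>2 * (h \<bar>w i \<bullet> w (i + e)\<bar> + B))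
        \<le> 4 * (LINT x:piece L m \<epsilon> \<kappa>|lebesgue. g (rad (Q x))) + 4 * B * (\<epsilon>\<^sup>2 * ((real L)\<^sup>2 * real m))
          + energy_error L m \<eta> * (\<epsilon>\<^sup>2 * ((real L)\<^sup>2 * real m))"
      using recovery_directors[OF pr \<epsilon>(1)] by blast
    note prw = pr \<epsilon>(1) w
    define P where "P = field \<epsilon> w"
    define U where "U = cover L m \<epsilon>"
    have U: "U \<subseteq> ?B"
    proof
      fix y assume "y \<in> U"
      then obtain x where x: "x \<in> \<Omega>" "dist y x \<le> c * \<epsilon>" using cover_near[OF pr \<epsilon>(1)] unfolding U_def c_def by blast
      then have "norm x < R" using R by auto
      then show "y \<in> ?B" using x(2) \<epsilon>(2) norm_triangle_sub[of y x] by (simp add: dist_norm)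
    qed
    have Pm: "P \<in> borel_measurable lebesgue" unfolding P_def by (rule field_measurable[OF prw])
    have Vm: "(\<lambda>x. P x - Q x) \<in> borel_measurable lebesgue" unfolding P_def by (rule field_diff_measurable[OF prw])
    have V2: "norm (P x - Q x) \<le> 2" for x unfolding P_def by (rule field_norm[OF prw])
    have PK: "P x \<in> K_set" for x unfolding P_def using field_S1[OF prw] S1_tensor_subset_K_set by blast
    have "P \<in> Linf \<Omega> sym_matrices"
      unfolding Linf_def using PK K_set_subset_sym norm_K_set_le Pm
      by (auto intro!: exI[of _ 1] measurable_restrict_space1)
    moreover have "director_field \<epsilon> \<Omega> P w" unfolding P_def by (rule director_field_field[OF prw])
    moreover have "\<bar>(\<integral>x. P x \<bullet> \<phi> x \<partial>lebesgue_on \<Omega>) - (\<integral>x. Q x \<bullet> \<phi> x \<partial>lebesgue_on \<Omega>)\<bar> < r" if \<phi>: "\<phi> \<in> \<Phi>" for \<phi>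
    proof -
      have pair: "(\<integral>x. P' x \<bullet> \<phi> x \<partial>lebesgue_on \<Omega>) = (\<integral>x. ext \<phi> x \<bullet> P' x \<partial>lebesgue)" for P'
        unfolding integral_lebesgue_on_eq[OF \<Omega>_sets] set_lebesgue_integral_def ext_def by (simp add: inner_commute)
      have P1: "norm (P x) \<le> 1" and Q1: "norm (Q x) \<le> 1" for x by (rule norm_K_set_le[OF PK], rule norm_K_set_le[OF Q_K])
      have diff: "(\<integral>x. ext \<phi> x \<bullet> P x \<partial>lebesgue) - (\<integral>x. ext \<phi> x \<bullet> Q x \<partial>lebesgue) = (\<integral>x. ext \<phi> x \<bullet> (P x - Q x) \<partial>lebesgue)"
        unfolding inner_diff_right
        by (rule Bochner_Integration.integral_diff[symmetric])
           (rule integrable_inner_bounded[OF exti[OF \<phi>] Pm P1], rule integrable_inner_bounded[OF exti[OF \<phi>] Q_measurable Q1])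
      let ?G = "\<lambda>x. indicator \<Omega> x *\<^sub>R (P x - Q x)"
      have [measurable]: "\<Omega> \<in> sets lebesgue" by (rule \<Omega>_sets)
      note Vm[measurable]
      have Gm: "?G \<in> borel_measurable lebesgue" by measurable
      have G2: "norm (?G x) \<le> 2" for x using V2[of x] by (simp add: indicator_def)
      have "ext \<phi> x \<bullet> (P x - Q x) = ext \<phi> x \<bullet> ?G x" for x by (simp add: ext_def indicator_def)
      then have e1: "(\<integral>x. ext \<phi> x \<bullet> (P x - Q x) \<partial>lebesgue) = (\<integral>x. ext \<phi> x \<bullet> ?G x \<partial>lebesgue)"
        by (intro Bochner_Integration.integral_cong refl)
      have e2: "(\<integral>x. \<psi> \<phi> x \<bullet> ?G x \<partial>lebesgue) = (LINT x:\<Omega>|lebesgue. (P x - Q x) \<bullet> \<psi> \<phi> x)"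
        unfolding set_lebesgue_integral_def by (simp add: inner_commute)
      have df: "integrable lebesgue (\<lambda>x. ext \<phi> x - \<psi> \<phi> x)" using exti[OF \<phi>] \<psi>(2)[OF \<phi>] by simp
      have "(\<integral>x. ext \<phi> x \<bullet> ?G x \<partial>lebesgue) - (\<integral>x. \<psi> \<phi> x \<bullet> ?G x \<partial>lebesgue) = (\<integral>x. (ext \<phi> x - \<psi> \<phi> x) \<bullet> ?G x \<partial>lebesgue)"
        unfolding inner_diff_left
        by (rule Bochner_Integration.integral_diff[symmetric])
           (rule integrable_inner_bounded[OF exti[OF \<phi>] Gm G2], rule integrable_inner_bounded[OF \<psi>(2)[OF \<phi>] Gm G2])
      then have near: "\<bar>(\<integral>x. ext \<phi> x \<bullet> ?G x \<partial>lebesgue) - (\<integral>x. \<psi> \<phi> x \<bullet> ?G x \<partial>lebesgue)\<bar> < r / 4"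
        using integral_inner_bounded_le[OF df Gm G2] \<psi>(3)[OF \<phi>] by simp
      have "\<bar>LINT x:\<Omega>|lebesgue. (P x - Q x) \<bullet> \<psi> \<phi> x\<bar>
          \<le> (K * mean_error m \<tau> + 2 * \<omega>) * measure lebesgue U + 2 * K * b"
        unfolding P_def U_def b_def c_def
      proof (rule field_pairing[OF prw])
        show "\<psi> \<phi> \<in> borel_measurable lebesgue" using \<psi>(2)[OF \<phi>] by simp
        show "norm (\<psi> \<phi> x) \<le> K" if "x \<in> cover L m \<epsilon>" for x using K(2)[OF \<phi>] U that unfolding U_def by blast
        show "norm (\<psi> \<phi> x - \<psi> \<phi> y) \<le> \<omega>"
          if "x \<in> cover L m \<epsilon>" "y \<in> cover L m \<epsilon>" "dist x y \<le> (real L + real m * real L + 2) * \<epsilon>" for x y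
          using elim(2) \<phi> U that unfolding U_def c_def by blast
      qed (use K in simp)
      also have "\<dots> \<le> r / 4 + r / 4"
      proof (rule add_mono)
        have "measure lebesgue U \<le> M" using measure_cover(2)[OF pr \<epsilon>(1)] b(2) unfolding U_def M_def b_def c_def by linarith
        then have "(K * mean_error m \<tau> + 2 * \<omega>) * measure lebesgue U \<le> (K * d1 + 2 * \<omega>) * M"
          using err(1) K \<omega> d1 by (intro mult_mono add_right_mono mult_left_mono) auto
        also have "\<dots> \<le> (K * (r / 8 / (K * M)) + 2 * \<omega>) * M"
          using K M by (intro mult_right_mono add_right_mono mult_left_mono) (auto simp: d1_def)
        also have "\<dots> = r / 4" using K M by (simp add: \<omega>_def field_simps)
        finally show "(K * mean_error m \<tau> + 2 * \<omega>) * measure lebesgue U \<le> r / 4" .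
        have "2 * K * b \<le> 2 * K * (r / 4 / (2 * K))" using b(3) K by (intro mult_left_mono) auto
        then show "2 * K * b \<le> r / 4" using K by simp
      qed
      finally show ?thesis using near unfolding pair diff e1 e2 by linarith
    qed
    moreover have "(\<Sum>(i, j)\<in>neighbours \<epsilon> \<Omega>. \<epsilon>\<^sup>2 * h \<bar>w i \<bullet> w j\<bar>) \<le> 4 * limit_density + d"
    proof -
      have "(\<Sum>(i, j)\<in>neighbours \<epsilon> \<Omega>. \<epsilon>\<^sup>2 * h \<bar>w i \<bullet> w j\<bar>)
          \<le> 4 * limit_density + energy_error L m \<eta> * measure lebesgue \<Omega> + (12 * B + energy_error L m \<eta>) * b"
        unfolding b_def c_def by (rule field_energy[OF prw])
      also have "\<dots> \<le> 4 * limit_density + d1 * M + (12 * B + d1) * b"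
        using err(2) b(1) d1 by (intro add_mono mult_mono mult_right_mono order_refl) (auto simp: M_def)
      also have "\<dots> \<le> 4 * limit_density + d / 2 + d / 2"
      proof (intro add_mono order_refl)
        have "d1 * M \<le> d / 2 / M * M" using M by (intro mult_right_mono) (auto simp: d1_def)
        then show "d1 * M \<le> d / 2" using M by simp
        have p: "0 < 12 * B + d1" using B_nonneg d1 by simp
        have "(12 * B + d1) * b \<le> (12 * B + d1) * (d / 2 / (12 * B + d1))" using b(4) p by (intro mult_left_mono) auto
        also have "\<dots> = d / 2" by (metis less_irrefl nonzero_mult_div_cancel_left p times_divide_eq_right)
        finally show "(12 * B + d1) * b \<le> d / 2" .
      qed
      finally show ?thesis by simp
    qed
    ultimately show ?case by blast
  qed
qed

end

section \<open>The lower and upper Gamma-limits\<close>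

lemma Gamma_liminf_le_limsup:
  assumes "G \<noteq> bot"
  shows "Gamma_liminf T G F x \<le> Gamma_limsup T G F x"
  unfolding Gamma_liminf_def Gamma_limsup_def
  by (intro SUP_mono) (use Liminf_le_Limsup[of G] assms in \<open>auto simp: trivial_limit_def\<close>)

lemma F_eps_infinity_outside_K:
  assumes "Q \<notin> Linf \<Omega> K_set" "Q \<in> Linf \<Omega> sym_matrices"
  shows "F_eps f \<Omega> \<epsilon> Q = \<infinity>"
proof (rule F_eps_infinity)
  show "\<not> (\<exists>P\<in>C_eps \<epsilon> \<Omega>. AE x in lebesgue_on \<Omega>. P x = Q x)"
  proof
    assume "\<exists>P\<in>C_eps \<epsilon> \<Omega>. AE x in lebesgue_on \<Omega>. P x = Q x"
    then obtain P where P: "P \<in> C_eps \<epsilon> \<Omega>" "AE x in lebesgue_on \<Omega>. P x = Q x" by blast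
    have "AE x in lebesgue_on \<Omega>. x \<in> \<Omega>" by (rule AE_I2) (simp add: space_restrict_space)
    with P(2) have "AE x in lebesgue_on \<Omega>. Q x \<in> K_set"
    proof eventually_elim
      case (elim x)
      have "P x \<in> S1_tensor" using P(1) elim(2) unfolding C_eps_def by blast
      then have "P x \<in> K_set" using S1_tensor_subset_K_set by blast
      then show ?case unfolding elim(1) .
    qed
    with assms show False unfolding Linf_def by blast
  qed
qed

theorem theorem3p15:
  fixes \<Omega> :: "(real^2) set" and h :: "real \<Rightarrow> real" and f :: "real^2 \<Rightarrow> real^2 \<Rightarrow> real"
  assumes "open \<Omega>" and "bounded \<Omega>" and "lipschitz_boundary \<Omega>"
    and "h \<in> borel_measurable (restrict_space borel {0..1})" and "bounded (h ` {0..1})"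
    and "\<And>u v. norm u = 1 \<Longrightarrow> norm v = 1 \<Longrightarrow> f u v = h \<bar>u \<bullet> v\<bar>"
  shows "Gamma_converges (weak_star \<Omega>) (at_right 0) (F_eps f \<Omega>) (F_lim h \<Omega>)"
  unfolding Gamma_converges_def topspace_weak_star
proof
  note f = assms(6)
  let ?li = "Gamma_liminf (weak_star \<Omega>) (at_right 0) (F_eps f \<Omega>)"
  let ?ls = "Gamma_limsup (weak_star \<Omega>) (at_right 0) (F_eps f \<Omega>)"
  fix Q0 assume Q0: "Q0 \<in> Linf \<Omega> sym_matrices"
  have lils: "?li Q0 \<le> ?ls Q0" by (rule Gamma_liminf_le_limsup) simp
  have \<Omega>lm: "\<Omega> \<in> lmeasurable" using assms(1,2) by (intro lmeasurable_open)
  show "?li Q0 = F_lim h \<Omega> Q0 \<and> ?ls Q0 = F_lim h \<Omega> Q0"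
  proof (cases "Q0 \<in> Linf \<Omega> K_set")
    case False
    \<comment> \<open>In the separating half-space all discrete energies are infinite, because a
      finite energy forces values in K almost everywhere.\<close>
    obtain \<phi> c where \<phi>: "\<phi> \<in> L1_sym \<Omega>" "c < (\<integral>x. Q0 x \<bullet> \<phi> x \<partial>lebesgue_on \<Omega>)"
      "\<And>P. P \<in> Linf \<Omega> K_set \<Longrightarrow> (\<integral>x. P x \<bullet> \<phi> x \<partial>lebesgue_on \<Omega>) \<le> c"
      using Linf_K_set_separation[OF \<Omega>lm Q0 False] by blast
    define U where "U = {P \<in> Linf \<Omega> sym_matrices. (\<integral>x. P x \<bullet> \<phi> x \<partial>lebesgue_on \<Omega>) \<in> {c<..}}"
    have "F_eps f \<Omega> \<epsilon> P = \<infinity>" if "P \<in> U" for \<epsilon> P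
      using that \<phi>(3)[of P] unfolding U_def by (intro F_eps_infinity_outside_K) auto
    moreover have U: "openin (weak_star \<Omega>) U" "Q0 \<in> U"
      unfolding U_def using openin_weak_star_pairing[OF \<phi>(1) open_greaterThan] Q0 \<phi>(2) by simp_all
    ultimately have "\<infinity> \<le> Liminf (at_right 0) (\<lambda>\<epsilon>. INF P\<in>U. F_eps f \<Omega> \<epsilon> P)"
      by (intro Liminf_bounded always_eventually allI INF_greatest) simp
    also have "\<dots> \<le> ?li Q0" unfolding Gamma_liminf_def using U by (intro SUP_upper) simp
    finally show ?thesis using lils False by (simp add: F_lim_def)
  next
    case True
    \<comment> \<open>Passing to a representative with values in K everywhere leaves the pairings
      and the limit energy unchanged.\<close>
    obtain Q where Q: "Q \<in> borel_measurable lebesgue" "\<And>x. Q x \<in> K_set" "AE x in lebesgue_on \<Omega>. Q x = Q0 x"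
      using K_set_representative[OF fmeasurableD[OF \<Omega>lm] True] by blast
    obtain B where B: "\<And>t. t \<in> {0..1} \<Longrightarrow> \<bar>h t\<bar> \<le> B"
      using assms(5) unfolding bounded_iff by (metis imageI real_norm_def)
    interpret spin_system \<Omega> h B Q
      by unfold_locales (use assms(1,2) negligible_frontier_lipschitz[OF assms(1-3)] B Q in auto)
    have pair: "(\<integral>x. Q0 x \<bullet> \<phi> x \<partial>lebesgue_on \<Omega>) = (\<integral>x. Q x \<bullet> \<phi> x \<partial>lebesgue_on \<Omega>)" if "\<phi> \<in> L1_sym \<Omega>" for \<phi>
    proof (rule integral_cong_AE)
      have [measurable]: "\<phi> \<in> borel_measurable (lebesgue_on \<Omega>)" using that by (auto simp: L1_sym_def)
      have [measurable]: "Q \<in> borel_measurable (lebesgue_on \<Omega>)" using Q(1) by (rule measurable_restrict_space1)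
      have [measurable]: "Q0 \<in> borel_measurable (lebesgue_on \<Omega>)" using Q0 by (simp add: Linf_def)
      show "(\<lambda>x. Q0 x \<bullet> \<phi> x) \<in> borel_measurable (lebesgue_on \<Omega>)" "(\<lambda>x. Q x \<bullet> \<phi> x) \<in> borel_measurable (lebesgue_on \<Omega>)"
        by measurable
      show "AE x in lebesgue_on \<Omega>. Q0 x \<bullet> \<phi> x = Q x \<bullet> \<phi> x" using Q(3) by eventually_elim simp
    qed
    have lim: "F_lim h \<Omega> Q0 = ereal (4 * limit_density)"
    proof -
      have ae: "AE x in lebesgue. indicator \<Omega> x *\<^sub>R g (rad (Q x)) = indicator \<Omega> x *\<^sub>R g (rad (Q0 x))"
      proof -
        have "AE x in lebesgue. x \<in> \<Omega> \<longrightarrow> Q x = Q0 x" using Q(3) \<Omega>_sets by (simp add: AE_restrict_space_iff)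
        then show ?thesis by eventually_elim (auto simp: indicator_def)
      qed
      have [measurable]: "\<Omega> \<in> sets lebesgue" by (rule \<Omega>_sets)
      have [measurable]: "(\<lambda>x. g (rad (Q x))) \<in> borel_measurable lebesgue" using g_rad_measurable[of 1] by simp
      have m: "(\<lambda>x. indicator \<Omega> x *\<^sub>R g (rad (Q x))) \<in> borel_measurable lebesgue" by measurable
      have "(\<integral>x. g (rad (Q0 x)) \<partial>lebesgue_on \<Omega>) = limit_density"
        unfolding integral_lebesgue_on_eq[OF \<Omega>_sets] set_lebesgue_integral_def limit_density_def
        by (rule integral_cong_AE[OF m borel_measurable_AE[OF m ae] ae, symmetric])
      then show ?thesis using True by (simp add: F_lim_def rad_def)
    qed
    have energy: "(\<Sum>(i, j)\<in>neighbours \<epsilon> \<Omega>. \<epsilon>\<^sup>2 * f (u i) (u j)) = (\<Sum>(i, j)\<in>neighbours \<epsilon> \<Omega>. \<epsilon>\<^sup>2 * h \<bar>u i \<bullet> u j\<bar>)"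
      if "director_field \<epsilon> \<Omega> P u" for \<epsilon> P u
      using that f by (intro sum.cong) (auto simp: director_field_def neighbours_def)
    have lower: "ereal (4 * limit_density) \<le> ?li Q0"
    \<comment> \<open>It suffices to find, for each real number below the limit energy, one
      neighbourhood in which the energies eventually exceed or equal it.\<close>
    proof (rule dense_le)
      fix z :: ereal assume z: "z < ereal (4 * limit_density)"
      show "z \<le> ?li Q0"
      proof (cases z)
        case (real c)
        then have "c < 4 * limit_density" using z by simp
        from lower_bound[OF this] obtain \<phi> r where \<phi>: "\<phi> \<in> L1_sym \<Omega>" "0 < r"
          and ev: "\<forall>\<^sub>F \<epsilon> in at_right 0. \<forall>P u. P \<in> Linf \<Omega> sym_matrices \<longrightarrow> director_field \<epsilon> \<Omega> P u \<longrightarrow>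
            (\<integral>x. Q x \<bullet> \<phi> x \<partial>lebesgue_on \<Omega>) - r < (\<integral>x. P x \<bullet> \<phi> x \<partial>lebesgue_on \<Omega>) \<longrightarrow>
            c \<le> (\<Sum>(i, j)\<in>neighbours \<epsilon> \<Omega>. \<epsilon>\<^sup>2 * h \<bar>u i \<bullet> u j\<bar>)" by blast
        define U where "U = {P \<in> Linf \<Omega> sym_matrices. (\<integral>x. P x \<bullet> \<phi> x \<partial>lebesgue_on \<Omega>) \<in> {(\<integral>x. Q x \<bullet> \<phi> x \<partial>lebesgue_on \<Omega>) - r<..}}"
        have U: "openin (weak_star \<Omega>) U" "Q0 \<in> U"
          unfolding U_def using openin_weak_star_pairing[OF \<phi>(1) open_greaterThan] Q0 \<phi>(2) pair[OF \<phi>(1)] by simp_all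
        have "\<forall>\<^sub>F \<epsilon> in at_right 0. z \<le> (INF P\<in>U. F_eps f \<Omega> \<epsilon> P)"
          using ev
        proof eventually_elim
          case (elim \<epsilon>)
          show ?case
          proof (rule INF_greatest)
            fix P assume "P \<in> U"
            then show "z \<le> F_eps f \<Omega> \<epsilon> P"
              unfolding F_eps_def using elim energy by (intro Inf_greatest) (auto simp: U_def real)
          qed
        qed
        then have "z \<le> Liminf (at_right 0) (\<lambda>\<epsilon>. INF P\<in>U. F_eps f \<Omega> \<epsilon> P)" by (rule Liminf_bounded)
        also have "\<dots> \<le> ?li Q0" unfolding Gamma_liminf_def using U by (intro SUP_upper) simp
        finally show ?thesis .
      qed (use z in auto)
    qed
    have upper: "?ls Q0 \<le> ereal (4 * limit_density)"
      unfolding Gamma_limsup_def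
    proof (rule SUP_least)
      fix U assume "U \<in> {U. openin (weak_star \<Omega>) U \<and> Q0 \<in> U}"
      then have "openin (weak_star \<Omega>) U" "Q0 \<in> U" by simp_all
      then obtain \<Phi> r where \<Phi>: "finite \<Phi>" "\<Phi> \<subseteq> L1_sym \<Omega>" "r > 0"
        and nbhd: "\<And>P. P \<in> Linf \<Omega> sym_matrices \<Longrightarrow>
          (\<And>\<phi>. \<phi> \<in> \<Phi> \<Longrightarrow> \<bar>(\<integral>x. P x \<bullet> \<phi> x \<partial>lebesgue_on \<Omega>) - (\<integral>x. Q0 x \<bullet> \<phi> x \<partial>lebesgue_on \<Omega>)\<bar> < r) \<Longrightarrow> P \<in> U"
        by (rule weak_star_nbhd) blast
      show "Limsup (at_right 0) (\<lambda>\<epsilon>. INF P\<in>U. F_eps f \<Omega> \<epsilon> P) \<le> ereal (4 * limit_density)"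
      \<comment> \<open>The extra error d is fixed together with the neighbourhood, so the
        parameters of the recovery field may depend on both.\<close>
      proof (rule ereal_le_epsilon2)
        fix d :: real assume d: "0 < d"
        have "\<forall>\<^sub>F \<epsilon> in at_right 0. (INF P\<in>U. F_eps f \<Omega> \<epsilon> P) \<le> ereal (4 * limit_density + d)"
          using upper_bound[OF \<Phi> d]
        proof eventually_elim
          case (elim \<epsilon>)
          then obtain P u where P: "P \<in> Linf \<Omega> sym_matrices" "director_field \<epsilon> \<Omega> P u"
            "\<forall>\<phi>\<in>\<Phi>. \<bar>(\<integral>x. P x \<bullet> \<phi> x \<partial>lebesgue_on \<Omega>) - (\<integral>x. Q x \<bullet> \<phi> x \<partial>lebesgue_on \<Omega>)\<bar> < r"
            "(\<Sum>(i, j)\<in>neighbours \<epsilon> \<Omega>. \<epsilon>\<^sup>2 * h \<bar>u i \<bullet> u j\<bar>) \<le> 4 * limit_density + d" by blast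
          have "P \<in> U" using P(3) pair \<Phi>(2) by (intro nbhd[OF P(1)]) (simp add: subset_iff)
          then have "(INF P\<in>U. F_eps f \<Omega> \<epsilon> P) \<le> F_eps f \<Omega> \<epsilon> P" by (rule INF_lower)
          also have "\<dots> \<le> ereal (\<Sum>(i, j)\<in>neighbours \<epsilon> \<Omega>. \<epsilon>\<^sup>2 * f (u i) (u j))"
            unfolding F_eps_def using P(2) by (intro Inf_lower) blast
          also have "\<dots> \<le> ereal (4 * limit_density + d)" using P(4) energy[OF P(2)] by simp
          finally show ?case .
        qed
        then show "Limsup (at_right 0) (\<lambda>\<epsilon>. INF P\<in>U. F_eps f \<Omega> \<epsilon> P) \<le> ereal (4 * limit_density) + ereal d"
          by (intro Limsup_bounded) simp
      qed
    qed
    show ?thesis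
      unfolding lim using antisym[OF order_trans[OF lils upper] lower] antisym[OF upper order_trans[OF lower lils]]
      by blast
  qed
qed

end
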